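(* For every knot $K\subset\mathbb{R}^3$, the sequence of polynomials $A_K^n(\lambda,\mu)$, $n\ge1$, stabilizes; that is, there is $N$ such that $A_K^n(\lambda,\mu)=A_K^N(\lambda,\mu)$ (up to units) for all $n\ge N$.
   Context: Let $\pi_K$ be the knot group of $K$, $m\in\pi_K$ a meridian and $\ell\in\pi_K$ the $0$-framed longitude commuting with $m$. A homomorphism $\rho:\pi_K\to\mathrm{GL}(V)$, $\dim_{\mathbb C}V=n$, is a KCH representation of degree $n$ if $\rho(m)$ is diagonalizable and has $1$ as an eigenvalue with multiplicity exactly $n-1$. Let $e_1$ be an eigenvector of $\rho(m)$ for the remaining eigenvalue $\mu_0\ne1$; since $\ell$ commutes with $m$, $\rho(\ell)e_1=\lambda_0e_1$ for some $\lambda_0\in\mathbb{C}^*$. Let $U_K^n\subset(\mathbb{C}^* )^2$ be the set of all pairs $(\lambda_0,\mu_0)$ arising from KCH representations of degree $n$. The $n$-dimensional $A$-polynomial $A_K^n(\lambda,\mu)$ is the reduced polynomial (no repeated factors), defined up to a unit in $\mathbb{C}[\lambda^{\pm1},\mu^{\pm1}]$, whose zero locus is the 1-dimensional part of the closure of $U_K^n$ (it is defined when there is no 2-dimensional component). *)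

theory Defs
  imports
    "HOL-Analysis.Analysis"
    "HOL-Algebra.Generated_Groups"
    "HOL-Library.Poly_Mapping"
    "HOL-Computational_Algebra.Squarefree"
    "Jordan_Normal_Form.Char_Poly"
begin

section \<open>The fundamental group\<close>

definition loops_at :: "'a::topological_space set \<Rightarrow> 'a \<Rightarrow> (real \<Rightarrow> 'a) set" where
  "loops_at S x = {p. path p \<and> path_image p \<subseteq> S \<and> pathstart p = x \<and> pathfinish p = x}"

definition path_class :: "'a::topological_space set \<Rightarrow> (real \<Rightarrow> 'a) \<Rightarrow> (real \<Rightarrow> 'a) set" where
  "path_class S p = {q. homotopic_paths S p q}"

definition fundamental_group ::
    "'a::topological_space set \<Rightarrow> 'a \<Rightarrow> (real \<Rightarrow> 'a) set monoid" where
  "fundamental_group S x =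
     \<lparr>carrier = path_class S ` loops_at S x,
      mult = (\<lambda>A B. \<Union>p\<in>A. \<Union>q\<in>B. path_class S (p +++ q)),
      one = path_class S (\<lambda>_. x)\<rparr>"

lemma path_class_eq:
  "homotopic_paths S p q \<Longrightarrow> path_class S p = path_class S q"
  unfolding path_class_def
  by (auto intro: homotopic_paths_trans homotopic_paths_sym)

lemma fundamental_group_mult:
  assumes "p \<in> loops_at S x" "q \<in> loops_at S x"
  shows "path_class S p \<otimes>\<^bsub>fundamental_group S x\<^esub> path_class S q = path_class S (p +++ q)"
proof -
  have "path_class S (p' +++ q') = path_class S (p +++ q)"
    if "p' \<in> path_class S p" "q' \<in> path_class S q" for p' q'
  proof (rule path_class_eq, rule homotopic_paths_sym, rule homotopic_paths_join)
    show "pathfinish p = pathstart q" using assms by (simp add: loops_at_def)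
  qed (use that in \<open>auto simp: path_class_def\<close>)
  then have "(\<Union>p'\<in>path_class S p. \<Union>q'\<in>path_class S q. path_class S (p' +++ q')) =
      (\<Union>p'\<in>path_class S p. \<Union>q'\<in>path_class S q. path_class S (p +++ q))"
    by (intro SUP_cong refl)
  moreover have "p \<in> path_class S p" "q \<in> path_class S q"
    using assms by (auto simp: path_class_def loops_at_def)
  ultimately show ?thesis
    unfolding fundamental_group_def by auto
qed

lemma group_fundamental_group:
  fixes S :: "'a::real_normed_vector set"
  assumes "x \<in> S"
  shows "group (fundamental_group S x)"
proof (rule groupI)
  let ?G = "fundamental_group S x"
  have car: "carrier ?G = path_class S ` loops_at S x"
    and one: "\<one>\<^bsub>?G\<^esub> = path_class S (linepath x x)"
    by (auto simp: fundamental_group_def linepath_refl)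
  have join: "p +++ q \<in> loops_at S x" if "p \<in> loops_at S x" "q \<in> loops_at S x" for p q
    using that by (auto simp: loops_at_def path_image_join)
  have const: "linepath x x \<in> loops_at S x"
    using assms by (auto simp: loops_at_def)
  show "\<one>\<^bsub>?G\<^esub> \<in> carrier ?G"
    using const by (auto simp: car one)
  fix A B assume "A \<in> carrier ?G" "B \<in> carrier ?G"
  then obtain p q where p: "p \<in> loops_at S x" "A = path_class S p"
    and q: "q \<in> loops_at S x" "B = path_class S q"
    by (auto simp: car)
  show "A \<otimes>\<^bsub>?G\<^esub> B \<in> carrier ?G"
    using p q join by (auto simp: car fundamental_group_mult)
  show "A \<otimes>\<^bsub>?G\<^esub> B \<otimes>\<^bsub>?G\<^esub> C = A \<otimes>\<^bsub>?G\<^esub> (B \<otimes>\<^bsub>?G\<^esub> C)" if C: "C \<in> carrier ?G" for C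
  proof -
    obtain r where r: "r \<in> loops_at S x" "C = path_class S r"
      using C by (auto simp: car)
    have "homotopic_paths S ((p +++ q) +++ r) (p +++ (q +++ r))"
      using p q r by (intro homotopic_paths_sym[OF homotopic_paths_assoc]) (auto simp: loops_at_def)
    from path_class_eq[OF this] show ?thesis
      using p q r join by (simp add: fundamental_group_mult)
  qed
next
  let ?G = "fundamental_group S x"
  fix A assume "A \<in> carrier ?G"
  then obtain p where p: "p \<in> loops_at S x" "A = path_class S p"
    by (auto simp: fundamental_group_def)
  have const: "linepath x x \<in> loops_at S x"
    using assms by (auto simp: loops_at_def)
  have one: "\<one>\<^bsub>?G\<^esub> = path_class S (linepath x x)"
    by (auto simp: fundamental_group_def linepath_refl)
  have "homotopic_paths S (linepath x x +++ p) p"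
    using p homotopic_paths_lid[of p S] by (auto simp: loops_at_def)
  from path_class_eq[OF this] show "\<one>\<^bsub>?G\<^esub> \<otimes>\<^bsub>?G\<^esub> A = A"
    using p const by (simp add: one fundamental_group_mult)
  have rev: "reversepath p \<in> loops_at S x"
    using p by (auto simp: loops_at_def)
  have "homotopic_paths S (reversepath p +++ p) (linepath x x)"
    using p homotopic_paths_linv[of p S] by (auto simp: loops_at_def)
  from path_class_eq[OF this]
  have "path_class S (reversepath p) \<otimes>\<^bsub>?G\<^esub> A = \<one>\<^bsub>?G\<^esub>"
    using p rev by (simp add: one fundamental_group_mult)
  then show "\<exists>B\<in>carrier ?G. B \<otimes>\<^bsub>?G\<^esub> A = \<one>\<^bsub>?G\<^esub>"
    using rev by (auto simp: fundamental_group_def)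
qed

section \<open>Knots, meridians and longitudes\<close>

text \<open>
  Knots are tame: \<open>K\<close> is the core of an embedded solid torus. This covers smooth and polygonal
  knots and excludes wild ones, which have no meridian. (An injective continuous map on a compact
  set is an embedding.)
\<close>
definition tubular_neighbourhood :: "(real^3) set \<Rightarrow> (complex \<times> complex \<Rightarrow> real^3) \<Rightarrow> bool" where
  "tubular_neighbourhood K \<Phi> \<longleftrightarrow>
     continuous_on (sphere 0 1 \<times> cball 0 1) \<Phi> \<and>
     inj_on \<Phi> (sphere 0 1 \<times> cball 0 1) \<and>
     \<Phi> ` (sphere 0 1 \<times> {0}) = K"

definition is_knot :: "(real^3) set \<Rightarrow> bool" where
  "is_knot K \<longleftrightarrow> (\<exists>\<Phi>. tubular_neighbourhood K \<Phi>)"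

abbreviation knot_group :: "(real^3) set \<Rightarrow> real^3 \<Rightarrow> (real \<Rightarrow> real^3) set monoid" where
  "knot_group K x \<equiv> fundamental_group (- K) x"

text \<open>
  Both loops lie on the boundary torus and are joined to the base point by the same path \<open>g\<close>, so
  their classes commute. The longitude is \<open>0\<close>-framed when it is null-homologous in the complement,
  the first homology group being the abelianization of the knot group. Orientations of the
  meridian and the longitude are left free.
\<close>
definition meridian_longitude ::
    "(real^3) set \<Rightarrow> real^3 \<Rightarrow> (real \<Rightarrow> real^3) set \<Rightarrow> (real \<Rightarrow> real^3) set \<Rightarrow> bool" where
  "meridian_longitude K x m l \<longleftrightarrow>
     (\<exists>\<Phi> g. tubular_neighbourhood K \<Phi> \<and>
        path g \<and> path_image g \<subseteq> - K \<and> pathstart g = x \<and> pathfinish g = \<Phi> (1, 1) \<and>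
        m = path_class (- K) (g +++ (\<lambda>t. \<Phi> (1, cis (2 * pi * t))) +++ reversepath g) \<and>
        l = path_class (- K) (g +++ (\<lambda>t. \<Phi> (cis (2 * pi * t), 1)) +++ reversepath g) \<and>
        l \<in> derived (knot_group K x) (carrier (knot_group K x)))"

section \<open>KCH representations\<close>

abbreviation general_linear_group :: "nat \<Rightarrow> complex mat monoid" where
  "general_linear_group n \<equiv> units_of (ring_mat TYPE(complex) n ())"

definition diagonalizable :: "complex mat \<Rightarrow> bool" where
  "diagonalizable A \<longleftrightarrow> (\<exists>D. diagonal_mat D \<and> similar_mat A D)"

definition KCH_representation ::
    "('g, 'b) monoid_scheme \<Rightarrow> 'g \<Rightarrow> nat \<Rightarrow> ('g \<Rightarrow> complex mat) \<Rightarrow> bool" where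
  "KCH_representation G m n \<rho> \<longleftrightarrow>
     1 \<le> n \<and> \<rho> \<in> hom G (general_linear_group n) \<and>
     diagonalizable (\<rho> m) \<and> Polynomial.order 1 (char_poly (\<rho> m)) = n - 1"

definition KCH_eigenvalues ::
    "('g, 'b) monoid_scheme \<Rightarrow> 'g \<Rightarrow> 'g \<Rightarrow> nat \<Rightarrow> (complex \<times> complex) set" where
  "KCH_eigenvalues G m l n =
     {(lam, mu). \<exists>\<rho> e. KCH_representation G m n \<rho> \<and>
        mu \<noteq> 1 \<and> eigenvector (\<rho> m) e mu \<and> eigenvector (\<rho> l) e lam}"

section \<open>Algebraic subsets of the two-dimensional torus\<close>

text \<open>The monoid algebra of \<open>\<int>\<^sup>2\<close>, i.e. the ring of Laurent polynomials in \<open>\<lambda>\<close> and \<open>\<mu>\<close>.\<close>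
type_synonym laurent2 = "(int \<times> int) \<Rightarrow>\<^sub>0 complex"

definition laurent_eval :: "laurent2 \<Rightarrow> complex \<times> complex \<Rightarrow> complex" where
  "laurent_eval p = (\<lambda>(a, b).
     \<Sum>(i, j)\<in>Poly_Mapping.keys p. Poly_Mapping.lookup p (i, j) * (a powi i) * (b powi j))"

definition torus2 :: "(complex \<times> complex) set" where
  "torus2 = (- {0}) \<times> (- {0})"

definition zero_locus :: "laurent2 set \<Rightarrow> (complex \<times> complex) set" where
  "zero_locus P = {z \<in> torus2. \<forall>p\<in>P. laurent_eval p z = 0}"

definition algebraic_set :: "(complex \<times> complex) set \<Rightarrow> bool" where
  "algebraic_set Z \<longleftrightarrow> (\<exists>P. Z = zero_locus P)"

definition irreducible_set :: "(complex \<times> complex) set \<Rightarrow> bool" where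
  "irreducible_set Z \<longleftrightarrow> algebraic_set Z \<and> Z \<noteq> {} \<and>
     (\<forall>A B. algebraic_set A \<longrightarrow> algebraic_set B \<longrightarrow> Z = A \<union> B \<longrightarrow> Z = A \<or> Z = B)"

definition irreducible_component ::
    "(complex \<times> complex) set \<Rightarrow> (complex \<times> complex) set \<Rightarrow> bool" where
  "irreducible_component Z C \<longleftrightarrow> irreducible_set C \<and> C \<subseteq> Z \<and>
     (\<forall>D. irreducible_set D \<longrightarrow> C \<subseteq> D \<longrightarrow> D \<subseteq> Z \<longrightarrow> D = C)"

definition irreducible_chain :: "(complex \<times> complex) set \<Rightarrow> nat \<Rightarrow> bool" where
  "irreducible_chain Z d \<longleftrightarrow>
     (\<exists>C. (\<forall>i\<le>d. irreducible_set (C i) \<and> C i \<subseteq> Z) \<and> (\<forall>i<d. C i \<subset> C (Suc i)))"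

text \<open>Krull dimension.\<close>
definition has_dimension :: "(complex \<times> complex) set \<Rightarrow> nat \<Rightarrow> bool" where
  "has_dimension Z d \<longleftrightarrow> irreducible_chain Z d \<and> \<not> irreducible_chain Z (Suc d)"

definition dimensional_part :: "nat \<Rightarrow> (complex \<times> complex) set \<Rightarrow> (complex \<times> complex) set" where
  "dimensional_part d Z = \<Union>{C. irreducible_component Z C \<and> has_dimension C d}"

section \<open>The \<open>n\<close>-dimensional A-polynomials\<close>

definition KCH_closure ::
    "('g, 'b) monoid_scheme \<Rightarrow> 'g \<Rightarrow> 'g \<Rightarrow> nat \<Rightarrow> (complex \<times> complex) set" where
  "KCH_closure G m l n = algebraic_set hull (KCH_eigenvalues G m l n)"

definition A_polynomial_defined :: "('g, 'b) monoid_scheme \<Rightarrow> 'g \<Rightarrow> 'g \<Rightarrow> nat \<Rightarrow> bool" where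
  "A_polynomial_defined G m l n \<longleftrightarrow>
     \<not> (\<exists>C. irreducible_component (KCH_closure G m l n) C \<and> has_dimension C 2)"

text \<open>A relation, since the polynomial is only determined up to a unit.\<close>
definition is_A_polynomial ::
    "('g, 'b) monoid_scheme \<Rightarrow> 'g \<Rightarrow> 'g \<Rightarrow> nat \<Rightarrow> laurent2 \<Rightarrow> bool" where
  "is_A_polynomial G m l n p \<longleftrightarrow>
     A_polynomial_defined G m l n \<and> squarefree p \<and>
     zero_locus {p} = dimensional_part 1 (KCH_closure G m l n)"

definition equal_up_to_unit :: "laurent2 \<Rightarrow> laurent2 \<Rightarrow> bool" where
  "equal_up_to_unit p q \<longleftrightarrow> (\<exists>u. u dvd 1 \<and> p = u * q)"

end

theory Submission
  imports Defs "HOL-Computational_Algebra.Field_as_Ring" "HOL-Computational_Algebra.Polynomial_Factorial"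
begin

text \<open>
  The knot group is generated by finitely many conjugates \<open>g m g\<inverse>\<close>, \<open>g \<in> F\<close>, of the meridian:
  it is finitely generated by compactness, and the conjugates of \<open>m\<close> generate it because \<open>\<real>\<^sup>3\<close> is simply
  connected and loops near \<open>K\<close> that do not run along \<open>K\<close> are powers of meridians. In a KCH
  representation \<open>\<rho>\<close> the matrix \<open>\<rho>(m) - 1\<close> has rank one and its image is spanned by \<open>e\<^sub>1\<close>, so the span of
  the vectors \<open>\<rho>(g) e\<^sub>1\<close>, \<open>g \<in> F\<close>, is invariant and carries a KCH representation of degree at most
  \<open>card F\<close> with the same \<open>(\<lambda>\<^sub>0, \<mu>\<^sub>0)\<close>. Adding trivial summands shows that \<open>U\<^sub>K\<^sup>n\<close> increases with \<open>n\<close>; so it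
  is constant for \<open>n \<ge> card F\<close>. Finally a squarefree Laurent polynomial is determined up to a unit by
  its zero locus (the Nullstellensatz for hypersurfaces of the torus).
\<close>

section \<open>Squarefree Laurent polynomials and their zero loci\<close>

text \<open>Both facts about generation come from one local statement: every point of space has
  arbitrarily small neighbourhoods U such that U - K is path connected and its loops at a fixed
  point represent powers of one conjugate of m. A Lebesgue number makes this uniform. A finite net
  of points then yields finitely many generators. Simple connectedness of space enters through rays
  from the origin, along which a flat connection with values in the quotient by the normal closure
  of m is trivialized; the obstacle is that rays may cross K, so their points are first pushed off K
  slightly. The two facts are merged by writing each of finitely many generators as a word in
  finitely many conjugates. On the linear side, a condition on the characteristic polynomial is
  awkward to restrict to subspaces. The image of m is therefore written as 1 + u v^T with v.u = mu -
  1, a form visibly inherited by summands and invariant subspaces. For uniqueness, monomials are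
  units of the Laurent ring, so primes associated to lambda or mu must be split off before
  polynomials are compared.\<close>

definition laurent_monom :: "complex \<Rightarrow> complex \<Rightarrow> int \<times> int \<Rightarrow> complex" where
  "laurent_monom a b k = a powi fst k * b powi snd k"

lemma laurent_monom_add:
  "a \<noteq> 0 \<Longrightarrow> b \<noteq> 0 \<Longrightarrow> laurent_monom a b (k + l) = laurent_monom a b k * laurent_monom a b l"
  by (simp add: laurent_monom_def power_int_add)

lemma laurent_eval_superset:
  assumes "finite A" "Poly_Mapping.keys p \<subseteq> A"
  shows "laurent_eval p (a, b) = (\<Sum>k\<in>A. Poly_Mapping.lookup p k * laurent_monom a b k)"
proof -
  have "laurent_eval p (a, b) = (\<Sum>k\<in>Poly_Mapping.keys p. Poly_Mapping.lookup p k * laurent_monom a b k)"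
    unfolding laurent_eval_def by (auto simp: laurent_monom_def case_prod_beta mult.assoc)
  also have "\<dots> = (\<Sum>k\<in>A. Poly_Mapping.lookup p k * laurent_monom a b k)"
    using assms by (intro sum.mono_neutral_left) (auto simp: in_keys_iff)
  finally show ?thesis .
qed

lemma laurent_eval_single:
  "laurent_eval (Poly_Mapping.single k c) (a, b) = c * laurent_monom a b k"
  by (subst laurent_eval_superset[of "{k}"]) auto

lemma laurent_eval_add:
  "laurent_eval (p + q) (a, b) = laurent_eval p (a, b) + laurent_eval q (a, b)"
proof -
  let ?A = "Poly_Mapping.keys p \<union> Poly_Mapping.keys q"
  have "Poly_Mapping.keys (p + q) \<subseteq> ?A" by (rule Poly_Mapping.keys_add)
  then show ?thesis
    by (simp add: laurent_eval_superset[of ?A] lookup_add ring_distribs sum.distrib)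
qed

lemma laurent_eval_sum:
  "laurent_eval (\<Sum>i\<in>I. f i) (a, b) = (\<Sum>i\<in>I. laurent_eval (f i) (a, b))"
proof (cases "finite I")
  case True
  then show ?thesis
    by induction (auto simp: laurent_eval_add laurent_eval_superset[of "{}"])
qed (auto simp: laurent_eval_superset[of "{}"])

lemma laurent_sum_single:
  fixes p :: laurent2
  shows "p = (\<Sum>k\<in>Poly_Mapping.keys p. Poly_Mapping.single k (Poly_Mapping.lookup p k))"
  by (rule poly_mapping_eqI) (auto simp: lookup_sum lookup_single when_def in_keys_iff)

lemma laurent_eval_mult:
  assumes "a \<noteq> 0" "b \<noteq> 0"
  shows "laurent_eval (p * q) (a, b) = laurent_eval p (a, b) * laurent_eval q (a, b)"
proof -
  let ?s = "\<lambda>p k. Poly_Mapping.single k (Poly_Mapping.lookup p k) :: laurent2"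
  have "p * q = (\<Sum>k\<in>Poly_Mapping.keys p. ?s p k) * (\<Sum>k\<in>Poly_Mapping.keys q. ?s q k)"
    using laurent_sum_single[of p] laurent_sum_single[of q] by simp
  also have "\<dots> = (\<Sum>k\<in>Poly_Mapping.keys p. \<Sum>l\<in>Poly_Mapping.keys q.
      Poly_Mapping.single (k + l) (Poly_Mapping.lookup p k * Poly_Mapping.lookup q l))"
    by (simp add: sum_product mult_single)
  finally have "laurent_eval (p * q) (a, b) = (\<Sum>k\<in>Poly_Mapping.keys p. \<Sum>l\<in>Poly_Mapping.keys q.
      (Poly_Mapping.lookup p k * laurent_monom a b k) * (Poly_Mapping.lookup q l * laurent_monom a b l))"
    by (simp add: laurent_eval_sum laurent_eval_single laurent_monom_add[OF assms] mult_ac)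
  then show ?thesis
    by (simp add: sum_product laurent_eval_superset[OF finite_keys subset_refl])
qed

lemma comm_ring_hom_laurent_eval:
  assumes "a \<noteq> 0" "b \<noteq> 0"
  shows "comm_ring_hom (\<lambda>p. laurent_eval p (a, b))"
proof
  show "laurent_eval 1 (a, b) = 1"
    using laurent_eval_single[of 0 1 a b]
    by (simp add: laurent_monom_def flip: single_one)
qed (use assms in \<open>auto simp: laurent_eval_add laurent_eval_mult laurent_eval_superset[of "{}"]\<close>)

text \<open>Factorizations are taken in \<open>\<complex>[\<lambda>][\<mu>]\<close>, which is known to be factorial.\<close>

definition laurent_const :: "complex \<Rightarrow> laurent2" where
  "laurent_const c = Poly_Mapping.single 0 c"

definition laurent_of_poly1 :: "complex poly \<Rightarrow> laurent2" where
  "laurent_of_poly1 f = poly (map_poly laurent_const f) (Poly_Mapping.single (1, 0) 1)"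

definition laurent_of_poly :: "complex poly poly \<Rightarrow> laurent2" where
  "laurent_of_poly P = poly (map_poly laurent_of_poly1 P) (Poly_Mapping.single (0, 1) 1)"

lemma comm_ring_hom_poly_map_poly:
  fixes h :: "'a::comm_ring_1 \<Rightarrow> 'b::comm_ring_1"
  assumes "comm_ring_hom h"
  shows "comm_ring_hom (\<lambda>p. poly (map_poly h p) x)"
proof -
  interpret h: comm_ring_hom h by fact
  interpret map_poly_comm_ring_hom h ..
  show ?thesis by standard (auto simp: hom_distribs)
qed

lemma comm_ring_hom_laurent_const: "comm_ring_hom laurent_const"
  by standard (auto simp: laurent_const_def single_add mult_single)

lemma comm_ring_hom_laurent_of_poly1: "comm_ring_hom laurent_of_poly1"
  unfolding laurent_of_poly1_def[abs_def]
  by (rule comm_ring_hom_poly_map_poly) (rule comm_ring_hom_laurent_const)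

interpretation laurent_of_poly: comm_ring_hom laurent_of_poly
  unfolding laurent_of_poly_def[abs_def]
  by (rule comm_ring_hom_poly_map_poly) (rule comm_ring_hom_laurent_of_poly1)

text \<open>The outer variable is mu and the inner one is lambda: \<open>poly P [:b:]\<close>
  substitutes the constant polynomial \<open>b\<close> for mu and leaves a polynomial in lambda,
  which is then taken at \<open>a\<close>.\<close>

lemma laurent_eval_of_poly:
  assumes "a \<noteq> 0" "b \<noteq> 0"
  shows "laurent_eval (laurent_of_poly P) (a, b) = poly (poly P [:b:]) a"
proof -
  interpret ev: comm_ring_hom "\<lambda>p. laurent_eval p (a, b)"
    by (rule comm_ring_hom_laurent_eval) fact+
  interpret c: comm_ring_hom laurent_const by (rule comm_ring_hom_laurent_const)
  interpret c1: comm_ring_hom laurent_of_poly1 by (rule comm_ring_hom_laurent_of_poly1)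
  have 1: "laurent_eval (laurent_of_poly1 f) (a, b) = poly f a" for f
    unfolding laurent_of_poly1_def
    by (simp add: ev.poly_map_poly[symmetric] map_poly_map_poly o_def laurent_const_def
        laurent_eval_single laurent_monom_def flip: ev.poly_map_poly)
  have "laurent_eval (laurent_of_poly P) (a, b) = poly (map_poly (\<lambda>f. poly f a) P) b"
    unfolding laurent_of_poly_def
    by (simp add: map_poly_map_poly o_def 1
        laurent_eval_single laurent_monom_def flip: ev.poly_map_poly)
  also have "\<dots> = poly (poly P [:b:]) a"
    using poly_hom.poly_map_poly[of a P "[:b:]"] by simp
  finally show ?thesis .
qed

lemma poly_eq_0_if_vanishes_off_0:
  fixes p :: "complex poly"
  assumes "\<And>x. x \<noteq> 0 \<Longrightarrow> poly p x = 0"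
  shows "p = 0"
proof (rule ccontr)
  assume "p \<noteq> 0"
  then have "finite {x. poly p x = 0}" by (rule poly_roots_finite)
  moreover have "UNIV - {0} \<subseteq> {x. poly p x = 0}" using assms by auto
  ultimately have "finite (UNIV - {0 :: complex})" by (rule finite_subset[rotated])
  then show False by (simp add: infinite_UNIV_char_0)
qed

text \<open>Substituting \<open>a\<close> for lambda in the coefficients gives a polynomial in mu
  with infinitely many roots, hence the zero polynomial.\<close>

lemma coeffs_vanish_if_vanishes_on_line:
  fixes Q :: "complex poly poly"
  assumes "\<And>b. b \<noteq> 0 \<Longrightarrow> poly (poly Q [:b:]) a = 0"
  shows "poly (coeff Q i) a = 0"
proof -
  have "map_poly (\<lambda>f. poly f a) Q = 0"
    using assms poly_hom.poly_map_poly[of a Q "[:b:]" for b]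
    by (intro poly_eq_0_if_vanishes_off_0) auto
  then have "coeff (map_poly (\<lambda>f. poly f a) Q) i = 0" by simp
  then show ?thesis by (simp add: coeff_map_poly)
qed

text \<open>Injectivity is tested on values: the torus meets each line lambda = \<open>a\<close>
  with \<open>a\<close> nonzero in infinitely many points, so every coefficient of \<open>P\<close>
  vanishes off 0.\<close>

lemma laurent_of_poly_eq_0:
  assumes "laurent_of_poly P = 0"
  shows "P = 0"
proof -
  have "poly (coeff P i) a = 0" if "a \<noteq> 0" for i a
    using that assms laurent_eval_of_poly[of a _ P] 
    by (intro coeffs_vanish_if_vanishes_on_line) (auto simp: laurent_eval_superset[of "{}"])
  then have "coeff P i = 0" for i by (intro poly_eq_0_if_vanishes_off_0)
  then show ?thesis by (intro poly_eqI) simp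
qed

lemma laurent_of_poly_inj: "laurent_of_poly P = laurent_of_poly Q \<Longrightarrow> P = Q"
  using laurent_of_poly_eq_0[of "P - Q"] by (simp add: laurent_of_poly.hom_minus)

abbreviation polyX :: "complex poly poly" where "polyX \<equiv> [:[:0, 1:]:]"
abbreviation polyY :: "complex poly poly" where "polyY \<equiv> [:0, 1:]"

lemma laurent_of_poly_X: "laurent_of_poly polyX = Poly_Mapping.single (1, 0) 1"
  and laurent_of_poly_Y: "laurent_of_poly polyY = Poly_Mapping.single (0, 1) 1"
  and laurent_of_poly_const: "laurent_of_poly [:[:c:]:] = Poly_Mapping.single 0 c"
proof -
  interpret c: comm_ring_hom laurent_const by (rule comm_ring_hom_laurent_const)
  interpret c1: comm_ring_hom laurent_of_poly1 by (rule comm_ring_hom_laurent_of_poly1)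
  show "laurent_of_poly polyX = Poly_Mapping.single (1, 0) 1"
    "laurent_of_poly polyY = Poly_Mapping.single (0, 1) 1"
    "laurent_of_poly [:[:c:]:] = Poly_Mapping.single 0 c"
    by (simp_all add: laurent_of_poly_def laurent_of_poly1_def
        c.map_poly_pCons_hom c1.map_poly_pCons_hom laurent_const_def)
qed

lemma single_power: "Poly_Mapping.single (i, j) 1 ^ n = (Poly_Mapping.single (int n * i, int n * j) 1 :: laurent2)"
  by (induction n) (auto simp: mult_single ring_distribs single_one[symmetric] zero_prod_def)

lemma laurent_of_poly_monom:
  "laurent_of_poly (polyX ^ i * polyY ^ j) = Poly_Mapping.single (int i, int j) 1"
  by (simp add: laurent_of_poly.hom_mult laurent_of_poly.hom_power laurent_of_poly_X
      laurent_of_poly_Y single_power mult_single)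

lemma laurent_monomial_is_unit: "(Poly_Mapping.single k 1 :: laurent2) dvd 1"
  by (rule dvdI[of _ _ "Poly_Mapping.single (-k) 1"]) (simp add: mult_single)

lemma laurent_clear_denominators:
  fixes p :: laurent2
  shows "\<exists>i j P. laurent_of_poly (polyX ^ i * polyY ^ j) * p = laurent_of_poly P"
proof -
  have "\<exists>i j P. laurent_of_poly (polyX ^ i * polyY ^ j) *
      (\<Sum>k\<in>A. Poly_Mapping.single k (c k)) = laurent_of_poly P"
    if "finite A" for A :: "(int \<times> int) set" and c
    using that
  proof induction
    case empty
    show ?case by (auto intro: exI[of _ 0])
  next
    case (insert k A)
    then obtain i j P where P: "laurent_of_poly (polyX ^ i * polyY ^ j) *
      (\<Sum>k\<in>A. Poly_Mapping.single k (c k)) = laurent_of_poly P" by blast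
    obtain s t where k: "k = (s, t)" by force
    \<comment> \<open>Multiplication by \<open>?M\<close> turns the exponents \<open>s\<close>,
      \<open>t\<close> into \<open>nat s\<close>, \<open>nat t\<close>. The monomials belonging to
      the single terms are simply multiplied together; no least common denominator is
      sought.\<close>
    let ?i = "nat (- s)" and ?j = "nat (- t)"
    let ?M = "polyX ^ ?i * polyY ^ ?j"
    have "laurent_of_poly ?M * Poly_Mapping.single k (c k) =
        laurent_of_poly (polyX ^ nat s * polyY ^ nat t * [:[:c k:]:])"
      unfolding laurent_of_poly.hom_mult[of _ "[:[:c k:]:]"] laurent_of_poly_monom
        laurent_of_poly_const
      by (simp add: mult_single k)
    then obtain P' where P': "laurent_of_poly ?M * Poly_Mapping.single k (c k) = laurent_of_poly P'"
      by blast
    have "polyX ^ (i + ?i) * polyY ^ (j + ?j) = (polyX ^ i * polyY ^ j) * ?M"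
      by (simp only: power_add mult_ac)
    then have "laurent_of_poly (polyX ^ (i + ?i) * polyY ^ (j + ?j)) =
        laurent_of_poly (polyX ^ i * polyY ^ j) * laurent_of_poly ?M"
      by (simp only: laurent_of_poly.hom_mult)
    then have "laurent_of_poly (polyX ^ (i + ?i) * polyY ^ (j + ?j)) *
        (\<Sum>k\<in>insert k A. Poly_Mapping.single k (c k)) =
        laurent_of_poly (polyX ^ i * polyY ^ j) * (laurent_of_poly ?M * Poly_Mapping.single k (c k)) +
        laurent_of_poly ?M * (laurent_of_poly (polyX ^ i * polyY ^ j) * (\<Sum>k\<in>A. Poly_Mapping.single k (c k)))"
      using insert by (simp only: sum.insert) (simp add: algebra_simps)
    also have "\<dots> = laurent_of_poly (polyX ^ i * polyY ^ j * P' + ?M * P)"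
      by (simp only: laurent_of_poly.hom_add laurent_of_poly.hom_mult[of _ P'] laurent_of_poly.hom_mult[of _ P] P P')
    finally show ?case by blast
  qed
  from this[of "Poly_Mapping.keys p" "Poly_Mapping.lookup p"] show ?thesis
    using laurent_sum_single[of p] by auto
qed

lemma laurent_unit_times_poly:
  fixes p :: laurent2
  shows "\<exists>u P. u dvd 1 \<and> p = u * laurent_of_poly P"
proof -
  obtain i j P where P: "laurent_of_poly (polyX ^ i * polyY ^ j) * p = laurent_of_poly P"
    using laurent_clear_denominators[of p] by blast
  let ?v = "Poly_Mapping.single (- int i, - int j) 1 :: laurent2"
  have "?v * (laurent_of_poly (polyX ^ i * polyY ^ j) * p) = p"
    unfolding laurent_of_poly_monom mult.assoc[symmetric] mult_single
    by (simp flip: zero_prod_def)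
  then have "p = ?v * laurent_of_poly P" by (simp add: P)
  then show ?thesis using laurent_monomial_is_unit by blast
qed

text \<open>Clearing denominators in an inverse of \<open>P\<close> makes \<open>P * S\<close> a
  monomial. Injectivity brings this equation back to the polynomial ring, where a prime divisor of a
  monomial divides one of the variables.\<close>

lemma prime_elem_dvd_if_laurent_unit:
  assumes "laurent_of_poly P dvd 1" "prime_elem P"
  shows "P dvd polyX \<or> P dvd polyY"
proof -
  obtain s where s: "1 = laurent_of_poly P * s" using assms(1) by blast
  obtain i j S where S: "laurent_of_poly (polyX ^ i * polyY ^ j) * s = laurent_of_poly S"
    using laurent_clear_denominators[of s] by blast
  have "laurent_of_poly (polyX ^ i * polyY ^ j) = laurent_of_poly (polyX ^ i * polyY ^ j) * (laurent_of_poly P * s)"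
    by (simp flip: s)
  also have "\<dots> = laurent_of_poly (P * S)"
    unfolding laurent_of_poly.hom_mult[of P] S[symmetric] by (simp only: mult_ac)
  finally have "polyX ^ i * polyY ^ j = P * S" by (rule laurent_of_poly_inj)
  then have "P dvd polyX ^ i * polyY ^ j" by simp
  then show ?thesis
    using assms(2) prime_elem_dvd_multD prime_elem_dvd_power by blast
qed

section \<open>Elimination and a Nullstellensatz for primes in the torus\<close>

text \<open>Bezout over the field C(lambda), with denominators cleared. A nonzero element
  \<open>D\<close> of least mu-degree in the ideal of \<pi> and \<open>Q\<close> divides both up to
  factors from C[lambda]; were its degree positive, primality would force \<pi> to divide
  \<open>Q\<close>.\<close>

lemma prime_elem_bezout:
  fixes \<pi> Q :: "complex poly poly"
  assumes \<pi>: "prime_elem \<pi>" and deg: "degree \<pi> > 0" and ndvd: "\<not> \<pi> dvd Q"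
  shows "\<exists>A B r. r \<noteq> 0 \<and> A * \<pi> + B * Q = [:r:]"
proof -
  define I where "I = {A * \<pi> + B * Q | A B. True}"
  have "1 * \<pi> + 0 * Q \<in> I" unfolding I_def by blast
  then have "\<pi> \<in> I" by simp
  have "0 * \<pi> + 1 * Q \<in> I" unfolding I_def by blast
  then have "Q \<in> I" by simp
  have "\<pi> \<noteq> 0" using deg by auto
  define d where "d = (LEAST d. \<exists>D\<in>I. D \<noteq> 0 \<and> degree D = d)"
  have "\<exists>d. \<exists>D\<in>I. D \<noteq> 0 \<and> degree D = d" using \<open>\<pi> \<in> I\<close> \<open>\<pi> \<noteq> 0\<close> by blast
  then have "\<exists>D\<in>I. D \<noteq> 0 \<and> degree D = d" unfolding d_def by (rule LeastI_ex)
  then obtain D where D: "D \<in> I" "D \<noteq> 0" "degree D = d" by blast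
  have least: "E = 0" if "E \<in> I" "degree E < d" for E
    using not_less_Least[of "degree E" "\<lambda>d. \<exists>D\<in>I. D \<noteq> 0 \<and> degree D = d"] that
    unfolding d_def[symmetric] by blast
  \<comment> \<open>The leading coefficient of \<open>D\<close> is not invertible in C[lambda],
    hence pseudo-division. The remainder lies in \<open>I\<close> and vanishes by minimality of
    \<open>d\<close>.\<close>
  have pseudo: "\<exists>a q. a \<noteq> 0 \<and> Polynomial.smult a f = D * q" if "f \<in> I" for f
  proof -
    obtain a q where aq: "a \<noteq> 0" "Polynomial.smult a f = D * q + pseudo_mod f D"
      and r: "pseudo_mod f D = 0 \<or> degree (pseudo_mod f D) < degree D"
      using pseudo_mod[OF D(2)] by blast
    from that D(1) obtain A B A' B' where "f = A * \<pi> + B * Q" "D = A' * \<pi> + B' * Q"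
      unfolding I_def by blast
    with aq(2) have "pseudo_mod f D = ([:a:] * A - q * A') * \<pi> + ([:a:] * B - q * B') * Q"
      by (simp add: algebra_simps smult_add_right)
    then have "pseudo_mod f D \<in> I" unfolding I_def by blast
    with r least D(3) have "pseudo_mod f D = 0" by auto
    with aq show ?thesis by auto
  qed
  have "d = 0"
  proof (rule ccontr)
    assume "d \<noteq> 0"
    obtain c S where c: "c \<noteq> 0" "Polynomial.smult c \<pi> = D * S" using pseudo[OF \<open>\<pi> \<in> I\<close>] by blast
    obtain c' S' where c': "c' \<noteq> 0" "Polynomial.smult c' Q = D * S'" using pseudo[OF \<open>Q \<in> I\<close>] by blast
    have "\<pi> dvd D * S" unfolding c(2)[symmetric] by (rule dvd_smult) simp
    then have "\<pi> dvd D \<or> \<pi> dvd S" using \<pi> prime_elem_dvd_multD by blast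
    then have "\<pi> dvd D"
    proof
      \<comment> \<open>Cancelling \<pi> leaves \<open>[:c:] = D * S''\<close>, which would make
        \<open>D\<close> constant in mu, against \<open>d \<noteq> 0\<close>.\<close>
      assume "\<pi> dvd S"
      then obtain S'' where "S = \<pi> * S''" by blast
      with c(2) have "\<pi> * [:c:] = \<pi> * (D * S'')" by (simp add: mult_ac)
      then have eq: "[:c:] = D * S''" using \<open>\<pi> \<noteq> 0\<close> by (metis mult_left_cancel)
      with c(1) have "S'' \<noteq> 0" by auto
      from eq have "degree (D * S'') = 0" by (metis degree_pCons_0)
      with \<open>S'' \<noteq> 0\<close> D \<open>d \<noteq> 0\<close> show ?thesis by (simp add: degree_mult_eq)
    qed
    then have "\<pi> dvd Polynomial.smult c' Q" unfolding c'(2) by simp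
    then have "\<pi> dvd [:c':] * Q" by simp
    then have "\<pi> dvd [:c':]" using \<pi> ndvd prime_elem_dvd_multD by blast
    then have "degree \<pi> \<le> degree [:c':]" using c'(1) by (intro dvd_imp_degree_le) auto
    with deg show False by simp
  qed
  with D obtain r where "D = [:r:]" by (metis degree_eq_zeroE)
  moreover from this D have "r \<noteq> 0" by auto
  moreover obtain A B where "D = A * \<pi> + B * Q" using D(1) unfolding I_def by blast
  ultimately show ?thesis by metis
qed

lemma complex_poly_has_root:
  fixes p :: "complex poly"
  assumes "degree p > 0"
  shows "\<exists>z. poly p z = 0"
  using assms fundamental_theorem_of_algebra[of p] by (auto simp: constant_degree)

text \<open>If \<pi> involves mu and does not divide \<open>Q\<close>, the two have a nonzero
  combination \<open>r\<close> in lambda alone, so common zeros lie over roots of \<open>r\<close>;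
  but \<pi> has zeros in the torus over almost every lambda. If \<pi> does not involve mu, it is
  linear in lambda up to a unit, and its zeros form a line.\<close>

lemma prime_elem_dvd_if_zeros_subset:
  fixes \<pi> Q :: "complex poly poly"
  assumes \<pi>: "prime_elem \<pi>" and nX: "\<not> \<pi> dvd polyX" and nY: "\<not> \<pi> dvd polyY"
    and zeros: "\<And>a b. a \<noteq> 0 \<Longrightarrow> b \<noteq> 0 \<Longrightarrow> poly (poly \<pi> [:b:]) a = 0 \<Longrightarrow> poly (poly Q [:b:]) a = 0"
  shows "\<pi> dvd Q"
proof (cases "degree \<pi> = 0")
  case True
  then obtain f where f: "\<pi> = [:f:]" by (metis degree_eq_zeroE)
  then have pf: "prime_elem f" using \<pi> by (simp add: prime_elem_const_poly_iff)
  then have "f \<noteq> 0" and "\<not> is_unit f" by (auto simp only: prime_elem_def)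
  then have "degree f > 0" using is_unit_iff_degree[OF \<open>f \<noteq> 0\<close>] by blast
  then obtain a where "poly f a = 0" using complex_poly_has_root by blast
  then obtain g where g: "f = [:-a, 1:] * g" unfolding poly_eq_0_iff_dvd by blast
  have "\<not> is_unit [:-a, 1:]" by (simp add: is_unit_iff_degree)
  then have "is_unit g" using pf prime_elem_multD g by blast
  then have fdvd: "f dvd [:-a, 1:]" unfolding g using mult_unit_dvd_iff dvd_refl by blast
  have "a \<noteq> 0"
  proof
    assume "a = 0"
    with fdvd have "f dvd [:0, 1:]" by simp
    then have "\<pi> dvd polyX" unfolding f by (auto elim!: dvdE)
    with nX show False by simp
  qed
  have "f dvd coeff Q i" for i
  proof -
    have "poly (coeff Q i) a = 0"
      using zeros[OF \<open>a \<noteq> 0\<close>] \<open>poly f a = 0\<close> f by (intro coeffs_vanish_if_vanishes_on_line) auto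
    then have "[:-a, 1:] dvd coeff Q i" by (simp add: poly_eq_0_iff_dvd)
    with fdvd show ?thesis by (rule dvd_trans)
  qed
  then show ?thesis unfolding f const_poly_dvd_iff by simp
next
  case False
  show ?thesis
  proof (rule ccontr)
    assume "\<not> \<pi> dvd Q"
    then obtain A B r where r: "r \<noteq> 0" "A * \<pi> + B * Q = [:r:]"
      using prime_elem_bezout[OF \<pi>] False by blast
    have c0: "coeff \<pi> 0 \<noteq> 0"
    proof
      \<comment> \<open>A prime divisible by mu is associated to mu, which \<open>nY\<close>
        excludes.\<close>
      assume "coeff \<pi> 0 = 0"
      then have "polyY dvd \<pi>" by (simp add: poly_eq_0_iff_dvd[of _ 0, simplified, symmetric] poly_0_coeff_0)
      then obtain s where s: "\<pi> = polyY * s" by blast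
      have "\<not> is_unit polyY" by (simp add: is_unit_poly_iff)
      then have "is_unit s" using prime_elem_multD[of polyY s] \<pi> s by blast
      then have "\<pi> dvd polyY" unfolding s using mult_unit_dvd_iff dvd_refl by blast
      with nY show False by simp
    qed
    \<comment> \<open>\<open>a\<close> avoids the roots of four factors: \<open>r\<close> for the
      final contradiction, the leading coefficient so that \<pi> stays nonconstant in mu over
      \<open>a\<close>, the constant coefficient so that its root \<open>b\<close> is nonzero, and
      lambda so that \<open>a\<close> is nonzero.\<close>
    let ?h = "r * lead_coeff \<pi> * coeff \<pi> 0 * [:0, 1:]"
    have "?h \<noteq> 0" using r c0 False by auto
    then obtain a where a: "poly ?h a \<noteq> 0" using poly_all_0_iff_0 by blast
    let ?p = "map_poly (\<lambda>f. poly f a) \<pi>"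
    have "coeff ?p (degree \<pi>) \<noteq> 0" using a by (simp add: coeff_map_poly)
    then have "degree ?p > 0" using False le_degree[of ?p "degree \<pi>"] by simp
    then obtain b where b: "poly ?p b = 0" using complex_poly_has_root by blast
    have "b \<noteq> 0"
    proof
      assume "b = 0"
      with b have "coeff ?p 0 = 0" by (simp add: poly_0_coeff_0)
      with a show False by (simp add: coeff_map_poly)
    qed
    have "a \<noteq> 0" using a by auto
    have "poly (poly \<pi> [:b:]) a = 0" using b poly_hom.poly_map_poly[of a \<pi> "[:b:]"] by simp
    moreover from this have "poly (poly Q [:b:]) a = 0" using zeros \<open>a \<noteq> 0\<close> \<open>b \<noteq> 0\<close> by blast
    moreover have "poly (poly (A * \<pi> + B * Q) [:b:]) a = poly r a" unfolding r(2) by simp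
    ultimately show False using a by simp
  qed
qed

text \<open>Primes dividing lambda or mu become units of the Laurent ring. Induction over a prime
  factorization moves them into \<open>u\<close>, so that \<open>P\<close> keeps only primes that
  have zeros in the torus to show for themselves.\<close>

lemma laurent_normal_form:
  assumes "p \<noteq> (0 :: laurent2)"
  shows "\<exists>u P. u dvd 1 \<and> p = u * laurent_of_poly P \<and> P \<noteq> 0 \<and>
    (\<forall>\<pi>. prime_elem \<pi> \<longrightarrow> \<pi> dvd P \<longrightarrow> \<not> \<pi> dvd polyX \<and> \<not> \<pi> dvd polyY)"
proof -
  let ?good = "\<lambda>P. \<forall>\<pi>. prime_elem \<pi> \<longrightarrow> \<pi> dvd P \<longrightarrow> \<not> \<pi> dvd polyX \<and> \<not> \<pi> dvd polyY"
  have unit_dvd: "laurent_of_poly \<pi> dvd 1" if "\<pi> dvd polyX \<or> \<pi> dvd polyY" for \<pi>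
    using that laurent_of_poly.hom_dvd[of \<pi> polyX] laurent_of_poly.hom_dvd[of \<pi> polyY]
      laurent_monomial_is_unit dvd_trans
    unfolding laurent_of_poly_X laurent_of_poly_Y by blast
  have "P \<noteq> 0 \<Longrightarrow> \<exists>u P'. u dvd 1 \<and> laurent_of_poly P = u * laurent_of_poly P' \<and> P' \<noteq> 0 \<and> ?good P'" for P
  proof (induction P rule: prime_divisors_induct)
    case zero
    then show ?case by simp
  next
    case (unit P)
    then have "laurent_of_poly P dvd 1" using laurent_of_poly.hom_dvd[of P 1] by simp
    moreover have "?good 1" using not_prime_elem_one by (auto dest: prime_elem_not_unit)
    ultimately show ?case by (intro exI[of _ "laurent_of_poly P"] exI[of _ 1]) auto
  next
    case (factor p P)
    then obtain u P' where IH: "u dvd 1" "laurent_of_poly P = u * laurent_of_poly P'" "P' \<noteq> 0" "?good P'"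
      by auto
    have p: "prime_elem p" using factor by simp
    show ?case
    proof (cases "p dvd polyX \<or> p dvd polyY")
      case True
      with IH unit_dvd[of p] show ?thesis
        by (intro exI[of _ "laurent_of_poly p * u"] exI[of _ P'])
          (auto simp: laurent_of_poly.hom_mult mult_ac)
    next
      case False
      have "?good (p * P')"
      proof (intro allI impI)
        fix \<pi> assume \<pi>: "prime_elem \<pi>" "\<pi> dvd p * P'"
        then have "\<pi> dvd p \<or> \<pi> dvd P'" using prime_elem_dvd_multD by blast
        then show "\<not> \<pi> dvd polyX \<and> \<not> \<pi> dvd polyY"
        proof
          assume "\<pi> dvd p"
          then obtain s where s: "p = \<pi> * s" by blast
          with p \<pi> have "is_unit s" using prime_elem_multD[of \<pi> s] prime_elem_not_unit by blast
          then have "p dvd \<pi>" unfolding s using mult_unit_dvd_iff dvd_refl by blast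
          with False dvd_trans show ?thesis by blast
        qed (use IH \<pi> in blast)
      qed
      with IH p show ?thesis
        by (intro exI[of _ u] exI[of _ "p * P'"]) (auto simp: laurent_of_poly.hom_mult mult_ac)
    qed
  qed
  moreover obtain v P where v: "v dvd 1" "p = v * laurent_of_poly P"
    using laurent_unit_times_poly by blast
  moreover have "P \<noteq> 0" using v assms by auto
  ultimately obtain u P' where "u dvd 1" "laurent_of_poly P = u * laurent_of_poly P'" "P' \<noteq> 0" "?good P'"
    by blast
  with v show ?thesis
    by (intro exI[of _ "v * u"] exI[of _ P']) (auto simp: mult.assoc)
qed

lemma zero_locus_singleton:
  "zero_locus {u * laurent_of_poly P} =
     {(a, b). a \<noteq> 0 \<and> b \<noteq> 0 \<and> poly (poly P [:b:]) a = 0}" if "u dvd 1"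
proof -
  have "laurent_eval u (a, b) \<noteq> 0" if "a \<noteq> 0" "b \<noteq> 0" for a b
  proof -
    interpret ev: comm_ring_hom "\<lambda>p. laurent_eval p (a, b)"
      by (rule comm_ring_hom_laurent_eval) fact+
    obtain v where "1 = u * v" using \<open>u dvd 1\<close> by blast
    then have "1 = laurent_eval u (a, b) * laurent_eval v (a, b)"
      using ev.hom_mult[of u v] ev.hom_one by simp
    then show ?thesis by auto
  qed
  then have "laurent_eval (u * laurent_of_poly P) (a, b) = 0 \<longleftrightarrow> poly (poly P [:b:]) a = 0"
    if "a \<noteq> 0" "b \<noteq> 0" for a b
    using that by (simp only: laurent_eval_mult laurent_eval_of_poly mult_eq_0_iff simp_thms)
  then show ?thesis unfolding zero_locus_def torus2_def by fast
qed

text \<open>A prime whose square divides \<open>P\<close> would be a unit of the Laurent ring, hence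
  divide lambda or mu, and such primes do not divide \<open>P\<close>.\<close>

lemma squarefree_laurent_of_poly:
  assumes "squarefree p" "p = u * laurent_of_poly P" "P \<noteq> 0"
    and good: "\<And>\<pi>. prime_elem \<pi> \<Longrightarrow> \<pi> dvd P \<Longrightarrow> \<not> \<pi> dvd polyX \<and> \<not> \<pi> dvd polyY"
  shows "squarefree P"
  unfolding squarefree_factorial_semiring[OF assms(3)]
proof (intro allI impI notI)
  fix \<pi> :: "complex poly poly"
  assume \<pi>: "prime \<pi>" "\<pi>\<^sup>2 dvd P"
  then have "laurent_of_poly \<pi> ^ 2 dvd p"
    using laurent_of_poly.hom_dvd[OF \<pi>(2)] assms(2) by (simp add: laurent_of_poly.hom_power)
  then have "laurent_of_poly \<pi> dvd 1" using assms(1) squarefreeD by blast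
  then have "\<pi> dvd polyX \<or> \<pi> dvd polyY" using \<pi> by (intro prime_elem_dvd_if_laurent_unit) auto
  moreover have "\<pi> dvd P" using \<pi>(2) by (metis dvd_power dvd_trans zero_less_numeral)
  ultimately show False using good[of \<pi>] \<pi>(1) by auto
qed

lemma squarefree_dvd_if_prime_divisors_dvd:
  fixes P Q :: "'a::factorial_semiring"
  assumes "squarefree P" "P \<noteq> 0" "Q \<noteq> 0" "\<And>\<pi>. prime \<pi> \<Longrightarrow> \<pi> dvd P \<Longrightarrow> \<pi> dvd Q"
  shows "P dvd Q"
proof (rule multiplicity_le_imp_dvd[OF assms(2)])
  fix \<pi> :: 'a assume \<pi>: "prime \<pi>"
  show "multiplicity \<pi> P \<le> multiplicity \<pi> Q"
  proof (cases "\<pi> dvd P")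
    case True
    then have "\<pi> dvd Q" using assms \<pi> by blast
    then have "multiplicity \<pi> Q \<ge> 1"
      using assms(3) \<pi> by (intro multiplicity_geI) auto
    moreover have "multiplicity \<pi> P \<le> 1"
      using assms(1,2) \<pi> squarefree_factorial_semiring'' by blast
    ultimately show ?thesis by simp
  qed (simp add: not_dvd_imp_multiplicity_0)
qed

text \<open>In the torus each prime factor of \<open>P\<close> vanishes only at zeros of
  \<open>Q\<close>, so it divides \<open>Q\<close>. As \<open>P\<close> is squarefree,
  \<open>P\<close> itself divides \<open>Q\<close>; by symmetry they differ by a unit.\<close>

lemma squarefree_laurent_unique:
  assumes "squarefree p" "squarefree q" "zero_locus {p} = zero_locus {q}"
  shows "equal_up_to_unit p q"
proof -
  have "p \<noteq> 0" "q \<noteq> 0" using assms by auto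
  then obtain u P v Q where P: "u dvd 1" "p = u * laurent_of_poly P" "P \<noteq> 0"
      "\<And>\<pi>. prime_elem \<pi> \<Longrightarrow> \<pi> dvd P \<Longrightarrow> \<not> \<pi> dvd polyX \<and> \<not> \<pi> dvd polyY"
    and Q: "v dvd 1" "q = v * laurent_of_poly Q" "Q \<noteq> 0"
      "\<And>\<pi>. prime_elem \<pi> \<Longrightarrow> \<pi> dvd Q \<Longrightarrow> \<not> \<pi> dvd polyX \<and> \<not> \<pi> dvd polyY"
    using laurent_normal_form[of p] laurent_normal_form[of q] by blast
  have zeros: "poly (poly P [:b:]) a = 0 \<longleftrightarrow> poly (poly Q [:b:]) a = 0" if "a \<noteq> 0" "b \<noteq> 0" for a b
    using assms(3) that unfolding P(2) Q(2) zero_locus_singleton[OF P(1)] zero_locus_singleton[OF Q(1)]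
    by blast
  have "P dvd Q"
  proof (rule squarefree_dvd_if_prime_divisors_dvd)
    show "squarefree P" using assms(1) P(2-) by (rule squarefree_laurent_of_poly)
    fix \<pi> assume \<pi>: "prime \<pi>" "\<pi> dvd P"
    then have "poly (poly P [:b:]) a = 0" if "poly (poly \<pi> [:b:]) a = 0" for a b
      using that by auto
    then show "\<pi> dvd Q"
      using P(4)[of \<pi>] \<pi> zeros by (intro prime_elem_dvd_if_zeros_subset) auto
  qed fact+
  moreover have "Q dvd P"
  proof (rule squarefree_dvd_if_prime_divisors_dvd)
    show "squarefree Q" using assms(2) Q(2-) by (rule squarefree_laurent_of_poly)
    fix \<pi> assume \<pi>: "prime \<pi>" "\<pi> dvd Q"
    then have "poly (poly Q [:b:]) a = 0" if "poly (poly \<pi> [:b:]) a = 0" for a b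
      using that by auto
    then show "\<pi> dvd P"
      using Q(4)[of \<pi>] \<pi> zeros by (intro prime_elem_dvd_if_zeros_subset) auto
  qed fact+
  ultimately obtain s w where sw: "Q = P * s" "P = Q * w" unfolding dvd_def by blast
  have "P * 1 = P * (s * w)" by (subst (1) sw(2)) (simp only: sw(1) mult.assoc mult_1_right)
  then have "1 = s * w" using P(3) mult_left_cancel by blast
  then have w: "is_unit w" "P = w * Q" using sw(2) dvd_triv_right[of w s] by (simp_all only: mult.commute)
  have "laurent_of_poly w dvd 1" using w(1) laurent_of_poly.hom_dvd[of w 1] by simp
  moreover obtain v' where v': "1 = v * v'" using Q(1) by blast
  moreover from v' have "v' dvd 1" by (metis dvd_triv_right)
  ultimately have "u * laurent_of_poly w * v' dvd 1 * 1 * 1" using P(1) by (intro mult_dvd_mono)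
  then have "u * laurent_of_poly w * v' dvd 1" by simp
  moreover have "p = (u * laurent_of_poly w * v') * q"
  proof -
    have "(u * laurent_of_poly w * v') * q = u * laurent_of_poly w * laurent_of_poly Q * (v * v')"
      unfolding Q(2) by (simp only: mult_ac)
    also have "\<dots> = u * laurent_of_poly (w * Q)"
      by (simp only: v'[symmetric] laurent_of_poly.hom_mult mult.assoc mult_1_right)
    finally show ?thesis unfolding P(2) by (simp only: w(2)[symmetric])
  qed
  ultimately show ?thesis unfolding equal_up_to_unit_def by blast
qed

section \<open>The degree of KCH representations\<close>

unbundle no vec_syntax

definition outer :: "'a::times vec \<Rightarrow> 'a vec \<Rightarrow> 'a mat" where
  "outer u v = mat (dim_vec u) (dim_vec v) (\<lambda>(i, j). u $ i * v $ j)"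

lemma outer_carrier [simp]:
  "u \<in> carrier_vec n \<Longrightarrow> v \<in> carrier_vec k \<Longrightarrow> outer u v \<in> carrier_mat n k"
  by (auto simp: outer_def)

lemma mult_outer:
  fixes u v :: "'a::comm_semiring_0 vec"
  assumes "A \<in> carrier_mat r n" "u \<in> carrier_vec n" "v \<in> carrier_vec k"
  shows "A * outer u v = outer (A *\<^sub>v u) v"
  using assms by (intro eq_matI) (auto simp: outer_def scalar_prod_def sum_distrib_right mult.assoc)

lemma outer_mult:
  fixes u v :: "'a::comm_semiring_0 vec"
  assumes "A \<in> carrier_mat k n" "u \<in> carrier_vec r" "v \<in> carrier_vec k"
  shows "outer u v * A = outer u (transpose_mat A *\<^sub>v v)"
  using assms
  by (intro eq_matI) (auto simp: outer_def scalar_prod_def sum_distrib_left mult_ac)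

lemma outer_mult_vec:
  fixes u v :: "'a::comm_semiring_0 vec"
  assumes "u \<in> carrier_vec r" "v \<in> carrier_vec k" "w \<in> carrier_vec k"
  shows "outer u v *\<^sub>v w = scalar_prod v w \<cdot>\<^sub>v u"
  using assms
  by (intro eq_vecI) (auto simp: outer_def scalar_prod_def sum_distrib_left mult_ac)

lemma outer_smult:
  fixes u v :: "'a::comm_semiring_0 vec"
  shows "outer u (c \<cdot>\<^sub>v v) = outer (c \<cdot>\<^sub>v u) v"
  by (intro eq_matI) (auto simp: outer_def mult_ac)

text \<open>For \<open>\<mu> \<noteq> 1\<close> these are the images of a meridian under KCH representations, with \<open>u\<close> spanning the
  \<open>\<mu>\<close>-eigenspace.\<close>
definition pseudo_reflection :: "nat \<Rightarrow> complex \<Rightarrow> complex mat \<Rightarrow> complex vec \<Rightarrow> complex vec \<Rightarrow> bool" where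
  "pseudo_reflection n \<mu> M u v \<longleftrightarrow>
     u \<in> carrier_vec n \<and> v \<in> carrier_vec n \<and> scalar_prod v u = \<mu> - 1 \<and> M = 1\<^sub>m n + outer u v"

lemma pseudo_reflection_carrier: "pseudo_reflection n \<mu> M u v \<Longrightarrow> M \<in> carrier_mat n n"
  by (auto simp: pseudo_reflection_def)

lemma pseudo_reflection_mult_vec:
  assumes "pseudo_reflection n \<mu> M u v" "w \<in> carrier_vec n"
  shows "M *\<^sub>v w = w + scalar_prod v w \<cdot>\<^sub>v u"
  using assms add_mult_distrib_mat_vec[of "1\<^sub>m n" n n "outer u v" w]
  by (auto simp: pseudo_reflection_def outer_mult_vec)

lemma pseudo_reflection_mult_mat:
  assumes "pseudo_reflection n \<mu> M u v" "A \<in> carrier_mat n k"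
  shows "M * A = A + outer u (transpose_mat A *\<^sub>v v)"
  using assms add_mult_distrib_mat[of "1\<^sub>m n" n n "outer u v" A]
  by (auto simp: pseudo_reflection_def outer_mult)

text \<open>P (1 + u v^T) Q = 1 + (P u) (Q^T v)^T, and the pairing of the two vectors is unchanged
  because Q P = 1.\<close>

lemma pseudo_reflection_conj:
  assumes M: "pseudo_reflection n \<mu> M u v"
    and PQ: "P \<in> carrier_mat n n" "Q \<in> carrier_mat n n" "P * Q = 1\<^sub>m n" "Q * P = 1\<^sub>m n"
  shows "pseudo_reflection n \<mu> (P * M * Q) (P *\<^sub>v u) (transpose_mat Q *\<^sub>v v)"
proof -
  have uv: "u \<in> carrier_vec n" "v \<in> carrier_vec n" "scalar_prod v u = \<mu> - 1" "M = 1\<^sub>m n + outer u v"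
    using M by (auto simp: pseudo_reflection_def)
  have tQ: "transpose_mat Q \<in> carrier_mat n n" using PQ by simp
  have "P * M = P + outer (P *\<^sub>v u) v"
    using uv PQ by (simp add: mult_add_distrib_mat[of _ n n _ n] mult_outer)
  also have "\<dots> * Q = 1\<^sub>m n + outer (P *\<^sub>v u) (transpose_mat Q *\<^sub>v v)"
    using uv PQ by (simp add: add_mult_distrib_mat[of _ n n _ _ n] outer_mult[of _ n n _ n])
  finally have 1: "P * M * Q = 1\<^sub>m n + outer (P *\<^sub>v u) (transpose_mat Q *\<^sub>v v)" .
  have "scalar_prod (transpose_mat Q *\<^sub>v v) (P *\<^sub>v u) = scalar_prod v (Q *\<^sub>v (P *\<^sub>v u))"
    using uv PQ by (intro transpose_vec_mult_scalar) auto
  also have "Q *\<^sub>v (P *\<^sub>v u) = u"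
    using uv PQ by (simp flip: assoc_mult_mat_vec)
  finally show ?thesis using 1 uv PQ tQ
    unfolding pseudo_reflection_def by (auto intro: mult_mat_vec_carrier)
qed

section \<open>Eigenvalues and diagonalizability of pseudo-reflections\<close>

lemma order_prod_list_linear:
  "Polynomial.order c (\<Prod>a\<leftarrow>as. [:- a, 1:]) = length (filter ((=) c) as)" for c :: complex
proof (induction as)
  case (Cons a as)
  have nz: "(\<Prod>a\<leftarrow>as. [:- a, 1:]) \<noteq> 0" by (auto simp: prod_list_zero_iff)
  have "Polynomial.order c [:- a, 1:] = (if c = a then 1 else 0)"
    by (auto simp: order_linear' )
  moreover have "[:- a, 1:] * (\<Prod>a\<leftarrow>as. [:- a, 1:]) \<noteq> 0" using nz by (simp only: mult_eq_0_iff) simp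
  ultimately show ?case using Cons by (simp add: order_mult del: mult_pCons_left)
qed (simp add: order_0I)

lemma order_char_poly_diagonal:
  fixes D :: "complex mat"
  assumes "D \<in> carrier_mat n n" "diagonal_mat D"
  shows "Polynomial.order c (char_poly D) = card {i. i < n \<and> D $$ (i, i) = c}"
proof -
  have "upper_triangular D" using assms by (auto simp: diagonal_mat_def)
  then have "Polynomial.order c (char_poly D) = length (filter ((=) c) (diag_mat D))"
    using char_poly_upper_triangular[OF assms(1)] by (simp only: order_prod_list_linear)
  also have "\<dots> = card {i. i < n \<and> D $$ (i, i) = c}"
    using assms(1) unfolding length_filter_conv_card
    by (intro arg_cong[where f = card]) (auto simp: diag_mat_def)
  finally show ?thesis .
qed

text \<open>The expansion of an entry of \<open>S * T\<close> in the diagonalization below: there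
  the first three sums are evaluated by Kronecker deltas and the last by the pairing of
  \<open>v\<close> and \<open>u\<close>.\<close>

lemma sum_product_differences:
  fixes p x r y :: "'b \<Rightarrow> 'a::comm_ring_1"
  shows "(\<Sum>l\<in>A. (p l - q * x l) * (r l - y l * s)) =
    (\<Sum>l\<in>A. p l * r l) - (\<Sum>l\<in>A. p l * y l) * s - q * (\<Sum>l\<in>A. x l * r l) + q * s * (\<Sum>l\<in>A. x l * y l)"
proof -
  have "(p l - q * x l) * (r l - y l * s) = p l * r l - p l * y l * s - q * (x l * r l) + q * s * (x l * y l)" for l
    by (simp add: algebra_simps)
  then show ?thesis by (simp only: sum.distrib sum_subtractf sum_distrib_left sum_distrib_right)
qed

text \<open>Since v.u = mu - 1 is nonzero, the space is the sum of the line of \<open>u\<close> and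
  the hyperplane annihilated by \<open>v\<close>; \<open>M\<close> is mu on the line and 1 on the
  hyperplane.\<close>

lemma pseudo_reflection_KCH:
  assumes M: "pseudo_reflection n \<mu> M u v" and \<mu>: "\<mu> \<noteq> 1"
  shows "1 \<le> n \<and> diagonalizable M \<and> Polynomial.order 1 (char_poly M) = n - 1"
proof -
  have uv: "u \<in> carrier_vec n" "v \<in> carrier_vec n" "scalar_prod v u = \<mu> - 1"
    using M by (auto simp: pseudo_reflection_def)
  define c where "c = \<mu> - 1"
  have c: "c \<noteq> 0" "(\<Sum>i<n. v $ i * u $ i) = c"
    using uv \<mu> by (auto simp: c_def scalar_prod_def atLeast0LessThan)
  then obtain k where k: "k < n" "v $ k \<noteq> 0" "u $ k \<noteq> 0"
    by (metis (no_types, lifting) lessThan_iff mult_eq_0_iff sum.neutral)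
  \<comment> \<open>An eigenbasis: column \<open>k\<close> is \<open>u\<close>, and the other
    columns \<open>e_j - (v_j / v_k) e_k\<close> form a basis of the hyperplane annihilated by
    \<open>v\<close>.\<close>
  define S where "S = mat n n (\<lambda>(i, j). if j = k then u $ i else
    (if i = j then 1 else 0) - (if i = k then v $ j / v $ k else 0))"
  \<comment> \<open>The inverse of \<open>S\<close>: row \<open>k\<close> reads off the coordinate
    along \<open>u\<close>, and the other rows are those of the projection onto the hyperplane along
    \<open>u\<close>.\<close>
  define T where "T = mat n n (\<lambda>(i, j). if i = k then v $ j / c else
    (if i = j then 1 else 0) - u $ i * v $ j / c)"
  define D where "D = mat n n (\<lambda>(i, j). if i = j then (if i = k then \<mu> else 1) else 0)"
  have car: "S \<in> carrier_mat n n" "T \<in> carrier_mat n n" "D \<in> carrier_mat n n"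
    by (auto simp: S_def T_def D_def)
  have ST: "S * T = 1\<^sub>m n"
  proof (intro eq_matI)
    fix i j assume "i < dim_row (1\<^sub>m n)" "j < dim_col (1\<^sub>m n)"
    then have ij: "i < n" "j < n" by auto
    define d :: "nat \<Rightarrow> nat \<Rightarrow> complex" where "d = (\<lambda>i j. if i = j then 1 else 0)"
    have dl: "(\<Sum>l<n. d i l * f l) = f i" and dr: "(\<Sum>l<n. f l * d l j) = f j" for f
    proof -
      have "(\<Sum>l<n. d i l * f l) = (\<Sum>l<n. if i = l then f l else 0)"
        "(\<Sum>l<n. f l * d l j) = (\<Sum>l<n. if l = j then f l else 0)"
        by (rule sum.cong; simp add: d_def)+
      then show "(\<Sum>l<n. d i l * f l) = f i" "(\<Sum>l<n. f l * d l j) = f j" using ij by simp_all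
    qed
    have "(S * T) $$ (i, j) = (\<Sum>l<n. S $$ (i, l) * T $$ (l, j))"
      using ij car by (simp add: scalar_prod_def atLeast0LessThan)
    also have "\<dots> = S $$ (i, k) * T $$ (k, j) + (\<Sum>l\<in>{..<n} - {k}. S $$ (i, l) * T $$ (l, j))"
      using k by (subst sum.remove[of _ k]) auto
    also have "(\<Sum>l\<in>{..<n} - {k}. S $$ (i, l) * T $$ (l, j)) =
        (\<Sum>l\<in>{..<n} - {k}. (d i l - d i k / v $ k * v $ l) * (d l j - u $ l * (v $ j / c)))"
      using ij by (intro sum.cong) (auto simp: S_def T_def d_def)
    \<comment> \<open>The first factor is zero at \<open>l = k\<close>, so the omitted index can be
      restored.\<close>
    also have "\<dots> = (\<Sum>l<n. (d i l - d i k / v $ k * v $ l) * (d l j - u $ l * (v $ j / c)))"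
      using k by (subst sum.remove[of "{..<n}" k]) auto
    also have "\<dots> = d i j - u $ i * (v $ j / c) - d i k / v $ k * v $ j
        + d i k / v $ k * (v $ j / c) * (\<Sum>l<n. v $ l * u $ l)"
      unfolding sum_product_differences dl dr ..
    also have "(\<Sum>l<n. v $ l * u $ l) = c" by fact
    also have "S $$ (i, k) * T $$ (k, j) = u $ i * (v $ j / c)" using ij k by (simp add: S_def T_def)
    finally have "(S * T) $$ (i, j) = d i j" using c by simp
    then show "(S * T) $$ (i, j) = 1\<^sub>m n $$ (i, j)" using ij by (simp add: d_def)
  qed (use car in auto)
  then have TS: "T * S = 1\<^sub>m n" using car mat_mult_left_right_inverse by blast
  have MS: "M * S = S * D"
  proof (intro eq_matI)
    fix i j assume "i < dim_row (S * D)" "j < dim_col (S * D)"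
    then have ij: "i < n" "j < n" using car by auto
    have "(S * D) $$ (i, j) = (\<Sum>l<n. S $$ (i, l) * D $$ (l, j))"
      using ij car by (simp add: scalar_prod_def atLeast0LessThan)
    also have "\<dots> = (\<Sum>l<n. if l = j then S $$ (i, l) * D $$ (l, j) else 0)"
      using ij by (intro sum.cong) (auto simp: D_def)
    also have "\<dots> = S $$ (i, j) * D $$ (j, j)" using ij by simp
    finally have 1: "(S * D) $$ (i, j) = S $$ (i, j) * D $$ (j, j)" .
    have "(transpose_mat S *\<^sub>v v) $ j = (\<Sum>l<n. S $$ (l, j) * v $ l)"
      using ij car uv by (simp add: scalar_prod_def atLeast0LessThan)
    also have "\<dots> = (if j = k then c else 0)"
    proof (cases "j = k")
      case True
      then show ?thesis using ij c(2) by (simp add: S_def mult.commute)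
    next
      case False
      then have "(\<Sum>l<n. S $$ (l, j) * v $ l) =
          (\<Sum>l<n. (if l = j then v $ l else 0) - (if l = k then v $ j / v $ k * v $ l else 0))"
        using ij by (intro sum.cong) (auto simp: S_def)
      also have "\<dots> = 0" using ij k by (simp add: sum_subtractf)
      finally show ?thesis using False by simp
    qed
    finally have 2: "(transpose_mat S *\<^sub>v v) $ j = (if j = k then c else 0)" .
    have "(M * S) $$ (i, j) = S $$ (i, j) + u $ i * (transpose_mat S *\<^sub>v v) $ j"
      unfolding pseudo_reflection_mult_mat[OF M car(1)] using ij car uv by (simp add: outer_def del: index_mult_mat_vec)
    also have "\<dots> = (S * D) $$ (i, j)" unfolding 1 2 using ij by (simp add: D_def S_def c_def algebra_simps)
    finally show "(M * S) $$ (i, j) = (S * D) $$ (i, j)" .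
  qed (use car M in \<open>auto simp: pseudo_reflection_def outer_def\<close>)
  have Mc: "M \<in> carrier_mat n n" using M by (rule pseudo_reflection_carrier)
  have "M = M * (S * T)" using Mc ST by simp
  also have "\<dots> = S * D * T" using MS Mc car by (simp flip: assoc_mult_mat)
  finally have sim: "similar_mat M D" using car ST TS Mc by (intro similar_matI[of _ _ S T n]) auto
  have diag: "diagonal_mat D" by (auto simp: D_def diagonal_mat_def)
  have "Polynomial.order 1 (char_poly M) = card {i. i < n \<and> D $$ (i, i) = 1}"
    unfolding char_poly_similar[OF sim] by (rule order_char_poly_diagonal) fact+
  also have "{i. i < n \<and> D $$ (i, i) = 1} = {..<n} - {k}" using \<mu> by (auto simp: D_def)
  also have "card \<dots> = n - 1" using k by simp
  finally show ?thesis using sim diag k unfolding diagonalizable_def by auto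
qed

text \<open>The multiplicity condition leaves exactly one diagonal entry \<open>c\<close> other than
  1, so \<open>D\<close> is the identity plus a multiple of a matrix unit, and conjugation gives the
  rank-one form. That \<open>c\<close> equals mu is read off from the eigenvector.\<close>

lemma KCH_pseudo_reflection:
  assumes n: "1 \<le> n" and M: "M \<in> carrier_mat n n" "diagonalizable M"
    and ord: "Polynomial.order 1 (char_poly M) = n - 1"
    and ev: "eigenvector M e \<mu>" and \<mu>: "\<mu> \<noteq> 1"
  shows "\<exists>u v a. pseudo_reflection n \<mu> M u v \<and> e = a \<cdot>\<^sub>v u"
proof -
  obtain D where D: "diagonal_mat D" "similar_mat M D" using M(2) by (auto simp: diagonalizable_def)
  then obtain P Q where "similar_mat_wit M D P Q" by (auto simp: similar_mat_def)
  note PQ = similar_mat_witD2[OF M(1) this]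
  have "card {i. i < n \<and> D $$ (i, i) = 1} = n - 1"
    using ord order_char_poly_diagonal[OF PQ(5) D(1)] char_poly_similar[OF D(2)] by simp
  moreover have "card ({..<n} - {i. i < n \<and> D $$ (i, i) = 1}) = n - card {i. i < n \<and> D $$ (i, i) = 1}"
    by (subst card_Diff_subset) auto
  ultimately have "card ({..<n} - {i. i < n \<and> D $$ (i, i) = 1}) = 1" using n by simp
  then obtain k where k: "{..<n} - {i. i < n \<and> D $$ (i, i) = 1} = {k}" by (rule card_1_singletonE)
  then have kn: "k < n" by auto
  define c where "c = D $$ (k, k)"
  have D1: "D $$ (i, i) = 1" if "i < n" "i \<noteq> k" for i using k that by auto
  have "D = 1\<^sub>m n + outer (unit_vec n k) ((c - 1) \<cdot>\<^sub>v unit_vec n k)"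
    using D(1) PQ(5) kn D1 by (intro eq_matI) (auto simp: outer_def unit_vec_def c_def diagonal_mat_def)
  then have "pseudo_reflection n c D (unit_vec n k) ((c - 1) \<cdot>\<^sub>v unit_vec n k)"
    using kn by (auto simp: pseudo_reflection_def)
  from pseudo_reflection_conj[OF this PQ(6,7,1,2)] obtain u v where uv: "pseudo_reflection n c M u v"
    unfolding PQ(3)[symmetric] by blast
  have e: "e \<in> carrier_vec n" "e \<noteq> 0\<^sub>v n" "M *\<^sub>v e = \<mu> \<cdot>\<^sub>v e"
    using ev M(1) by (auto simp: eigenvector_def)
  have u: "u \<in> carrier_vec n" "v \<in> carrier_vec n" "scalar_prod v u = c - 1" using uv by (auto simp: pseudo_reflection_def)
  have "e + scalar_prod v e \<cdot>\<^sub>v u = \<mu> \<cdot>\<^sub>v e"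
    using pseudo_reflection_mult_vec[OF uv e(1)] e(3) by simp
  then have "(e + scalar_prod v e \<cdot>\<^sub>v u) $ i = (\<mu> \<cdot>\<^sub>v e) $ i" for i by simp
  \<comment> \<open>In vector form (mu - 1) e = (v.e) u. Division by mu - 1 makes \<open>e\<close> a
    multiple of \<open>u\<close>; pairing with \<open>v\<close> then identifies \<open>c\<close>
    with mu.\<close>
  then have eq: "scalar_prod v e * u $ i = (\<mu> - 1) * e $ i" if "i < n" for i
    using e(1) u that by (auto simp: algebra_simps dest!: meta_spec[of _ i])
  have eu: "e = (scalar_prod v e / (\<mu> - 1)) \<cdot>\<^sub>v u"
    using eq e(1) u \<mu> by (intro eq_vecI) (auto simp: field_simps)
  have "scalar_prod v e \<noteq> 0"
  proof
    assume "scalar_prod v e = 0"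
    with eu have "e = 0 \<cdot>\<^sub>v u" by simp
    then have "e = 0\<^sub>v n" using u by auto
    with e show False by simp
  qed
  moreover have "scalar_prod v e = (scalar_prod v e / (\<mu> - 1)) * (c - 1)"
    by (subst (1) eu) (use u in \<open>simp\<close>)
  ultimately have "c = \<mu>" using \<mu> by (auto simp: field_simps)
  with uv eu show ?thesis by blast
qed


section \<open>KCH representations in terms of pseudo-reflections\<close>

lemma general_linear_group_simps:
  "mult (general_linear_group n) = (*)" "\<one>\<^bsub>general_linear_group n\<^esub> = 1\<^sub>m n"
  "carrier (general_linear_group n) =
     {A \<in> carrier_mat n n. \<exists>B\<in>carrier_mat n n. B * A = 1\<^sub>m n \<and> A * B = 1\<^sub>m n}"
  by (auto simp: units_of_def Units_def ring_mat_simps)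

lemma group_general_linear_group: "group (general_linear_group n)"
proof -
  interpret ring "ring_mat TYPE(complex) n ()" by (rule ring_mat)
  show ?thesis by (rule units_group)
qed

lemma hom_general_linear_groupD:
  assumes "group G" "\<rho> \<in> hom G (general_linear_group n)"
  shows "x \<in> carrier G \<Longrightarrow> \<rho> x \<in> carrier_mat n n"
    and "x \<in> carrier G \<Longrightarrow> y \<in> carrier G \<Longrightarrow> \<rho> (x \<otimes>\<^bsub>G\<^esub> y) = \<rho> x * \<rho> y"
    and "\<rho> \<one>\<^bsub>G\<^esub> = 1\<^sub>m n"
    and "x \<in> carrier G \<Longrightarrow> \<rho> x * \<rho> (inv\<^bsub>G\<^esub> x) = 1\<^sub>m n"
    and "x \<in> carrier G \<Longrightarrow> \<rho> (inv\<^bsub>G\<^esub> x) * \<rho> x = 1\<^sub>m n"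
proof -
  interpret group G by fact
  interpret \<rho>: group_hom G "general_linear_group n" \<rho>
    using assms group_general_linear_group by (auto simp: group_hom_def group_hom_axioms_def)
  have *: "\<rho> x \<otimes>\<^bsub>general_linear_group n\<^esub> \<rho> y = \<rho> x * \<rho> y" for x y
    by (simp add: general_linear_group_simps)
  show one: "\<rho> \<one>\<^bsub>G\<^esub> = 1\<^sub>m n" using \<rho>.hom_one by (simp add: general_linear_group_simps)
  show mult: "\<rho> (x \<otimes>\<^bsub>G\<^esub> y) = \<rho> x * \<rho> y" if "x \<in> carrier G" "y \<in> carrier G" for x y
    using that \<rho>.hom_mult * by simp
  show "x \<in> carrier G \<Longrightarrow> \<rho> x \<in> carrier_mat n n"
    using \<rho>.hom_closed by (auto simp: general_linear_group_simps)
  show "\<rho> x * \<rho> (inv\<^bsub>G\<^esub> x) = 1\<^sub>m n" "\<rho> (inv\<^bsub>G\<^esub> x) * \<rho> x = 1\<^sub>m n" if "x \<in> carrier G"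
    using that mult[of x "inv\<^bsub>G\<^esub> x"] mult[of "inv\<^bsub>G\<^esub> x" x] one
    by (metis inv_closed r_inv, metis inv_closed l_inv)
qed

lemma hom_general_linear_groupI:
  assumes "group G"
    and car: "\<And>x. x \<in> carrier G \<Longrightarrow> \<rho> x \<in> carrier_mat n n"
    and mult: "\<And>x y. x \<in> carrier G \<Longrightarrow> y \<in> carrier G \<Longrightarrow> \<rho> (x \<otimes>\<^bsub>G\<^esub> y) = \<rho> x * \<rho> y"
    and one: "\<rho> \<one>\<^bsub>G\<^esub> = 1\<^sub>m n"
  shows "\<rho> \<in> hom G (general_linear_group n)"
proof -
  interpret group G by fact
  have "\<rho> x * \<rho> (inv\<^bsub>G\<^esub> x) = 1\<^sub>m n" "\<rho> (inv\<^bsub>G\<^esub> x) * \<rho> x = 1\<^sub>m n" if "x \<in> carrier G" for x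
    using that by (simp_all add: one flip: mult)
  then show ?thesis
    using car mult by (auto simp: hom_def general_linear_group_simps intro!: bexI[of _ "\<rho> (inv\<^bsub>G\<^esub> _)"])
qed

text \<open>The eigenvector for the remaining eigenvalue is a nonzero multiple of \<open>u\<close>
  and can be rescaled to \<open>u\<close>. The multiplicity condition becomes an equation that
  passes to direct sums and to invariant subspaces.\<close>

lemma KCH_eigenvalues_iff:
  assumes G: "group G" "m \<in> carrier G" "l \<in> carrier G"
  shows "(lam, mu) \<in> KCH_eigenvalues G m l n \<longleftrightarrow>
    (\<exists>\<rho> u v. \<rho> \<in> hom G (general_linear_group n) \<and> mu \<noteq> 1 \<and> u \<noteq> 0\<^sub>v n \<and>
       pseudo_reflection n mu (\<rho> m) u v \<and> \<rho> l *\<^sub>v u = lam \<cdot>\<^sub>v u)"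
proof
  assume "(lam, mu) \<in> KCH_eigenvalues G m l n"
  then obtain \<rho> e where \<rho>: "KCH_representation G m n \<rho>" "mu \<noteq> 1" "eigenvector (\<rho> m) e mu"
    "eigenvector (\<rho> l) e lam" by (auto simp: KCH_eigenvalues_def)
  then have hom: "\<rho> \<in> hom G (general_linear_group n)" and n: "1 \<le> n"
    by (auto simp: KCH_representation_def)
  note \<rho>D = hom_general_linear_groupD[OF G(1) hom]
  obtain u v a where uv: "pseudo_reflection n mu (\<rho> m) u v" "e = a \<cdot>\<^sub>v u"
    using KCH_pseudo_reflection[OF n \<rho>D(1)[OF G(2)] _ _ \<rho>(3,2)] \<rho>(1)
    by (auto simp: KCH_representation_def)
  have u: "u \<in> carrier_vec n" using uv by (auto simp: pseudo_reflection_def)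
  have e: "e \<noteq> 0\<^sub>v n" "\<rho> l *\<^sub>v e = lam \<cdot>\<^sub>v e"
    using \<rho>(4) \<rho>D(1)[OF G(3)] by (auto simp: eigenvector_def)
  have "a \<noteq> 0" "u \<noteq> 0\<^sub>v n"
    using e(1) uv(2) u by auto
  have "a \<cdot>\<^sub>v (\<rho> l *\<^sub>v u) = a \<cdot>\<^sub>v (lam \<cdot>\<^sub>v u)"
    using e(2) uv(2) u \<rho>D(1)[OF G(3)] by (simp add: mult_mat_vec smult_smult_assoc mult.commute)
  then have "inverse a \<cdot>\<^sub>v (a \<cdot>\<^sub>v (\<rho> l *\<^sub>v u)) = inverse a \<cdot>\<^sub>v (a \<cdot>\<^sub>v (lam \<cdot>\<^sub>v u))" by simp
  then have "\<rho> l *\<^sub>v u = lam \<cdot>\<^sub>v u"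
    using \<open>a \<noteq> 0\<close> by (simp add: smult_smult_assoc flip: mult.assoc)
  with hom \<rho>(2) uv \<open>u \<noteq> 0\<^sub>v n\<close> show "\<exists>\<rho> u v. \<rho> \<in> hom G (general_linear_group n) \<and> mu \<noteq> 1 \<and> u \<noteq> 0\<^sub>v n \<and>
       pseudo_reflection n mu (\<rho> m) u v \<and> \<rho> l *\<^sub>v u = lam \<cdot>\<^sub>v u" by blast
next
  assume "\<exists>\<rho> u v. \<rho> \<in> hom G (general_linear_group n) \<and> mu \<noteq> 1 \<and> u \<noteq> 0\<^sub>v n \<and>
       pseudo_reflection n mu (\<rho> m) u v \<and> \<rho> l *\<^sub>v u = lam \<cdot>\<^sub>v u"
  then obtain \<rho> u v where \<rho>: "\<rho> \<in> hom G (general_linear_group n)" "mu \<noteq> 1" "u \<noteq> 0\<^sub>v n"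
    and uv: "pseudo_reflection n mu (\<rho> m) u v" and l: "\<rho> l *\<^sub>v u = lam \<cdot>\<^sub>v u" by blast
  note \<rho>D = hom_general_linear_groupD[OF G(1) \<rho>(1)]
  have u: "u \<in> carrier_vec n" "scalar_prod v u = mu - 1" using uv by (auto simp: pseudo_reflection_def)
  have "\<rho> m *\<^sub>v u = u + (mu - 1) \<cdot>\<^sub>v u" using pseudo_reflection_mult_vec[OF uv u(1)] u by simp
  also have "\<dots> = mu \<cdot>\<^sub>v u" using u by (intro eq_vecI) (auto simp: algebra_simps)
  finally have "\<rho> m *\<^sub>v u = mu \<cdot>\<^sub>v u" .
  then have "eigenvector (\<rho> m) u mu" "eigenvector (\<rho> l) u lam"
    using \<rho>(3) u l \<rho>D(1)[OF G(2)] \<rho>D(1)[OF G(3)] by (auto simp: eigenvector_def)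
  with \<rho> pseudo_reflection_KCH[OF uv \<rho>(2)] show "(lam, mu) \<in> KCH_eigenvalues G m l n"
    unfolding KCH_eigenvalues_def KCH_representation_def by blast
qed

section \<open>Dependence of the eigenvalue set on the degree\<close>

lemma KCH_eigenvalues_mono:
  assumes G: "group G" "m \<in> carrier G" "l \<in> carrier G" and "d \<le> n"
  shows "KCH_eigenvalues G m l d \<subseteq> KCH_eigenvalues G m l n"
proof (rule subsetI, clarify)
  fix lam mu assume "(lam, mu) \<in> KCH_eigenvalues G m l d"
  then obtain \<rho> u v where \<rho>: "\<rho> \<in> hom G (general_linear_group d)" "mu \<noteq> 1" "u \<noteq> 0\<^sub>v d"
    and uv: "pseudo_reflection d mu (\<rho> m) u v" and l: "\<rho> l *\<^sub>v u = lam \<cdot>\<^sub>v u"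
    using KCH_eigenvalues_iff[OF G] by blast
  note \<rho>D = hom_general_linear_groupD[OF G(1) \<rho>(1)]
  have uvc: "u \<in> carrier_vec d" "v \<in> carrier_vec d" "scalar_prod v u = mu - 1"
    using uv by (auto simp: pseudo_reflection_def)
  define k where "k = n - d"
  have n: "n = d + k" using assms by (simp add: k_def)
  define \<sigma> where "\<sigma> = (\<lambda>g. four_block_mat (\<rho> g) (0\<^sub>m d k) (0\<^sub>m k d) (1\<^sub>m k))"
  have "\<sigma> \<in> hom G (general_linear_group n)"
  proof (rule hom_general_linear_groupI[OF G(1)])
    show "\<sigma> x \<in> carrier_mat n n" if "x \<in> carrier G" for x
      using \<rho>D(1)[OF that] by (simp add: \<sigma>_def n)
    show "\<sigma> (x \<otimes>\<^bsub>G\<^esub> y) = \<sigma> x * \<sigma> y" if "x \<in> carrier G" "y \<in> carrier G" for x y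
    proof -
      have c: "\<rho> x \<in> carrier_mat d d" "\<rho> y \<in> carrier_mat d d" using \<rho>D(1) that by auto
      have "\<sigma> x * \<sigma> y = four_block_mat (\<rho> x * \<rho> y + 0\<^sub>m d k * 0\<^sub>m k d) (\<rho> x * 0\<^sub>m d k + 0\<^sub>m d k * 1\<^sub>m k)
          (0\<^sub>m k d * \<rho> y + 1\<^sub>m k * 0\<^sub>m k d) (0\<^sub>m k d * 0\<^sub>m d k + 1\<^sub>m k * 1\<^sub>m k)"
        unfolding \<sigma>_def by (rule mult_four_block_mat) (use c in auto)
      then show ?thesis using c \<rho>D(2)[OF that] by (simp add: \<sigma>_def)
    qed
    show "\<sigma> \<one>\<^bsub>G\<^esub> = 1\<^sub>m n" unfolding \<sigma>_def \<rho>D(3) n by (intro eq_matI) auto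
  qed
  moreover have "u @\<^sub>v 0\<^sub>v k \<noteq> 0\<^sub>v n"
  proof
    assume "u @\<^sub>v 0\<^sub>v k = 0\<^sub>v n"
    then have "(u @\<^sub>v 0\<^sub>v k) $ i = 0" if "i < d" for i using that n by simp
    then have "u = 0\<^sub>v d" using uvc by (intro eq_vecI) auto
    with \<rho>(3) show False by simp
  qed
  moreover have "pseudo_reflection n mu (\<sigma> m) (u @\<^sub>v 0\<^sub>v k) (v @\<^sub>v 0\<^sub>v k)"
    unfolding pseudo_reflection_def
  proof (intro conjI)
    show "scalar_prod (v @\<^sub>v 0\<^sub>v k) (u @\<^sub>v 0\<^sub>v k) = mu - 1"
      using uvc by (simp add: scalar_prod_append[of _ d _ k])
    have "\<rho> m = 1\<^sub>m d + outer u v" using uv by (auto simp: pseudo_reflection_def)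
    then show "\<sigma> m = 1\<^sub>m n + outer (u @\<^sub>v 0\<^sub>v k) (v @\<^sub>v 0\<^sub>v k)"
      using uvc by (intro eq_matI) (auto simp: \<sigma>_def n outer_def)
  qed (use uvc n in auto)
  moreover have "\<sigma> l *\<^sub>v (u @\<^sub>v 0\<^sub>v k) = lam \<cdot>\<^sub>v (u @\<^sub>v 0\<^sub>v k)"
  proof -
    have c: "\<rho> l \<in> carrier_mat d d" using \<rho>D(1) G by auto
    have "\<sigma> l *\<^sub>v (u @\<^sub>v 0\<^sub>v k) = (\<rho> l *\<^sub>v u + 0\<^sub>m d k *\<^sub>v 0\<^sub>v k) @\<^sub>v (0\<^sub>m k d *\<^sub>v u + 1\<^sub>m k *\<^sub>v 0\<^sub>v k)"
      unfolding \<sigma>_def by (rule four_block_mat_mult_vec) (use c uvc in auto)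
    then show ?thesis using uvc l by (intro eq_vecI) auto
  qed
  ultimately show "(lam, mu) \<in> KCH_eigenvalues G m l n"
    using \<rho>(2) KCH_eigenvalues_iff[OF G] by blast
qed

text \<open>If the columns of \<open>E\<close> are dependent, one of them is redundant: \<open>C\<close> deletes it, and \<open>B\<close>
  expresses all columns by the remaining ones.\<close>
lemma redundant_column:
  fixes E :: "complex mat"
  assumes E: "E \<in> carrier_mat n d" and w: "w \<in> carrier_vec d" "w \<noteq> 0\<^sub>v d" "E *\<^sub>v w = 0\<^sub>v n"
  shows "\<exists>C B. d > 0 \<and> C \<in> carrier_mat d (d - 1) \<and> B \<in> carrier_mat (d - 1) d \<and> E * C * B = E"
proof -
  have "\<exists>k<d. w $ k \<noteq> 0" using w by (metis carrier_vecD eq_vecI index_zero_vec)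
  then obtain k where k: "k < d" "w $ k \<noteq> 0" by blast
  define s where "s = (\<lambda>i. if i < k then i else Suc i)"
  \<comment> \<open>\<open>X\<close> is 1 - w e_k^T / w_k. Its row \<open>k\<close> is zero, so it
    factors through the coordinates other than \<open>k\<close>, which \<open>s\<close> enumerates;
    \<open>E * X = E\<close> because \<open>E\<close> kills \<open>w\<close>.\<close>
  define X where "X = 1\<^sub>m d + outer w ((- inverse (w $ k)) \<cdot>\<^sub>v unit_vec d k)"
  define C :: "complex mat" where "C = mat d (d - 1) (\<lambda>(i, j). if i = s j then 1 else 0)"
  define B where "B = mat (d - 1) d (\<lambda>(i, j). X $$ (s i, j))"
  have X: "X \<in> carrier_mat d d" using w by (auto simp: X_def outer_def)
  have Xk: "X $$ (k, j) = 0" if "j < d" for j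
    using that k w by (auto simp: X_def outer_def unit_vec_def)
  have sd: "s i < d" if "i < d - 1" for i using that by (auto simp: s_def)
  have "C * B = X"
  proof (intro eq_matI)
    fix i j assume "i < dim_row X" "j < dim_col X"
    then have ij: "i < d" "j < d" using X by auto
    have "(C * B) $$ (i, j) = (\<Sum>l<d - 1. if i = s l then X $$ (s l, j) else 0)"
      using ij by (auto simp: C_def B_def scalar_prod_def atLeast0LessThan intro!: sum.cong)
    also have "\<dots> = X $$ (i, j)"
    proof (cases "i = k")
      case True
      then have "i \<noteq> s l" for l by (auto simp: s_def)
      then show ?thesis using True Xk ij by simp
    next
      case False
      define l0 where "l0 = (if i < k then i else i - 1)"
      have "i = s l \<longleftrightarrow> l = l0" for l using False by (auto simp: s_def l0_def)
      moreover have "s l0 = i" using False by (auto simp: s_def l0_def)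
      moreover have "l0 < d - 1" using False ij k by (auto simp: l0_def)
      ultimately show ?thesis by simp
    qed
    finally show "(C * B) $$ (i, j) = X $$ (i, j)" .
  qed (use X in \<open>auto simp: C_def B_def\<close>)
  moreover have "E * X = E"
  proof -
    have "E * X = E + outer (E *\<^sub>v w) ((- inverse (w $ k)) \<cdot>\<^sub>v unit_vec d k)"
      unfolding X_def using E w k
      by (subst mult_add_distrib_mat[of _ n d _ d]) (auto simp: mult_outer[of _ n d _ _ d])
    also have "\<dots> = E" using E unfolding w(3) by (intro eq_matI) (auto simp: outer_def)
    finally show ?thesis .
  qed
  moreover have "C \<in> carrier_mat d (d - 1)" "B \<in> carrier_mat (d - 1) d" by (auto simp: C_def B_def)
  ultimately show ?thesis using E k
    by (intro exI[of _ C] exI[of _ B]) (auto simp: assoc_mult_mat[of _ n d _ "d - 1" _ d])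
qed


text \<open>A KCH representation whose group is generated by the conjugates of the meridian by \<open>F\<close> restricts
  to the span of the vectors \<open>\<rho>(g) e\<^sub>1\<close> with \<open>g \<in> F\<close>; the columns of \<open>E\<close> are a basis of that span.\<close>
lemma KCH_eigenvalues_bounded_degree:
  assumes G: "group G" "m \<in> carrier G" "l \<in> carrier G"
    and F: "finite F" "F \<subseteq> carrier G" "\<one>\<^bsub>G\<^esub> \<in> F"
    and gen: "carrier G = generate G ((\<lambda>g. g \<otimes>\<^bsub>G\<^esub> m \<otimes>\<^bsub>G\<^esub> inv\<^bsub>G\<^esub> g) ` F)"
    and z: "(lam, mu) \<in> KCH_eigenvalues G m l n"
  shows "\<exists>d\<le>card F. (lam, mu) \<in> KCH_eigenvalues G m l d"
proof -
  interpret group G by fact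
  obtain \<rho> u v where \<rho>: "\<rho> \<in> hom G (general_linear_group n)" "mu \<noteq> 1" "u \<noteq> 0\<^sub>v n"
    and uv: "pseudo_reflection n mu (\<rho> m) u v" and l: "\<rho> l *\<^sub>v u = lam \<cdot>\<^sub>v u"
    using KCH_eigenvalues_iff[OF G] z by blast
  note \<rho>D = hom_general_linear_groupD[OF G(1) \<rho>(1)]
  have uvc: "u \<in> carrier_vec n" "v \<in> carrier_vec n" "scalar_prod v u = mu - 1"
    using uv by (auto simp: pseudo_reflection_def)
  \<comment> \<open>The column span of \<open>E\<close> is invariant and contains \<open>u\<close>,
    expressed by matrices acting on coordinates. Independence of the columns will come from
    minimality of \<open>d\<close>.\<close>
  define spanned where "spanned = (\<lambda>d E. E \<in> carrier_mat n d \<and>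
    (\<forall>g\<in>carrier G. \<exists>A\<in>carrier_mat d d. \<rho> g * E = E * A) \<and> (\<exists>w\<in>carrier_vec d. u = E *\<^sub>v w))"
  obtain gs where "set gs = F" "distinct gs" using finite_distinct_list[OF F(1)] by blast
  then have gs: "set gs = F" "length gs = card F" using distinct_card[of gs] by auto
  define W where "W = mat_of_cols n (map (\<lambda>g. \<rho> g *\<^sub>v u) gs)"
  have W: "W \<in> carrier_mat n (card F)" unfolding W_def using gs(2) by (metis length_map mat_of_cols_carrier(1))
  have col_W: "\<exists>a\<in>carrier_vec (card F). \<rho> g *\<^sub>v u = W *\<^sub>v a" if "g \<in> F" for g
  proof -
    have "g \<in> set gs" using that gs by simp
    then obtain k where "k < length gs" "gs ! k = g" unfolding in_set_conv_nth by blast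
    then have k: "k < card F" "gs ! k = g" using gs by auto
    have "\<rho> g *\<^sub>v u \<in> carrier_vec n" using \<rho>D(1) F(2) that uvc by (auto intro: mult_mat_vec_carrier)
    then have "col W k = \<rho> g *\<^sub>v u" using k gs by (simp add: W_def)
    moreover have "W *\<^sub>v unit_vec (card F) k = col W k" using W k by (intro eq_vecI) auto
    ultimately show ?thesis by (intro bexI[of _ "unit_vec (card F) k"]) auto
  qed
  \<comment> \<open>If the direction \<open>a\<close> lies in the column span of \<open>W\<close>,
    then W + a (W^T b)^T = W (1 + a' (W^T b)^T), so the pseudo-reflection preserves that span
    whatever \<open>b\<close> is.\<close>
  have generator: "\<exists>A\<in>carrier_mat (card F) (card F). \<rho> x * W = W * A"
    if px: "pseudo_reflection n c (\<rho> x) a b" and a: "a' \<in> carrier_vec (card F)" "a = W *\<^sub>v a'" for x c a b a'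
  proof -
    have b: "b \<in> carrier_vec n" using px by (auto simp: pseudo_reflection_def)
    let ?b = "transpose_mat W *\<^sub>v b"
    have "?b \<in> carrier_vec (card F)" using b W by (auto intro: mult_mat_vec_carrier)
    then have "W * (1\<^sub>m (card F) + outer a' ?b) = W + outer a ?b"
      using W a by (simp add: mult_add_distrib_mat[of _ n "card F" _ "card F"] mult_outer)
    then show ?thesis using pseudo_reflection_mult_mat[OF px W] \<open>?b \<in> _\<close> a
      by (intro bexI[of _ "1\<^sub>m (card F) + outer a' ?b"]) auto
  qed
  have conj: "pseudo_reflection n mu (\<rho> (g \<otimes>\<^bsub>G\<^esub> m \<otimes>\<^bsub>G\<^esub> inv\<^bsub>G\<^esub> g)) (\<rho> g *\<^sub>v u) (transpose_mat (\<rho> (inv\<^bsub>G\<^esub> g)) *\<^sub>v v)"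
    if "g \<in> carrier G" for g
    using pseudo_reflection_conj[OF uv] \<rho>D(1,4,5) that G by (simp add: \<rho>D(2))
  have invariant: "\<exists>A\<in>carrier_mat (card F) (card F). \<rho> x * W = W * A" if "x \<in> carrier G" for x
    using that unfolding gen
  proof (induction rule: generate.induct)
    case one
    show ?case using W by (intro bexI[of _ "1\<^sub>m (card F)"]) (auto simp: \<rho>D(3))
  next
    case (incl x)
    then obtain g where g: "g \<in> F" "x = g \<otimes>\<^bsub>G\<^esub> m \<otimes>\<^bsub>G\<^esub> inv\<^bsub>G\<^esub> g" by auto
    then show ?case using generator[OF conj] F(2) col_W by blast
  next
    \<comment> \<open>The inverse of 1 + a b^T is 1 - (1/mu) a b^T, again a pseudo-reflection in the
      direction \<open>a\<close>, so \<open>generator\<close> applies to it as well.\<close>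
    case (inv x)
    then obtain g where g: "g \<in> F" "x = g \<otimes>\<^bsub>G\<^esub> m \<otimes>\<^bsub>G\<^esub> inv\<^bsub>G\<^esub> g" by auto
    have gG: "g \<in> carrier G" "x \<in> carrier G" using g F(2) G(2) by auto
    obtain a b where ab: "pseudo_reflection n mu (\<rho> x) a b" and a: "a = \<rho> g *\<^sub>v u"
      using conj[OF gG(1)] g by blast
    have abc: "a \<in> carrier_vec n" "b \<in> carrier_vec n" "scalar_prod b a = mu - 1" "\<rho> x = 1\<^sub>m n + outer a b"
      using ab by (auto simp: pseudo_reflection_def)
    let ?R = "\<rho> (inv\<^bsub>G\<^esub> x)"
    have R: "?R \<in> carrier_mat n n" "?R * \<rho> x = 1\<^sub>m n" using \<rho>D gG by auto
    have "\<rho> x *\<^sub>v a = a + (mu - 1) \<cdot>\<^sub>v a" using pseudo_reflection_mult_vec[OF ab abc(1)] abc by simp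
    then have xa: "\<rho> x *\<^sub>v a = mu \<cdot>\<^sub>v a" using abc by (intro eq_vecI) (auto simp: algebra_simps)
    have "a = (?R * \<rho> x) *\<^sub>v a" using R abc by simp
    also have "\<dots> = ?R *\<^sub>v (\<rho> x *\<^sub>v a)" by (rule assoc_mult_mat_vec[OF R(1) \<rho>D(1)[OF gG(2)] abc(1)])
    also have "\<dots> = mu \<cdot>\<^sub>v (?R *\<^sub>v a)" unfolding xa using R abc by (simp add: mult_mat_vec)
    finally have Ra: "a = mu \<cdot>\<^sub>v (?R *\<^sub>v a)" .
    \<comment> \<open>For mu = 0, \<open>Ra\<close> would give \<open>a = 0\<close>, and then
      \<open>u = 0\<close>, as \<open>a\<close> is the image of \<open>u\<close> under an invertible
      matrix.\<close>
    have "mu \<noteq> 0"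
    proof
      assume "mu = 0"
      then have "a = 0\<^sub>v n" by (subst Ra) (use R abc in auto)
      moreover have "u = \<rho> (inv\<^bsub>G\<^esub> g) *\<^sub>v a" unfolding a
        using assoc_mult_mat_vec[OF \<rho>D(1)[of "inv\<^bsub>G\<^esub> g"] \<rho>D(1)[OF gG(1)] uvc(1)] \<rho>D(5)[OF gG(1)] gG uvc by simp
      moreover have "\<rho> (inv\<^bsub>G\<^esub> g) *\<^sub>v 0\<^sub>v n = 0\<^sub>v n" using \<rho>D(1)[of "inv\<^bsub>G\<^esub> g"] gG by (intro eq_vecI) auto
      ultimately show False using \<rho>(3) by simp
    qed
    have "1\<^sub>m n = ?R * (1\<^sub>m n + outer a b)" using R abc by simp
    also have "\<dots> = ?R + outer (?R *\<^sub>v a) b"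
      using R abc by (simp add: mult_add_distrib_mat[of _ n n _ n] mult_outer)
    finally have 1: "1\<^sub>m n = ?R + outer (?R *\<^sub>v a) b" .
    have "?R *\<^sub>v a \<in> carrier_vec n" using R abc by auto
    then have "?R *\<^sub>v a = inverse mu \<cdot>\<^sub>v a" using \<open>mu \<noteq> 0\<close>
      by (subst (2) Ra) (simp add: smult_smult_assoc)
    with 1 have 2: "1\<^sub>m n = ?R + outer a (inverse mu \<cdot>\<^sub>v b)" by (simp add: outer_smult)
    have "?R = 1\<^sub>m n + outer a ((- inverse mu) \<cdot>\<^sub>v b)"
      unfolding 2 using R abc by (intro eq_matI) (auto simp: outer_def)
    \<comment> \<open>The eigenvalue 1 - (mu - 1)/mu written here is 1/mu.\<close>
    then have "pseudo_reflection n (1 + (- inverse mu) * (mu - 1)) ?R a ((- inverse mu) \<cdot>\<^sub>v b)"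
      using abc by (auto simp: pseudo_reflection_def)
    then show ?case using generator col_W g(1) a by blast
  next
    case (eng x y)
    then obtain A B where A: "A \<in> carrier_mat (card F) (card F)" "\<rho> x * W = W * A"
      and B: "B \<in> carrier_mat (card F) (card F)" "\<rho> y * W = W * B" by blast
    have xy: "x \<in> carrier G" "y \<in> carrier G" using eng gen by auto
    have "\<rho> (x \<otimes>\<^bsub>G\<^esub> y) * W = \<rho> x * (\<rho> y * W)"
      using \<rho>D(1,2) xy W by (simp add: assoc_mult_mat[of _ n n _ n _ "card F"])
    also have "\<dots> = (\<rho> x * W) * B"
      unfolding B(2) using \<rho>D(1) xy W B(1) by (simp add: assoc_mult_mat[of _ n n _ "card F" _ "card F"])
    also have "\<dots> = W * (A * B)"
      unfolding A(2) using W A(1) B(1) by (simp add: assoc_mult_mat[of _ n "card F" _ "card F" _ "card F"])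
    finally show ?case using A(1) B(1) by (intro bexI[of _ "A * B"]) auto
  qed
  \<comment> \<open>The unit of the group lies in \<open>F\<close>, so \<open>u\<close> itself is a
    column of \<open>W\<close>.\<close>
  have "\<exists>w\<in>carrier_vec (card F). u = W *\<^sub>v w"
    using col_W[OF F(3)] uvc by (simp add: \<rho>D(3))
  with invariant W have "spanned (card F) W" by (auto simp: spanned_def)
  then have ex: "\<exists>d. \<exists>E. spanned d E" by blast
  \<comment> \<open>A least number of columns takes the place of a choice of basis: a dependent
    column could be deleted by \<open>redundant_column\<close>, so \<open>E\<close> is
    injective.\<close>
  define d where "d = (LEAST d. \<exists>E. spanned d E)"
  have "d \<le> card F" unfolding d_def using \<open>spanned (card F) W\<close> by (intro Least_le) blast
  obtain E where sE: "spanned d E" using LeastI_ex[OF ex] unfolding d_def by blast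
  have E: "E \<in> carrier_mat n d" using sE by (auto simp: spanned_def)
  obtain w where w: "w \<in> carrier_vec d" "u = E *\<^sub>v w" using sE by (auto simp: spanned_def)
  obtain A where A: "\<And>g. g \<in> carrier G \<Longrightarrow> A g \<in> carrier_mat d d" "\<And>g. g \<in> carrier G \<Longrightarrow> \<rho> g * E = E * A g"
    using sE unfolding spanned_def by metis
  have inj0: "y = 0\<^sub>v d" if y: "y \<in> carrier_vec d" "E *\<^sub>v y = 0\<^sub>v n" for y
  proof (rule ccontr)
    assume "y \<noteq> 0\<^sub>v d"
    then obtain C B where CB: "d > 0" "C \<in> carrier_mat d (d - 1)" "B \<in> carrier_mat (d - 1) d" "E * C * B = E"
      using redundant_column[OF E y(1) _ y(2)] by blast
    have "spanned (d - 1) (E * C)" unfolding spanned_def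
    proof (intro conjI ballI)
      show "E * C \<in> carrier_mat n (d - 1)" using E CB by auto
      show "\<exists>w\<in>carrier_vec (d - 1). u = E * C *\<^sub>v w"
      proof
        show "B *\<^sub>v w \<in> carrier_vec (d - 1)" using CB w by auto
        have "E * C *\<^sub>v (B *\<^sub>v w) = (E * C * B) *\<^sub>v w"
          using CB w E by (intro assoc_mult_mat_vec[symmetric]) auto
        then show "u = E * C *\<^sub>v (B *\<^sub>v w)" using CB w by simp
      qed
      fix g assume g: "g \<in> carrier G"
      have "\<rho> g * (E * C) = (\<rho> g * E) * C" using \<rho>D(1)[OF g] E CB by (intro assoc_mult_mat[symmetric]) auto
      also have "\<dots> = (E * C * B) * A g * C" unfolding CB(4) using A(2)[OF g] by simp
      also have "\<dots> = (E * C) * (B * A g * C)"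
      proof -
        have EC: "E * C \<in> carrier_mat n (d - 1)" using E CB by auto
        have "E * C * B * A g = E * C * (B * A g)"
          using EC CB A(1)[OF g] by (intro assoc_mult_mat) auto
        moreover have "E * C * (B * A g) * C = E * C * (B * A g * C)"
          using EC CB A(1)[OF g] by (intro assoc_mult_mat) auto
        ultimately show ?thesis by simp
      qed
      finally show "\<exists>A\<in>carrier_mat (d - 1) (d - 1). \<rho> g * (E * C) = E * C * A"
        using CB A(1)[OF g] by (intro bexI[of _ "B * A g * C"]) auto
    qed
    then have "d \<le> d - 1" unfolding d_def by (intro Least_le) blast
    with CB(1) show False by simp
  qed
  have inj: "y = y'" if y: "y \<in> carrier_vec d" "y' \<in> carrier_vec d" "E *\<^sub>v y = E *\<^sub>v y'" for y y'
  proof -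
    have "E *\<^sub>v (y - y') = 0\<^sub>v n" using y E by (simp add: mult_minus_distrib_mat_vec)
    then have "y - y' = 0\<^sub>v d" using y by (intro inj0) auto
    then have "(y - y') $ i = 0" if "i < d" for i using that by simp
    then show ?thesis using y by (intro eq_vecI) auto
  qed
  have injM: "X = Y" if XY: "X \<in> carrier_mat d k" "Y \<in> carrier_mat d k" "E * X = E * Y" for X Y k
  proof -
    have "col X j = col Y j" if "j < k" for j
    proof (rule inj)
      show "E *\<^sub>v col X j = E *\<^sub>v col Y j" using XY E that by (metis col_mult2)
    qed (use XY that in auto)
    then show ?thesis using XY by (intro mat_col_eqI) auto
  qed
  \<comment> \<open>Since \<open>E\<close> is injective, each identity for \<open>A\<close> may be
    checked after multiplication by \<open>E\<close>, where it becomes an identity for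
    \<rho>.\<close>
  have homA: "A \<in> hom G (general_linear_group d)"
  proof (rule hom_general_linear_groupI[OF G(1) A(1)])
    show "A (x \<otimes>\<^bsub>G\<^esub> y) = A x * A y" if xy: "x \<in> carrier G" "y \<in> carrier G" for x y
    proof (rule injM)
      have "E * A (x \<otimes>\<^bsub>G\<^esub> y) = \<rho> (x \<otimes>\<^bsub>G\<^esub> y) * E" using A(2) xy by simp
      also have "\<dots> = \<rho> x * (\<rho> y * E)"
        using \<rho>D(1,2) xy E by (simp add: assoc_mult_mat[of _ n n _ n _ d])
      also have "\<dots> = \<rho> x * E * A y"
        unfolding A(2)[OF xy(2)] using \<rho>D(1) A(1) xy E by (intro assoc_mult_mat[symmetric]) auto
      also have "\<dots> = E * (A x * A y)"
        unfolding A(2)[OF xy(1)] using A(1) xy E by (intro assoc_mult_mat) auto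
      finally show "E * A (x \<otimes>\<^bsub>G\<^esub> y) = E * (A x * A y)" .
    qed (use A(1) xy in \<open>auto intro: mult_carrier_mat\<close>)
    show "A \<one>\<^bsub>G\<^esub> = 1\<^sub>m d"
    proof (rule injM)
      show "E * A \<one>\<^bsub>G\<^esub> = E * 1\<^sub>m d" using A(2)[of "\<one>\<^bsub>G\<^esub>"] E by (simp add: \<rho>D(3))
    qed (use A(1) in auto)
  qed
  have "w \<noteq> 0\<^sub>v d"
  proof
    assume "w = 0\<^sub>v d"
    then have "u = 0\<^sub>v n" using w(2) E by (intro eq_vecI) auto
    with \<rho>(3) show False by simp
  qed
  moreover have "pseudo_reflection d mu (A m) w (transpose_mat E *\<^sub>v v)"
    unfolding pseudo_reflection_def
  proof (intro conjI)
    show v': "transpose_mat E *\<^sub>v v \<in> carrier_vec d" using E uvc by auto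
    show "scalar_prod (transpose_mat E *\<^sub>v v) w = mu - 1"
      using transpose_vec_mult_scalar[OF E w(1) uvc(2)] w uvc by simp
    show "A m = 1\<^sub>m d + outer w (transpose_mat E *\<^sub>v v)"
    proof (rule injM)
      have "E * A m = E + outer u (transpose_mat E *\<^sub>v v)"
        using A(2)[OF G(2)] pseudo_reflection_mult_mat[OF uv E] by simp
      also have "\<dots> = E * (1\<^sub>m d + outer w (transpose_mat E *\<^sub>v v))"
        using E w v' by (simp add: mult_add_distrib_mat[of _ n d _ d] mult_outer)
      finally show "E * A m = E * (1\<^sub>m d + outer w (transpose_mat E *\<^sub>v v))" .
    qed (use A(1)[OF G(2)] outer_carrier[OF w(1) v'] in auto)
  qed (use w in auto)
  moreover have "A l *\<^sub>v w = lam \<cdot>\<^sub>v w"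
  proof (rule inj)
    have "E *\<^sub>v (A l *\<^sub>v w) = (\<rho> l * E) *\<^sub>v w" 
      using assoc_mult_mat_vec[OF E A(1)[OF G(3)] w(1)] A(2)[OF G(3)] by simp
    also have "\<dots> = \<rho> l *\<^sub>v u" unfolding w(2) using \<rho>D(1)[OF G(3)] E w(1) by (rule assoc_mult_mat_vec)
    also have "\<dots> = E *\<^sub>v (lam \<cdot>\<^sub>v w)" unfolding l using w E by (simp add: mult_mat_vec)
    finally show "E *\<^sub>v (A l *\<^sub>v w) = E *\<^sub>v (lam \<cdot>\<^sub>v w)" .
  qed (use A(1)[OF G(3)] w in auto)
  ultimately have "(lam, mu) \<in> KCH_eigenvalues G m l d"
    using KCH_eigenvalues_iff[OF G] homA \<rho>(2) by blast
  with \<open>d \<le> card F\<close> show ?thesis by blast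
qed

lemma KCH_eigenvalues_stabilize:
  assumes G: "group G" "m \<in> carrier G" "l \<in> carrier G"
    and F: "finite F" "F \<subseteq> carrier G"
    and gen: "carrier G = generate G ((\<lambda>g. g \<otimes>\<^bsub>G\<^esub> m \<otimes>\<^bsub>G\<^esub> inv\<^bsub>G\<^esub> g) ` F)"
  shows "\<exists>N\<ge>1. \<forall>n\<ge>N. KCH_eigenvalues G m l n = KCH_eigenvalues G m l N"
proof (intro exI[of _ "card (insert \<one>\<^bsub>G\<^esub> F)"] conjI allI impI)
  interpret group G by fact
  \<comment> \<open>Adjoining the unit puts the eigenvector itself into the span and makes the bound
    positive.\<close>
  let ?F = "insert \<one>\<^bsub>G\<^esub> F"
  have F': "finite ?F" "?F \<subseteq> carrier G" "\<one>\<^bsub>G\<^esub> \<in> ?F" using F by auto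
  show "1 \<le> card ?F" using F by (simp add: Suc_le_eq card_gt_0_iff)
  let ?c = "\<lambda>g. g \<otimes>\<^bsub>G\<^esub> m \<otimes>\<^bsub>G\<^esub> inv\<^bsub>G\<^esub> g"
  have "carrier G \<subseteq> generate G (?c ` ?F)" by (subst gen) (intro mono_generate, auto)
  moreover have "generate G (?c ` ?F) \<subseteq> carrier G" using F' G by (intro generate_incl) auto
  ultimately have gen': "carrier G = generate G (?c ` ?F)" by blast
  fix n assume n: "card ?F \<le> n"
  have "KCH_eigenvalues G m l n \<subseteq> KCH_eigenvalues G m l (card ?F)"
  proof (rule subsetI, clarify)
    fix lam mu assume "(lam, mu) \<in> KCH_eigenvalues G m l n"
    from KCH_eigenvalues_bounded_degree[OF G F' gen' this] obtain d
      where "d \<le> card ?F" "(lam, mu) \<in> KCH_eigenvalues G m l d" by blast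
    then show "(lam, mu) \<in> KCH_eigenvalues G m l (card ?F)" using KCH_eigenvalues_mono[OF G] by blast
  qed
  then show "KCH_eigenvalues G m l n = KCH_eigenvalues G m l (card ?F)"
    using KCH_eigenvalues_mono[OF G n] by blast
qed

unbundle vec_syntax

section \<open>The fundamental groupoid\<close>

definition path_in :: "'a::topological_space set \<Rightarrow> (real \<Rightarrow> 'a) \<Rightarrow> bool" where
  "path_in S p \<longleftrightarrow> path p \<and> path_image p \<subseteq> S"

lemma path_in_join:
  "path_in S p \<Longrightarrow> path_in S q \<Longrightarrow> pathfinish p = pathstart q \<Longrightarrow> path_in S (p +++ q)"
  by (auto simp: path_in_def path_image_join)

lemma path_in_reversepath [simp]: "path_in S (reversepath p) \<longleftrightarrow> path_in S p"
  by (auto simp: path_in_def)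

lemma path_in_linepath_refl: "path_in S (linepath u u) \<longleftrightarrow> u \<in> S"
  by (auto simp: path_in_def)

lemma path_in_subset: "path_in S p \<Longrightarrow> S \<subseteq> T \<Longrightarrow> path_in T p"
  by (auto simp: path_in_def)

lemma path_in_subpath:
  "path_in S p \<Longrightarrow> s \<in> {0..1} \<Longrightarrow> t \<in> {0..1} \<Longrightarrow> path_in S (subpath s t p)"
  using path_image_subpath_subset[of s t p] by (auto simp: path_in_def)

lemma path_in_starts:
  "path_in S p \<Longrightarrow> pathstart p \<in> S" "path_in S p \<Longrightarrow> pathfinish p \<in> S"
  by (auto simp: path_in_def)

text \<open>The paths \<open>a u\<close> play the role of a maximal tree: they turn paths with
  arbitrary ends into elements of the group. \<open>a_base\<close> makes the class of a loop at
  \<open>x\<close> the usual one.\<close>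

locale based_paths =
  fixes S :: "'a::real_normed_vector set" and x :: 'a and a :: "'a \<Rightarrow> real \<Rightarrow> 'a"
  assumes a: "u \<in> S \<Longrightarrow> path_in S (a u) \<and> pathstart (a u) = x \<and> pathfinish (a u) = u"
    and a_base: "a x = linepath x x"
    and base: "x \<in> S"
begin

abbreviation \<pi> where "\<pi> \<equiv> fundamental_group S x"

sublocale fg: group \<pi>
  using base by (rule group_fundamental_group)

definition cl :: "(real \<Rightarrow> 'a) \<Rightarrow> (real \<Rightarrow> 'a) set" where
  "cl p = path_class S (a (pathstart p) +++ (p +++ reversepath (a (pathfinish p))))"

lemma cl_loop_in:
  assumes "path_in S p"
  shows "a (pathstart p) +++ (p +++ reversepath (a (pathfinish p))) \<in> loops_at S x"
  using a[OF path_in_starts(1)[OF assms]] a[OF path_in_starts(2)[OF assms]] assms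
  by (auto simp: loops_at_def path_in_def path_image_join)

lemma cl_closed: "path_in S p \<Longrightarrow> cl p \<in> carrier \<pi>"
  using cl_loop_in by (auto simp: cl_def fundamental_group_def)

lemma cl_homotopic:
  assumes "homotopic_paths S p q"
  shows "cl p = cl q"
proof -
  have p: "path_in S p" using assms homotopic_paths_imp_path homotopic_paths_imp_subset
    unfolding path_in_def by blast
  have e: "pathstart p = pathstart q" "pathfinish p = pathfinish q"
    using assms homotopic_paths_imp_pathstart homotopic_paths_imp_pathfinish by blast+
  note as = a[OF path_in_starts(1)[OF p]] a[OF path_in_starts(2)[OF p]]
  show ?thesis unfolding cl_def e[symmetric]
    by (intro path_class_eq homotopic_paths_join assms)
      (use as in \<open>auto simp: path_in_def\<close>)
qed

text \<open>The two tails along \<open>a\<close> at the common point cancel. Thus \<open>cl\<close>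
  is a functor from the fundamental groupoid to the group, and a loop can be cut up and treated
  piece by piece.\<close>

lemma cl_join:
  assumes p: "path_in S p" and q: "path_in S q" and pq: "pathfinish p = pathstart q"
  shows "cl (p +++ q) = cl p \<otimes>\<^bsub>\<pi>\<^esub> cl q"
proof -
  note au = a[OF path_in_starts(1)[OF p]] and av = a[OF path_in_starts(2)[OF p]]
    and aw = a[OF path_in_starts(2)[OF q]]
  let ?u = "a (pathstart p)" and ?v = "a (pathfinish p)" and ?w = "a (pathfinish q)"
  let ?X = "q +++ reversepath ?w"
  have h: "path ?u" "path_image ?u \<subseteq> S" "path ?v" "path_image ?v \<subseteq> S" "path ?w" "path_image ?w \<subseteq> S"
    "path p" "path_image p \<subseteq> S" "path q" "path_image q \<subseteq> S"
    using au av aw p q by (auto simp: path_in_def)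
  have X: "path ?X" "path_image ?X \<subseteq> S" "pathstart ?X = pathfinish p"
    using h aw pq by (auto simp: path_image_join)
  have "cl p \<otimes>\<^bsub>\<pi>\<^esub> cl q = path_class S ((?u +++ (p +++ reversepath ?v)) +++ (?v +++ ?X))"
    unfolding cl_def pq[symmetric]
    using fundamental_group_mult[OF cl_loop_in[OF p] cl_loop_in[OF q]] by (simp add: pq)
  also have "\<dots> = path_class S (?u +++ ((p +++ reversepath ?v) +++ (?v +++ ?X)))"
    by (rule path_class_eq, rule homotopic_paths_sym, rule homotopic_paths_assoc)
      (use h X au av in \<open>auto simp: path_image_join\<close>)
  also have "\<dots> = path_class S (?u +++ (p +++ (reversepath ?v +++ (?v +++ ?X))))"
  proof (rule path_class_eq, rule homotopic_paths_join)
    show "homotopic_paths S ((p +++ reversepath ?v) +++ (?v +++ ?X)) (p +++ (reversepath ?v +++ (?v +++ ?X)))"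
      by (rule homotopic_paths_sym, rule homotopic_paths_assoc)
        (use h X au av in \<open>auto simp: path_image_join\<close>)
  qed (use h X au av in auto)
  also have "\<dots> = path_class S (?u +++ (p +++ ?X))"
  proof (rule path_class_eq, rule homotopic_paths_join[OF _ homotopic_paths_join])
    have "homotopic_paths S (reversepath ?v +++ (?v +++ ?X)) ((reversepath ?v +++ ?v) +++ ?X)"
      by (rule homotopic_paths_assoc) (use h X av in auto)
    moreover have "homotopic_paths S ((reversepath ?v +++ ?v) +++ ?X) (linepath (pathstart ?X) (pathstart ?X) +++ ?X)"
      using homotopic_paths_linv[OF h(3,4)] h X av by (intro homotopic_paths_join) auto
    moreover have "homotopic_paths S (linepath (pathstart ?X) (pathstart ?X) +++ ?X) ?X"
      by (rule homotopic_paths_lid) (use X in auto)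
    ultimately show "homotopic_paths S (reversepath ?v +++ (?v +++ ?X)) ?X"
      using homotopic_paths_trans by blast
  qed (use h X au av in auto)
  also have "\<dots> = path_class S (?u +++ ((p +++ q) +++ reversepath ?w))"
  proof (rule path_class_eq, rule homotopic_paths_join)
    show "homotopic_paths S (p +++ ?X) ((p +++ q) +++ reversepath ?w)"
      by (rule homotopic_paths_assoc) (use h X au av aw pq in \<open>auto simp: path_image_join\<close>)
  qed (use h X au av in auto)
  finally show ?thesis by (simp add: cl_def)
qed

lemma cl_refl:
  assumes "u \<in> S"
  shows "cl (linepath u u) = \<one>\<^bsub>\<pi>\<^esub>"
proof -
  have au: "path (a u)" "path_image (a u) \<subseteq> S" "pathstart (a u) = x" "pathfinish (a u) = u"
    using a[OF assms] by (auto simp: path_in_def)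
  have "cl (linepath u u) = path_class S (a u +++ (linepath u u +++ reversepath (a u)))"
    by (simp add: cl_def)
  also have "\<dots> = path_class S (a u +++ reversepath (a u))"
    using homotopic_paths_lid[of "reversepath (a u)" S] au
    by (intro path_class_eq homotopic_paths_join) auto
  also have "\<dots> = path_class S (linepath x x)"
    using homotopic_paths_rinv[of "a u" S] au by (intro path_class_eq) auto
  finally show ?thesis by (simp add: fundamental_group_def linepath_refl)
qed

lemma cl_reversepath:
  assumes "path_in S p"
  shows "cl (reversepath p) = inv\<^bsub>\<pi>\<^esub> cl p"
proof -
  have "cl p \<otimes>\<^bsub>\<pi>\<^esub> cl (reversepath p) = cl (p +++ reversepath p)"
    using assms by (subst cl_join) auto
  also have "\<dots> = cl (linepath (pathstart p) (pathstart p))"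
    using assms by (intro cl_homotopic homotopic_paths_rinv) (auto simp: path_in_def)
  also have "\<dots> = \<one>\<^bsub>\<pi>\<^esub>" using assms by (intro cl_refl path_in_starts)
  finally show ?thesis
    using assms by (metis cl_closed fg.inv_equality fg.inv_inv path_in_reversepath)
qed

lemma cl_loop:
  assumes "p \<in> loops_at S x"
  shows "cl p = path_class S p"
proof -
  have p: "path p" "path_image p \<subseteq> S" "pathstart p = x" "pathfinish p = x"
    using assms by (auto simp: loops_at_def)
  have "cl p = path_class S (linepath x x +++ (p +++ linepath x x))"
    by (simp add: cl_def p a_base)
  also have "\<dots> = path_class S (p +++ linepath x x)"
    using homotopic_paths_lid[of "p +++ linepath x x" S] p base
    by (intro path_class_eq) (auto simp: path_image_join)
  also have "\<dots> = path_class S p"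
    using homotopic_paths_rid[of p S] p by (intro path_class_eq) auto
  finally show ?thesis .
qed

end

lemma based_paths_exist:
  assumes "path_connected S" "x \<in> S"
  shows "\<exists>a. based_paths S x a"
proof -
  have "\<forall>u\<in>S. \<exists>p. path_in S p \<and> pathstart p = x \<and> pathfinish p = u"
    using assms unfolding path_connected_def path_in_def by blast
  then obtain b where b: "\<And>u. u \<in> S \<Longrightarrow> path_in S (b u) \<and> pathstart (b u) = x \<and> pathfinish (b u) = u"
    by metis
  have "based_paths S x (b(x := linepath x x))"
    using assms b by unfold_locales (auto simp: path_in_linepath_refl)
  then show ?thesis by blast
qed

section \<open>The complement of a knot near the knot\<close>

lemma homotopic_paths_convex:
  fixes S :: "'a::real_normed_vector set"
  assumes "convex S" "path_in S p" "path_in S q" "pathstart p = pathstart q" "pathfinish p = pathfinish q"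
  shows "homotopic_paths S p q"
proof (rule homotopic_paths_linear)
  fix t :: real assume "t \<in> {0..1}"
  then have "p t \<in> S" "q t \<in> S" using assms(2,3) by (auto simp: path_in_def path_image_def)
  then show "closed_segment (p t) (q t) \<subseteq> S" using assms(1) by (rule closed_segment_subset)
qed (use assms in \<open>auto simp: path_in_def\<close>)

text \<open>For a meridian of the form h M h^-1, with \<open>M\<close> the class of a circle around
  the tube, this replaces the connecting element \<open>h\<close> by any other element
  \<open>r\<close>.\<close>

lemma (in group) conj_conj:
  assumes "r \<in> carrier G" "h \<in> carrier G" "M \<in> carrier G"
  shows "(r \<otimes> inv h) \<otimes> (h \<otimes> (M \<otimes> inv h)) \<otimes> inv (r \<otimes> inv h) = r \<otimes> M \<otimes> inv r"
proof -
  have "inv h \<otimes> (h \<otimes> z) = z" if "z \<in> carrier G" for z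
    using assms that by (simp flip: m_assoc)
  then show ?thesis using assms by (simp add: m_assoc inv_mult_group)
qed

text \<open>\<open>tube_exp\<close> is the universal covering of the punctured tube (with boundary).\<close>
context
  fixes \<Phi> :: "complex \<times> complex \<Rightarrow> real^3" and K :: "(real^3) set"
  assumes tub: "tubular_neighbourhood K \<Phi>"
begin

definition tube :: "real \<times> complex \<Rightarrow> real^3" where
  "tube = (\<lambda>(t, z). \<Phi> (cis t, z))"

definition tube_exp :: "real \<times> complex \<Rightarrow> real^3" where
  "tube_exp = (\<lambda>(t, w). \<Phi> (cis t, exp w))"

text \<open>The logarithms of the points of the punctured closed unit disc fill a closed half-plane.
  Its convexity makes all paths with the same ends homotopic.\<close>

definition tube_lift :: "(real \<times> complex) set" where
  "tube_lift = UNIV \<times> {w. Re w \<le> 0}"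

lemma tube_exp_eq: "tube_exp (t, w) = tube (t, exp w)"
  by (simp add: tube_def tube_exp_def)

lemma convex_tube_lift: "convex tube_lift"
  unfolding tube_lift_def by (intro convex_Times convex_halfspace_Re_le) auto

lemma continuous_on_tube: "continuous_on (UNIV \<times> cball 0 1) tube"
proof -
  have "continuous_on (sphere 0 1 \<times> cball 0 1) \<Phi>"
    using tub unfolding tubular_neighbourhood_def by blast
  then have "continuous_on (UNIV \<times> cball 0 1) (\<lambda>p. \<Phi> (cis (fst p), snd p))"
    by (rule continuous_on_compose2) (intro continuous_intros, auto)
  then show ?thesis by (simp add: tube_def case_prod_beta)
qed

lemma continuous_on_tube_exp: "continuous_on tube_lift tube_exp"
proof -
  have "continuous_on tube_lift (\<lambda>p. tube (fst p, exp (snd p)))"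
    by (rule continuous_on_compose2[OF continuous_on_tube])
      (intro continuous_intros, auto simp: tube_lift_def norm_exp_eq_Re)
  then show ?thesis by (simp add: tube_def tube_exp_def case_prod_beta)
qed

lemma tube_eqD:
  assumes "norm z \<le> 1" "norm z' \<le> 1" "tube (t, z) = tube (t', z')"
  shows "cis t = cis t'" "z = z'"
  using assms tub unfolding tubular_neighbourhood_def tube_def
  by (auto dest!: inj_onD[where x = "(cis t, z)" and y = "(cis t', z')"])

lemma tube_in_K: "norm z \<le> 1 \<Longrightarrow> tube (t, z) \<in> K \<longleftrightarrow> z = 0"
proof
  assume z: "norm z \<le> 1" "tube (t, z) \<in> K"
  then obtain \<zeta> where "\<zeta> \<in> sphere 0 1" "\<Phi> (cis t, z) = \<Phi> (\<zeta>, 0)"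
    using tub unfolding tubular_neighbourhood_def tube_def by auto
  then show "z = 0"
    using z tub unfolding tubular_neighbourhood_def
    by (auto dest!: inj_onD[where x = "(cis t, z)" and y = "(\<zeta>, 0)"])
next
  assume "z = 0"
  then show "tube (t, z) \<in> K"
    using tub unfolding tubular_neighbourhood_def tube_def by auto
qed

lemma tube_exp_in: "tube_exp ` tube_lift \<subseteq> - K"
  by (auto simp: tube_lift_def tube_exp_eq tube_in_K norm_exp_eq_Re)

lemma K_tube:
  assumes "y \<in> K"
  shows "\<exists>t. y = tube (t, 0)"
proof -
  obtain \<zeta> where \<zeta>: "norm \<zeta> = 1" "y = \<Phi> (\<zeta>, 0)"
    using assms tub unfolding tubular_neighbourhood_def by auto
  then have "\<zeta> \<noteq> 0" by auto
  then have "cis (Arg \<zeta>) = \<zeta>" using cis_Arg[of \<zeta>] \<zeta> by (simp add: sgn_eq)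
  then have "y = tube (Arg \<zeta>, 0)" using \<zeta> by (simp add: tube_def)
  then show ?thesis by blast
qed

lemma compact_K: "compact K"
proof -
  have "compact (\<Phi> ` (sphere 0 1 \<times> {0}))"
    using tub unfolding tubular_neighbourhood_def
    by (intro compact_continuous_image compact_Times) (auto elim: continuous_on_subset)
  then show ?thesis using tub unfolding tubular_neighbourhood_def by simp
qed

definition tube_piece :: "real \<Rightarrow> real \<Rightarrow> (real^3) set" where
  "tube_piece t0 \<eta> = tube ` ({t0 - \<eta><..<t0 + \<eta>} \<times> ball 0 \<eta>)"

text \<open>A convex set mapping onto \<open>tube_piece\<close> minus the knot: the modulus of exp w
  is below \<eta> exactly if Re w < ln \<eta>.\<close>

definition lift_piece :: "real \<Rightarrow> real \<Rightarrow> (real \<times> complex) set" where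
  "lift_piece t0 \<eta> = {t0 - \<eta><..<t0 + \<eta>} \<times> {w. Re w < ln \<eta>}"

text \<open>Two angles in the interval differ by less than 2, hence by no nonzero multiple of 2 pi,
  and \<open>tube\<close> is injective there. Source and target both have dimension 3, so invariance
  of domain provides the inverse.\<close>

lemma tube_homeomorphism:
  assumes "\<eta> < 1"
  shows "\<exists>g. homeomorphism ({t0 - \<eta><..<t0 + \<eta>} \<times> ball 0 \<eta>) (tube_piece t0 \<eta>) tube g"
proof -
  have "inj_on tube ({t0 - \<eta><..<t0 + \<eta>} \<times> ball 0 \<eta>)"
  proof (rule inj_onI, clarify)
    fix t t' :: real and z z' :: complex
    assume tz: "t \<in> {t0 - \<eta><..<t0 + \<eta>}" "t' \<in> {t0 - \<eta><..<t0 + \<eta>}" "z \<in> ball 0 \<eta>" "z' \<in> ball 0 \<eta>"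
      "tube (t, z) = tube (t', z')"
    then have "cis t = cis t'" "z = z'" using assms tube_eqD[of z z' t t'] by auto
    then obtain n :: int where "\<i> * t = \<i> * t' + complex_of_real (real_of_int (2 * n) * pi) * \<i>"
      by (auto simp: cis_conv_exp exp_eq)
    then have "\<i> * t = \<i> * (t' + real_of_int (2 * n) * pi)" by (simp add: algebra_simps)
    then have eq: "t = t' + 2 * n * pi"
      by (metis complex_i_not_zero mult_cancel_left of_real_eq_iff of_real_add of_int_mult of_int_numeral of_real_mult)
    have "n = 0"
    proof (rule ccontr)
      assume "n \<noteq> 0"
      then have "\<bar>real_of_int n\<bar> \<ge> 1" by linarith
      then have "\<bar>2 * n * pi\<bar> \<ge> 2 * 1 * pi" unfolding abs_mult by (intro mult_mono) auto
      moreover have "\<bar>t - t'\<bar> < 2" using tz assms by auto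
      ultimately show False using eq pi_gt3 by auto
    qed
    with eq \<open>z = z'\<close> show "t = t' \<and> z = z'" by simp
  qed
  moreover have "continuous_on ({t0 - \<eta><..<t0 + \<eta>} \<times> ball 0 \<eta>) tube"
    using assms by (intro continuous_on_subset[OF continuous_on_tube]) auto
  ultimately show ?thesis
    using invariance_of_domain_homeomorphism[of "{t0 - \<eta><..<t0 + \<eta>} \<times> ball (0::complex) \<eta>" tube]
    by (auto simp: tube_piece_def open_Times)
qed

lemma open_tube_piece:
  assumes "\<eta> < 1"
  shows "open (tube_piece t0 \<eta>)"
proof -
  obtain g where g: "homeomorphism ({t0 - \<eta><..<t0 + \<eta>} \<times> ball 0 \<eta>) (tube_piece t0 \<eta>) tube g"
    using tube_homeomorphism[OF assms] by blast
  then have "inj_on tube ({t0 - \<eta><..<t0 + \<eta>} \<times> ball 0 \<eta>)"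
    by (intro inj_on_inverseI[of _ g]) (rule homeomorphism_apply1)
  then show ?thesis unfolding tube_piece_def
    using homeomorphism_cont1[OF g] by (intro invariance_of_domain_gen) (auto intro: open_Times)
qed

lemma tube_piece_minus_K:
  assumes "0 < \<eta>" "\<eta> < 1"
  shows "tube_piece t0 \<eta> - K = tube_exp ` lift_piece t0 \<eta>"
proof
  show "tube_piece t0 \<eta> - K \<subseteq> tube_exp ` lift_piece t0 \<eta>"
  proof
    fix y assume y: "y \<in> tube_piece t0 \<eta> - K"
    then obtain t z where tz: "t \<in> {t0 - \<eta><..<t0 + \<eta>}" "norm z < \<eta>" "y = tube (t, z)"
      by (auto simp: tube_piece_def)
    with y assms have "z \<noteq> 0" using tube_in_K by auto
    then have "tube_exp (t, ln z) = y" "Re (ln z) < ln \<eta>"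
      using tz assms by (auto simp: tube_exp_eq)
    with tz show "y \<in> tube_exp ` lift_piece t0 \<eta>"
      by (intro image_eqI[of _ _ "(t, ln z)"]) (auto simp: lift_piece_def)
  qed
  show "tube_exp ` lift_piece t0 \<eta> \<subseteq> tube_piece t0 \<eta> - K"
  proof
    fix y assume "y \<in> tube_exp ` lift_piece t0 \<eta>"
    then obtain t w where tw: "t \<in> {t0 - \<eta><..<t0 + \<eta>}" "Re w < ln \<eta>" "y = tube (t, exp w)"
      by (auto simp: lift_piece_def tube_exp_eq)
    then have "norm (exp w) < \<eta>" using assms by (metis exp_less_cancel_iff exp_ln norm_exp_eq_Re)
    moreover from this assms have "tube (t, exp w) \<notin> K" using tube_in_K[of "exp w" t] exp_not_eq_zero
      by (metis less_imp_le order.strict_trans)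
    ultimately show "y \<in> tube_piece t0 \<eta> - K" using tw unfolding tube_piece_def by auto
  qed
qed

lemma convex_lift_piece: "convex (lift_piece t0 \<eta>)"
  unfolding lift_piece_def by (intro convex_Times convex_halfspace_Re_lt) auto

lemma lift_piece_subset:
  assumes "0 < \<eta>" "\<eta> < 1"
  shows "lift_piece t0 \<eta> \<subseteq> tube_lift"
proof -
  have "ln \<eta> < 0" using assms by simp
  then have "Re w \<le> 0" if "Re w < ln \<eta>" for w using that by linarith
  then show ?thesis unfolding lift_piece_def tube_lift_def by blast
qed

lemma path_connected_tube_piece:
  assumes "0 < \<eta>" "\<eta> < 1"
  shows "path_connected (tube_piece t0 \<eta> - K)" "tube_piece t0 \<eta> - K \<noteq> {}"
proof -
  show "path_connected (tube_piece t0 \<eta> - K)"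
    unfolding tube_piece_minus_K[OF assms]
    using continuous_on_subset[OF continuous_on_tube_exp lift_piece_subset[OF assms]]
    by (intro path_connected_continuous_image convex_imp_path_connected convex_lift_piece) 
  have "(t0, complex_of_real (ln \<eta> - 1)) \<in> lift_piece t0 \<eta>"
    using assms by (auto simp: lift_piece_def)
  then show "tube_piece t0 \<eta> - K \<noteq> {}" unfolding tube_piece_minus_K[OF assms] by blast
qed

lemma small_tube_piece:
  assumes "0 < e"
  shows "\<exists>\<eta>>0. \<eta> < 1 \<and> tube_piece t0 \<eta> \<subseteq> ball (tube (t0, 0)) e"
proof -
  have "(t0, 0) \<in> UNIV \<times> cball (0::complex) 1" by simp
  then obtain d where d: "d > 0" "\<And>p. p \<in> UNIV \<times> cball 0 1 \<Longrightarrow> dist p (t0, 0) < d \<Longrightarrow>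
      dist (tube p) (tube (t0, 0)) < e"
    using continuous_on_tube assms unfolding continuous_on_iff by metis
  define \<eta> where "\<eta> = min (d / 2) (1 / 2)"
  have \<eta>: "0 < \<eta>" "\<eta> < 1" using d by (auto simp: \<eta>_def)
  have "dist (tube (t, z)) (tube (t0, 0)) < e" if "t \<in> {t0 - \<eta><..<t0 + \<eta>}" "norm z < \<eta>" for t z
  proof (rule d(2))
    have "dist (t, z) (t0, 0) \<le> dist t t0 + dist z 0"
      using norm_Pair_le[of "t - t0" z] by (simp add: dist_norm)
    also have "\<dots> < \<eta> + \<eta>" using that by (intro add_strict_mono) (auto simp: dist_norm)
    also have "\<dots> \<le> d" by (simp add: \<eta>_def)
    finally show "dist (t, z) (t0, 0) < d" .
  qed (use that \<eta> in auto)
  then have "tube_piece t0 \<eta> \<subseteq> ball (tube (t0, 0)) e"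
    by (auto simp: tube_piece_def dist_commute)
  with \<eta> show ?thesis by blast
qed

text \<open>Inverting \<open>tube\<close> and choosing a continuous logarithm of the disc coordinate
  lifts \<open>q\<close> to a path in the convex set \<open>lift_piece\<close>. The end of the lift
  is determined up to a multiple of 2 pi i, and the lift can be straightened.\<close>

lemma loop_in_tube_piece:
  assumes \<eta>: "0 < \<eta>" "\<eta> < 1" and q: "path_in (tube_piece t0 \<eta> - K) q"
    and c: "(t1, w0) \<in> lift_piece t0 \<eta>" "pathstart q = tube_exp (t1, w0)" "pathfinish q = tube_exp (t1, w0)"
  shows "\<exists>k::int. homotopic_paths (- K) q
    (tube_exp \<circ> linepath (t1, w0) (t1, w0 + of_int k * (2 * pi * \<i>)))"
proof -
  let ?U = "{t0 - \<eta><..<t0 + \<eta>} \<times> ball (0::complex) \<eta>"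
  obtain g where g: "homeomorphism ?U (tube_piece t0 \<eta>) tube g"
    using tube_homeomorphism[OF \<eta>(2)] by blast
  define r where "r = g \<circ> q"
  have q01: "q s \<in> tube_piece t0 \<eta> - K" if "s \<in> {0..1}" for s
    using q that unfolding path_in_def path_image_def by blast
  have qc: "continuous_on {0..1} q" using q by (auto simp: path_in_def path_def)
  have rc: "continuous_on {0..1} r" unfolding r_def
    by (rule continuous_on_compose[OF qc]) (rule continuous_on_subset[OF homeomorphism_cont2[OF g]], use q01 in auto)
  have tr: "tube (r s) = q s" if "s \<in> {0..1}" for s
    using q01[OF that] homeomorphism_apply2[OF g] by (auto simp: r_def)
  have rU: "r s \<in> ?U" if "s \<in> {0..1}" for s
    using q01[OF that] homeomorphism_image2[OF g] unfolding r_def by auto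
  have z: "snd (r s) \<noteq> 0" if "s \<in> {0..1}" for s
  proof
    assume "snd (r s) = 0"
    then have "q s = tube (fst (r s), 0)" using tr[OF that] by (metis prod.collapse)
    then show False using q01[OF that] tube_in_K[of 0] by auto
  qed
  obtain w where w: "continuous_on {0..1} w" "\<And>s. s \<in> {0..1} \<Longrightarrow> snd (r s) = exp (w s)"
    using continuous_logarithm_on_contractible[of "{0..1}" "\<lambda>s. snd (r s)"] z
      continuous_on_snd[OF rc] convex_imp_contractible[of "{0..1::real}"] by auto
  have c': "tube (t1, exp w0) = q 0" "tube (t1, exp w0) = q 1"
    using c by (auto simp: pathstart_def pathfinish_def tube_exp_eq)
  have less_ln: "Re w < ln \<eta> \<longleftrightarrow> norm (exp w) < \<eta>" for w
    using \<eta> by (metis exp_less_cancel_iff exp_ln norm_exp_eq_Re)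
  have U1: "(t1, exp w0) \<in> ?U"
    using c(1) less_ln[of w0] by (simp add: lift_piece_def)
  then have r01: "r 0 = (t1, exp w0)" "r 1 = (t1, exp w0)"
    using c' homeomorphism_apply1[OF g U1] by (auto simp: r_def)
  \<comment> \<open>The logarithm is shifted to start at \<open>w0\<close>; the shift is a period of
    the exponential, as \<open>ew0\<close> shows.\<close>
  define v where "v = (\<lambda>s. w s - w 0 + w0)"
  define L where "L = (\<lambda>s. (fst (r s), v s))"
  have ew0: "exp (w 0) = exp w0" using w(2)[of 0] r01 by simp
  have ev: "exp (v s) = snd (r s)" if "s \<in> {0..1}" for s
    using w(2)[OF that] ew0 by (simp add: v_def exp_add exp_diff)
  have "exp (v 1) = exp w0" using ev[of 1] r01 by simp
  then obtain k :: int where k: "v 1 = w0 + complex_of_real (real_of_int (2 * k) * pi) * \<i>"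
    using exp_eq by blast
  have L01: "L 0 = (t1, w0)" "L 1 = (t1, w0 + of_int k * (2 * pi * \<i>))"
    using r01 k by (simp_all add: L_def v_def mult_ac)
  have EL: "tube_exp (L s) = q s" if "s \<in> {0..1}" for s
    using tr[OF that] ev[OF that] by (simp add: L_def tube_exp_eq)
  have "path L" unfolding path_def L_def v_def
    by (intro continuous_intros continuous_on_fst rc w)
  moreover have "L s \<in> lift_piece t0 \<eta>" if "s \<in> {0..1}" for s
  proof -
    have "norm (exp (v s)) < \<eta>" "fst (r s) \<in> {t0 - \<eta><..<t0 + \<eta>}"
      using rU[OF that] unfolding ev[OF that] by auto
    then show ?thesis using less_ln[of "v s"] by (simp add: L_def lift_piece_def)
  qed
  ultimately have L: "path_in (lift_piece t0 \<eta>) L" by (auto simp: path_in_def path_image_def)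
  have "L 1 \<in> lift_piece t0 \<eta>" using L path_in_starts(2)[of _ L] by (simp add: pathfinish_def)
  then have "path_in (lift_piece t0 \<eta>) (linepath (t1, w0) (t1, w0 + of_int k * (2 * pi * \<i>)))"
    using c(1) closed_segment_subset[OF _ _ convex_lift_piece] unfolding L01 path_in_def by simp
  then have "homotopic_paths (lift_piece t0 \<eta>) L (linepath (t1, w0) (t1, w0 + of_int k * (2 * pi * \<i>)))"
    using L L01 by (intro homotopic_paths_convex convex_lift_piece) (auto simp: pathstart_def pathfinish_def linepath_def)
  then have "homotopic_paths (- K) (tube_exp \<circ> L) (tube_exp \<circ> linepath (t1, w0) (t1, w0 + of_int k * (2 * pi * \<i>)))"
  proof (rule homotopic_paths_continuous_image)
    show "continuous_on (lift_piece t0 \<eta>) tube_exp"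
      using continuous_on_tube_exp lift_piece_subset[OF \<eta>] by (rule continuous_on_subset)
    show "tube_exp \<in> lift_piece t0 \<eta> \<rightarrow> - K"
      using tube_exp_in lift_piece_subset[OF \<eta>, of t0] by blast
  qed
  moreover have "homotopic_paths (- K) q (tube_exp \<circ> L)"
    using q EL by (intro homotopic_paths_eq) (auto simp: path_in_def)
  ultimately show ?thesis using homotopic_paths_trans by blast
qed

text \<open>Around a point of \<open>K\<close> a short piece of the tube serves, elsewhere a ball
  missing \<open>K\<close>. The disjunction records the kind, since loops are computed differently
  in the two.\<close>

lemma complement_piece:
  assumes "0 < e"
  shows "\<exists>U. open U \<and> y \<in> U \<and> U \<subseteq> ball y e \<and> path_connected (U - K) \<and> U - K \<noteq> {} \<and>
    ((\<exists>t0 \<eta>. 0 < \<eta> \<and> \<eta> < 1 \<and> U = tube_piece t0 \<eta>) \<or> convex U \<and> U \<inter> K = {})"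
proof (cases "y \<in> K")
  case True
  then obtain t0 where t0: "y = tube (t0, 0)" using K_tube by blast
  obtain \<eta> where \<eta>: "0 < \<eta>" "\<eta> < 1" "tube_piece t0 \<eta> \<subseteq> ball (tube (t0, 0)) e"
    using small_tube_piece[OF assms] by blast
  have "y \<in> tube_piece t0 \<eta>" unfolding t0 tube_piece_def using \<eta> by auto
  then show ?thesis using \<eta> t0 open_tube_piece[OF \<eta>(2)] path_connected_tube_piece[OF \<eta>(1,2)]
    by (intro exI[of _ "tube_piece t0 \<eta>"] conjI disjI1 exI[of _ t0] exI[of _ \<eta>]) auto
next
  case False
  have "open (- K)" using compact_K compact_imp_closed by blast
  then obtain d where d: "d > 0" "ball y d \<subseteq> - K" using False open_contains_ball by blast
  let ?U = "ball y (min d e)"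
  have U: "?U \<inter> K = {}" "?U \<subseteq> ball y e" "y \<in> ?U" using d assms by auto
  then have "?U - K = ?U" by blast
  then have pc: "path_connected (?U - K)" "?U - K \<noteq> {}"
    using U(3) convex_imp_path_connected[OF convex_ball[of y "min d e"]] by (simp_all only:) blast
  show ?thesis by (intro exI[of _ ?U] conjI disjI2 open_ball convex_ball U pc)
qed

text \<open>Connectedness of space carries over: the complement is dense, and suitable
  neighbourhoods minus \<open>K\<close> are path connected, so membership in one path component
  spreads everywhere.\<close>

lemma path_connected_complement: "path_connected (- K)"
  unfolding path_connected_component
proof (intro ballI)
  fix u v assume uv: "u \<in> - K" "v \<in> - K"
  have dense: "\<exists>z. z \<in> T \<and> z \<in> - K" if T: "openin (top_of_set UNIV) T" "y \<in> T" for T and y :: "real^3"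
  proof -
    have "open T" using T(1) open_UNIV by (rule openin_open_trans)
    then obtain e where e: "e > 0" "ball y e \<subseteq> T" using T(2) open_contains_ball by metis
    obtain U where "U \<subseteq> ball y e" "U - K \<noteq> {}" using complement_piece[OF e(1), of y] by metis
    with e show ?thesis by blast
  qed
  have step: "\<exists>T. openin (top_of_set UNIV) T \<and> y \<in> T \<and>
        (\<forall>u'\<in>T. \<forall>v'\<in>T. u' \<in> - K \<and> v' \<in> - K \<and> path_component (- K) u u' \<longrightarrow> path_component (- K) u v')"
    for y :: "real^3"
  proof -
    have "0 < (1::real)" by simp
    from complement_piece[OF this, of y] obtain U where U: "open U" "y \<in> U" "path_connected (U - K)"
      by metis
    have "path_component (- K) u v'" if "u' \<in> U" "v' \<in> U" "u' \<in> - K" "v' \<in> - K" "path_component (- K) u u'" for u' v'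
    proof -
      have "u' \<in> U - K" "v' \<in> U - K" using that by auto
      then have "path_component (U - K) u' v'" using U(3) unfolding path_connected_component by metis
      then have "path_component (- K) u' v'" by (rule path_component_of_subset[rotated]) blast
      with that(5) show ?thesis by (rule path_component_trans)
    qed
    moreover have "openin (top_of_set UNIV) U" using U(1) by (intro open_subset) auto
    ultimately show ?thesis using U(2) by metis
  qed
  have "path_component (- K) u u" using uv(1) by (simp add: path_component_refl)
  then show "path_component (- K) u v"
    using connected_induction[of UNIV "\<lambda>y. y \<in> - K" "path_component (- K) u" u v, OF connected_UNIV dense step] uv
    by simp
qed

text \<open>Loops in a piece of the punctured tube lift to paths in the universal covering, so they represent
  powers of a conjugate of the meridian.\<close>
lemma piece_loops:
  assumes "based_paths (- K) x a"
    and g0: "path_in (- K) g0" "pathstart g0 = x" "pathfinish g0 = \<Phi> (1, 1)"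
    and m: "m = path_class (- K) (g0 +++ (\<lambda>t. \<Phi> (1, cis (2 * pi * t))) +++ reversepath g0)"
    and \<eta>: "0 < \<eta>" "\<eta> < 1" and u: "u \<in> tube_piece t0 \<eta> - K"
  shows "\<exists>g\<in>carrier (fundamental_group (- K) x).
    \<forall>q. path_in (tube_piece t0 \<eta> - K) q \<and> pathstart q = u \<and> pathfinish q = u \<longrightarrow>
      based_paths.cl (- K) a q \<in> generate (fundamental_group (- K) x)
        {g \<otimes>\<^bsub>fundamental_group (- K) x\<^esub> m \<otimes>\<^bsub>fundamental_group (- K) x\<^esub> inv\<^bsub>fundamental_group (- K) x\<^esub> g}"
proof -
  interpret based_paths "- K" x a by fact
  \<comment> \<open>The class of a projected segment. As \<open>tube_lift\<close> is convex, these
    classes compose around every triangle.\<close>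
  define \<sigma> where "\<sigma> c d = cl (tube_exp \<circ> linepath c d)" for c d
  \<comment> \<open>The deck translation for one turn around the knot at a fixed position along
    it.\<close>
  define v :: "real \<times> complex" where "v = (0, 2 * pi * \<i>)"
  have seg: "path_in tube_lift (linepath c d)" if "c \<in> tube_lift" "d \<in> tube_lift" for c d
    using that convex_tube_lift by (simp add: path_in_def closed_segment_subset)
  have image: "path_in (- K) (tube_exp \<circ> p)" if "path_in tube_lift p" for p
    using that path_continuous_image[of p tube_exp] continuous_on_subset[OF continuous_on_tube_exp] tube_exp_in
    unfolding path_in_def path_image_compose by blast
  have \<sigma>_closed: "\<sigma> c d \<in> carrier \<pi>" if "c \<in> tube_lift" "d \<in> tube_lift" for c d
    unfolding \<sigma>_def using that by (intro cl_closed image seg)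
  have \<sigma>_join: "\<sigma> c d \<otimes>\<^bsub>\<pi>\<^esub> \<sigma> d f = \<sigma> c f" if "c \<in> tube_lift" "d \<in> tube_lift" "f \<in> tube_lift" for c d f
  proof -
    have "\<sigma> c d \<otimes>\<^bsub>\<pi>\<^esub> \<sigma> d f = cl ((tube_exp \<circ> linepath c d) +++ (tube_exp \<circ> linepath d f))"
      unfolding \<sigma>_def using that by (intro cl_join[symmetric] image seg) (auto simp: pathfinish_compose pathstart_compose)
    also have "\<dots> = cl (tube_exp \<circ> (linepath c d +++ linepath d f))" by (simp add: path_compose_join)
    also have "\<dots> = \<sigma> c f" unfolding \<sigma>_def
    proof (rule cl_homotopic, rule homotopic_paths_continuous_image)
      show "homotopic_paths tube_lift (linepath c d +++ linepath d f) (linepath c f)"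
        using that by (intro homotopic_paths_convex convex_tube_lift path_in_join seg) auto
      show "continuous_on tube_lift tube_exp" by (rule continuous_on_tube_exp)
      show "tube_exp \<in> tube_lift \<rightarrow> - K" using tube_exp_in by blast
    qed
    finally show ?thesis .
  qed
  have \<sigma>_refl: "\<sigma> c c = \<one>\<^bsub>\<pi>\<^esub>" if "c \<in> tube_lift" for c
    using \<sigma>_join[OF that that that] \<sigma>_closed[OF that that] by simp
  have \<sigma>_inv: "\<sigma> d c = inv\<^bsub>\<pi>\<^esub> \<sigma> c d" if "c \<in> tube_lift" "d \<in> tube_lift" for c d
    using \<sigma>_join[of d c d] \<sigma>_refl \<sigma>_closed that by (intro fg.inv_equality[symmetric]) auto
  have v_lift: "c + of_int k *\<^sub>R v \<in> tube_lift" if "c \<in> tube_lift" for c and k :: int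
    using that by (auto simp: tube_lift_def v_def)
  have tube_exp_period: "tube_exp (c + of_int k *\<^sub>R v) = tube_exp c" for c and k :: int
  proof -
    obtain t w where c: "c = (t, w)" by force
    have "exp (w + of_int k *\<^sub>R (2 * pi * \<i>)) = exp w"
      unfolding exp_eq by (intro exI[of _ k]) (simp add: scaleR_conv_of_real mult_ac)
    then show ?thesis by (simp add: c v_def tube_exp_def)
  qed
  have \<sigma>_period: "\<sigma> (c + of_int k *\<^sub>R v) (d + of_int k *\<^sub>R v) = \<sigma> c d" for c d and k :: int
  proof -
    have "linepath (c + of_int k *\<^sub>R v) (d + of_int k *\<^sub>R v) t = linepath c d t + of_int k *\<^sub>R v" for t
      by (simp add: linepath_def algebra_simps)
    then have "tube_exp \<circ> linepath (c + of_int k *\<^sub>R v) (d + of_int k *\<^sub>R v) = tube_exp \<circ> linepath c d"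
      by (auto simp: tube_exp_period)
    then show ?thesis by (simp add: \<sigma>_def)
  qed
  obtain c where c: "c \<in> lift_piece t0 \<eta>" "u = tube_exp c"
    using u unfolding tube_piece_minus_K[OF \<eta>] by blast
  have cl: "c \<in> tube_lift" using c lift_piece_subset[OF \<eta>] by blast
  have zl: "(0, 0) \<in> tube_lift" by (simp add: tube_lift_def)
  let ?M = "\<sigma> (0, 0) ((0, 0) + v)" and ?N = "\<sigma> c (c + v)"
  have vl: "c + v \<in> tube_lift" "(0, 0) + v \<in> tube_lift"
    using v_lift[OF cl, of 1] v_lift[OF zl, of 1] by simp_all
  note G = cl_closed[OF g0(1)]
  have circle: "tube_exp \<circ> linepath (0, 0) ((0, 0) + v) = (\<lambda>t. \<Phi> (1, cis (2 * pi * t)))"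
    by (rule ext) (simp add: tube_exp_def linepath_def v_def cis_conv_exp scaleR_conv_of_real mult_ac)
  have circle_in: "path_in (- K) (\<lambda>t. \<Phi> (1, cis (2 * pi * t)))"
    unfolding circle[symmetric] by (intro image seg zl vl)
  have circle_ends: "pathstart (\<lambda>t. \<Phi> (1, cis (2 * pi * t))) = \<Phi> (1, 1)"
    "pathfinish (\<lambda>t. \<Phi> (1, cis (2 * pi * t))) = \<Phi> (1, 1)"
    by (simp_all add: pathstart_def pathfinish_def)
  have "m = cl (g0 +++ (\<lambda>t. \<Phi> (1, cis (2 * pi * t))) +++ reversepath g0)"
  proof -
    have "path_in (- K) (g0 +++ (\<lambda>t. \<Phi> (1, cis (2 * pi * t))) +++ reversepath g0)"
      using g0 circle_in circle_ends by (intro path_in_join) auto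
    then show ?thesis unfolding m using g0 by (intro cl_loop[symmetric]) (auto simp: loops_at_def path_in_def)
  qed
  also have "\<dots> = cl g0 \<otimes>\<^bsub>\<pi>\<^esub> (cl (\<lambda>t. \<Phi> (1, cis (2 * pi * t))) \<otimes>\<^bsub>\<pi>\<^esub> inv\<^bsub>\<pi>\<^esub> cl g0)"
    using g0 circle_in circle_ends by (simp add: cl_join path_in_join cl_reversepath)
  also have "cl (\<lambda>t. \<Phi> (1, cis (2 * pi * t))) = ?M" by (simp add: \<sigma>_def flip: circle)
  finally have mM: "m = cl g0 \<otimes>\<^bsub>\<pi>\<^esub> (?M \<otimes>\<^bsub>\<pi>\<^esub> inv\<^bsub>\<pi>\<^esub> cl g0)" .
  define r where "r = \<sigma> c (0, 0)"
  have r: "r \<in> carrier \<pi>" "?M \<in> carrier \<pi>" "?N \<in> carrier \<pi>"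
    unfolding r_def by (intro \<sigma>_closed cl zl vl)+
  \<comment> \<open>The segment from \<open>c\<close> to \<open>c + v\<close> is replaced by the
    route through 0 and \<open>v\<close>, whose last leg is a translate of the reversed first
    leg.\<close>
  have "?N = r \<otimes>\<^bsub>\<pi>\<^esub> ?M \<otimes>\<^bsub>\<pi>\<^esub> \<sigma> ((0, 0) + v) (c + v)"
    unfolding r_def by (simp only: \<sigma>_join cl zl vl)
  also have "\<sigma> ((0, 0) + v) (c + v) = \<sigma> (0, 0) c"
    using \<sigma>_period[of "(0, 0)" 1 c] by simp
  also have "\<dots> = inv\<^bsub>\<pi>\<^esub> r" unfolding r_def by (intro \<sigma>_inv cl zl)
  finally have NM: "?N = r \<otimes>\<^bsub>\<pi>\<^esub> ?M \<otimes>\<^bsub>\<pi>\<^esub> inv\<^bsub>\<pi>\<^esub> r" .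
  \<comment> \<open>\<open>m\<close> is the circle \<open>?M\<close> conjugated by the class of
    \<open>g0\<close>; this element undoes that and conjugates by \<open>r\<close> instead.\<close>
  define g where "g = r \<otimes>\<^bsub>\<pi>\<^esub> inv\<^bsub>\<pi>\<^esub> cl g0"
  have g: "g \<in> carrier \<pi>" using r G by (simp add: g_def)
  have Ng: "g \<otimes>\<^bsub>\<pi>\<^esub> m \<otimes>\<^bsub>\<pi>\<^esub> inv\<^bsub>\<pi>\<^esub> g = ?N"
    unfolding g_def mM NM using r G by (simp add: fg.conj_conj)
  have powers: "\<sigma> c (c + of_int k *\<^sub>R v) \<in> generate \<pi> {?N}" for k :: int
  proof (induction k rule: int_induct[where k = 0])
    case base
    show ?case using \<sigma>_refl[OF cl] generate.one[of \<pi>] by simp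
  next
    case (step1 k)
    have "\<sigma> c (c + of_int (k + 1) *\<^sub>R v) = \<sigma> c (c + of_int k *\<^sub>R v) \<otimes>\<^bsub>\<pi>\<^esub> \<sigma> (c + of_int k *\<^sub>R v) (c + of_int (k + 1) *\<^sub>R v)"
      by (intro \<sigma>_join[symmetric] v_lift cl)
    also have "\<sigma> (c + of_int k *\<^sub>R v) (c + of_int (k + 1) *\<^sub>R v) = ?N"
      using \<sigma>_period[of c k "c + v"] by (simp add: algebra_simps)
    finally show ?case using step1 by (auto intro: generate.eng generate.incl)
  next
    case (step2 k)
    have "\<sigma> c (c + of_int (k - 1) *\<^sub>R v) = \<sigma> c (c + of_int k *\<^sub>R v) \<otimes>\<^bsub>\<pi>\<^esub> \<sigma> (c + of_int k *\<^sub>R v) (c + of_int (k - 1) *\<^sub>R v)"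
      by (intro \<sigma>_join[symmetric] v_lift cl)
    also have "\<sigma> (c + of_int k *\<^sub>R v) (c + of_int (k - 1) *\<^sub>R v) = inv\<^bsub>\<pi>\<^esub> \<sigma> (c + of_int (k - 1) *\<^sub>R v) (c + of_int k *\<^sub>R v)"
      by (intro \<sigma>_inv v_lift cl)
    also have "\<sigma> (c + of_int (k - 1) *\<^sub>R v) (c + of_int k *\<^sub>R v) = ?N"
      using \<sigma>_period[of c "k - 1" "c + v"] by (simp add: algebra_simps)
    finally show ?case using step2 by (auto intro: generate.eng generate.inv)
  qed
  have "cl q \<in> generate \<pi> {g \<otimes>\<^bsub>\<pi>\<^esub> m \<otimes>\<^bsub>\<pi>\<^esub> inv\<^bsub>\<pi>\<^esub> g}"
    if q: "path_in (tube_piece t0 \<eta> - K) q" "pathstart q = u" "pathfinish q = u" for q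
  proof -
    obtain t1 w0 where tw: "c = (t1, w0)" by force
    obtain k :: int where "homotopic_paths (- K) q (tube_exp \<circ> linepath (t1, w0) (t1, w0 + of_int k * (2 * pi * \<i>)))"
      using loop_in_tube_piece[OF \<eta> q(1)] c q tw by blast
    moreover have "(t1, w0 + of_int k * (2 * pi * \<i>)) = c + of_int k *\<^sub>R v"
      by (simp add: tw v_def scaleR_conv_of_real)
    ultimately have "cl q = \<sigma> c (c + of_int k *\<^sub>R v)"
      unfolding \<sigma>_def tw by (metis cl_homotopic)
    then show ?thesis unfolding Ng using powers by simp
  qed
  with g show ?thesis by blast
qed

end

section \<open>Generation by conjugates of the meridian\<close>

lemma path_subdivision:
  fixes p :: "real \<Rightarrow> 'a::real_normed_vector"
  assumes p: "path_in S p" and e: "e > 0"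
  shows "\<exists>M::nat. M > 0 \<and>
    (\<forall>k<M. path_in (ball (p (real k / real M)) e \<inter> S) (subpath (real k / real M) (real (Suc k) / real M) p))"
proof -
  have "uniformly_continuous_on {0..1} p"
    using p by (intro compact_uniformly_continuous) (auto simp: path_in_def path_def)
  then obtain d where d: "d > 0" "\<And>s t. s \<in> {0..1} \<Longrightarrow> t \<in> {0..1} \<Longrightarrow> dist s t < d \<Longrightarrow> dist (p s) (p t) < e"
    using e unfolding uniformly_continuous_on_def by metis
  obtain M :: nat where M: "1 / d < real M" using reals_Archimedean2 by blast
  have "M > 0" using M d by (cases "M = 0") auto
  then have Md: "1 / real M < d" using M d by (simp add: field_simps)
  have "path_in (ball (p (real k / real M)) e \<inter> S) (subpath (real k / real M) (real (Suc k) / real M) p)"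
    if k: "k < M" for k
  proof -
    let ?s = "real k / real M" and ?t = "real (Suc k) / real M"
    have st: "?s \<in> {0..1}" "?t \<in> {0..1}" "?s \<le> ?t" using k by (auto simp: field_simps)
    have "p r \<in> ball (p ?s) e" if r: "r \<in> {?s..?t}" for r
    proof -
      have "dist ?s r \<le> 1 / real M" using r by (auto simp: dist_real_def add_divide_distrib)
      moreover have "r \<in> {0..1}" using r st by (meson atLeastAtMost_iff order_trans)
      ultimately have "dist (p ?s) (p r) < e" using st(1) Md by (intro d(2)) auto
      then show ?thesis by simp
    qed
    then have "path_image (subpath ?s ?t p) \<subseteq> ball (p ?s) e"
      using st by (auto simp: path_image_subpath)
    then show ?thesis using path_in_subpath[OF p st(1,2)] by (auto simp: path_in_def)
  qed
  with \<open>M > 0\<close> show ?thesis by blast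
qed

text \<open>The closure is compact and is covered by balls with centres in \<open>A\<close> itself,
  so for a ball minus the knot the net stays off the knot.\<close>

lemma finite_net:
  fixes A :: "'a::heine_borel set"
  assumes "bounded A" "e > 0"
  shows "\<exists>F\<subseteq>A. finite F \<and> (\<forall>y\<in>A. \<exists>v\<in>F. dist y v < e)"
proof -
  have comp: "compact (closure A)" using assms by simp
  have cov: "closure A \<subseteq> (\<Union>v\<in>A. ball v e)"
    using assms(2) by (auto simp: closure_approachable)
  obtain F where F: "F \<subseteq> A" "finite F" "closure A \<subseteq> (\<Union>v\<in>F. ball v e)"
    by (rule compactE_image[OF comp _ cov]) auto
  have "\<exists>v\<in>F. dist y v < e" if "y \<in> A" for y
  proof -
    have "y \<in> closure A" using that closure_subset by blast
    then obtain v where "v \<in> F" "y \<in> ball v e" using F(3) by blast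
    then show ?thesis by (auto simp: dist_commute)
  qed
  with F show ?thesis by blast
qed

lemma (in group) mult_inv_cancel:
  "a \<in> carrier G \<Longrightarrow> b \<in> carrier G \<Longrightarrow> a \<otimes> (inv a \<otimes> b) = b"
  by (simp flip: m_assoc)

lemma (in group) generate_finite_subset:
  assumes "z \<in> generate G A"
  shows "\<exists>B\<subseteq>A. finite B \<and> z \<in> generate G B"
  using assms
proof (induction rule: generate.induct)
  case one
  show ?case by (intro exI[of _ "{}"]) (auto intro: generate.one)
next
  case (incl h)
  then show ?case by (intro exI[of _ "{h}"]) (auto intro: generate.incl)
next
  case (inv h)
  then show ?case by (intro exI[of _ "{h}"]) (auto intro: generate.inv)
next
  case (eng h1 h2)
  then obtain B1 B2 where "B1 \<subseteq> A" "finite B1" "h1 \<in> generate G B1" "B2 \<subseteq> A" "finite B2" "h2 \<in> generate G B2"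
    by blast
  moreover from this have "h1 \<in> generate G (B1 \<union> B2)" "h2 \<in> generate G (B1 \<union> B2)"
    using mono_generate[of B1 "B1 \<union> B2"] mono_generate[of B2 "B1 \<union> B2"] by auto
  ultimately show ?case by (intro exI[of _ "B1 \<union> B2"]) (auto intro: generate.eng)
qed

text \<open>Each element of the finite set \<open>E\<close> is a word in finitely many elements of
  \<open>A\<close>. This merges finite generation with generation by all conjugates of the
  meridian.\<close>

lemma (in group) finite_generating_subset:
  assumes "carrier G = generate G A" "finite E" "carrier G = generate G E" "A \<subseteq> carrier G"
  shows "\<exists>B\<subseteq>A. finite B \<and> carrier G = generate G B"
proof -
  have "E \<subseteq> carrier G" using assms(3) generate.incl by fast
  then have "\<forall>z\<in>E. \<exists>B\<subseteq>A. finite B \<and> z \<in> generate G B"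
    using generate_finite_subset assms(1) by blast
  then obtain B where B: "\<And>z. z \<in> E \<Longrightarrow> B z \<subseteq> A \<and> finite (B z) \<and> z \<in> generate G (B z)" by metis
  let ?B = "\<Union>z\<in>E. B z"
  have BA: "?B \<subseteq> A" using B by blast
  have "z \<in> generate G ?B" if "z \<in> E" for z
    using B[OF that] mono_generate[of "B z" ?B] that by blast
  then have "E \<subseteq> generate G ?B" by blast
  then have "generate G E \<subseteq> generate G ?B"
    using BA assms(4) by (intro generate_subgroup_incl generate_is_subgroup) auto
  moreover have "generate G ?B \<subseteq> carrier G" using BA assms(4) by (intro generate_incl) auto
  ultimately show ?thesis using BA B assms(2,3) by (intro exI[of _ ?B]) auto
qed

section \<open>Uniform local control\<close>

text \<open>The local properties that the generation argument extracts from the tube. In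
  \<open>pieces\<close> the element \<open>g\<close> depends on \<open>U\<close> and the starting
  point \<open>u\<close> but not on the loop \<open>q\<close>; this keeps the number of generators
  finite.\<close>

locale meridional_complement = based_paths "- K" x a
  for K :: "'a::euclidean_space set" and x a +
  fixes m :: "(real \<Rightarrow> 'a) set"
  assumes compact_K: "compact K" and m: "m \<in> carrier \<pi>"
    and pieces: "0 < e \<Longrightarrow> \<exists>U. open U \<and> y \<in> U \<and> U \<subseteq> ball y e \<and> path_connected (U - K) \<and> U - K \<noteq> {} \<and>
      (\<forall>u\<in>U - K. \<exists>g\<in>carrier \<pi>. \<forall>q. path_in (U - K) q \<and> pathstart q = u \<and> pathfinish q = u \<longrightarrow>
        cl q \<in> generate \<pi> {g \<otimes>\<^bsub>\<pi>\<^esub> m \<otimes>\<^bsub>\<pi>\<^esub> inv\<^bsub>\<pi>\<^esub> g})"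
begin

abbreviation conj_m where "conj_m g \<equiv> g \<otimes>\<^bsub>\<pi>\<^esub> m \<otimes>\<^bsub>\<pi>\<^esub> inv\<^bsub>\<pi>\<^esub> g"

lemma complement_dense: "0 < e \<Longrightarrow> \<exists>z. z \<notin> K \<and> dist y z < e"
  using pieces[of e y] by (fastforce simp: subset_iff)

text \<open>\<delta> is a Lebesgue number of the cover by the sets from \<open>pieces\<close>; the
  property of their loops is inherited by subsets.\<close>

lemma small_loops:
  "\<exists>\<delta>>0. \<forall>u\<in>cball 0 R. \<forall>w\<in>ball u \<delta> - K. \<exists>g\<in>carrier \<pi>. \<forall>q.
     path_in (ball u \<delta> - K) q \<and> pathstart q = w \<and> pathfinish q = w \<longrightarrow> cl q \<in> generate \<pi> {conj_m g}"
proof -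
  let ?P = "\<lambda>U. \<forall>u\<in>U - K. \<exists>g\<in>carrier \<pi>. \<forall>q.
     path_in (U - K) q \<and> pathstart q = u \<and> pathfinish q = u \<longrightarrow> cl q \<in> generate \<pi> {conj_m g}"
  have cover: "cball 0 R \<subseteq> \<Union> {U. open U \<and> ?P U}"
  proof
    fix y :: 'a
    obtain U where "open U" "y \<in> U" "?P U" using pieces[of 1 y] by auto
    then show "y \<in> \<Union> {U. open U \<and> ?P U}" by blast
  qed
  obtain \<delta> where \<delta>: "\<delta> > 0" "\<And>u. u \<in> cball 0 R \<Longrightarrow> \<exists>U\<in>{U. open U \<and> ?P U}. ball u \<delta> \<subseteq> U"
    using Heine_Borel_lemma[OF compact_cball cover] by blast
  have "\<exists>g\<in>carrier \<pi>. \<forall>q. path_in (ball u \<delta> - K) q \<and> pathstart q = w \<and> pathfinish q = w \<longrightarrow> cl q \<in> generate \<pi> {conj_m g}"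
    if uw: "u \<in> cball 0 R" "w \<in> ball u \<delta> - K" for u w
  proof -
    obtain U where U: "?P U" "ball u \<delta> \<subseteq> U" using \<delta>(2)[OF uw(1)] by blast
    then have "w \<in> U - K" using uw by blast
    from bspec[OF U(1) this] obtain g where g: "g \<in> carrier \<pi>" "\<forall>q. path_in (U - K) q \<and>
        pathstart q = w \<and> pathfinish q = w \<longrightarrow> cl q \<in> generate \<pi> {conj_m g}" by (elim bexE)
    have "ball u \<delta> - K \<subseteq> U - K" using U(2) by blast
    then have "path_in (U - K) q" if "path_in (ball u \<delta> - K) q" for q
      using that path_in_subset by metis
    with g(2) show ?thesis by (intro bexI[OF _ g(1)]) simp
  qed
  with \<delta>(1) show ?thesis by blast
qed

lemma short_paths:
  assumes "0 < e"
  shows "\<exists>\<delta>>0. \<forall>u\<in>cball 0 R - K. \<forall>v. v \<notin> K \<and> dist u v < \<delta> \<longrightarrow>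
     (\<exists>\<gamma>. path_in (ball u e - K) \<gamma> \<and> pathstart \<gamma> = u \<and> pathfinish \<gamma> = v)"
proof -
  let ?P = "\<lambda>U. path_connected (U - K) \<and> (\<forall>u\<in>U. U \<subseteq> ball u e)"
  have cover: "cball 0 R \<subseteq> \<Union> {U. open U \<and> ?P U}"
  proof
    fix y :: 'a
    \<comment> \<open>Half the radius, so that \<open>U\<close> lies in the ball of radius
      \<open>e\<close> around each of its points and not only around \<open>y\<close>.\<close>
    obtain U where U: "open U" "y \<in> U" "U \<subseteq> ball y (e / 2)" "path_connected (U - K)"
      using pieces[of "e / 2" y] assms by auto
    have "U \<subseteq> ball u e" if "u \<in> U" for u
    proof
      fix z assume "z \<in> U"
      then have "dist y z < e / 2" "dist y u < e / 2" using U(3) that by auto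
      then have "dist u z < e / 2 + e / 2" using dist_triangle3[of u z y] by linarith
      then show "z \<in> ball u e" by simp
    qed
    then show "y \<in> \<Union> {U. open U \<and> ?P U}" using U by blast
  qed
  obtain \<delta> where \<delta>: "\<delta> > 0" "\<And>u. u \<in> cball 0 R \<Longrightarrow> \<exists>U\<in>{U. open U \<and> ?P U}. ball u \<delta> \<subseteq> U"
    using Heine_Borel_lemma[OF compact_cball cover] by blast
  have "\<exists>\<gamma>. path_in (ball u e - K) \<gamma> \<and> pathstart \<gamma> = u \<and> pathfinish \<gamma> = v"
    if uv: "u \<in> cball 0 R - K" "v \<notin> K" "dist u v < \<delta>" for u v
  proof -
    have "u \<in> cball 0 R" using uv(1) by blast
    then obtain U where U: "path_connected (U - K)" "\<forall>u\<in>U. U \<subseteq> ball u e" "ball u \<delta> \<subseteq> U" using \<delta>(2) by blast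
    have "u \<in> U" "v \<in> U" using U(3) uv(3) \<delta>(1) by auto
    then have "u \<in> U - K" "v \<in> U - K" using uv by auto
    then obtain \<gamma> where \<gamma>: "path_in (U - K) \<gamma>" "pathstart \<gamma> = u" "pathfinish \<gamma> = v"
      using U(1) unfolding path_connected_def path_in_def by metis
    have "U - K \<subseteq> ball u e - K" using U(2) \<open>u \<in> U\<close> by blast
    with \<gamma> show ?thesis using path_in_subset by blast
  qed
  with \<delta>(1) show ?thesis by blast
qed

text \<open>The factor 4 leaves room to concatenate short paths from neighbouring points inside one
  ball of radius \<delta>1, where loops are controlled. One path \<gamma> per pair of points is
  fixed, so that its class can serve as a generator or as a transition element.\<close>

lemma scales:
  obtains \<delta>1 \<delta> \<gamma> where "0 < \<delta>" "\<delta> \<le> \<delta>1 / 4"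
    and "\<And>u w. u \<in> cball 0 R \<Longrightarrow> w \<in> ball u \<delta>1 - K \<Longrightarrow> \<exists>g\<in>carrier \<pi>. \<forall>q.
      path_in (ball u \<delta>1 - K) q \<and> pathstart q = w \<and> pathfinish q = w \<longrightarrow> cl q \<in> generate \<pi> {conj_m g}"
    and "\<And>u v. u \<in> cball 0 R - K \<Longrightarrow> v \<notin> K \<Longrightarrow> dist u v < \<delta> \<Longrightarrow>
      path_in (ball u (\<delta>1 / 4) - K) (\<gamma> u v) \<and> pathstart (\<gamma> u v) = u \<and> pathfinish (\<gamma> u v) = v"
proof -
  obtain \<delta>1 where \<delta>1: "\<delta>1 > 0" "\<And>u w. u \<in> cball 0 R \<Longrightarrow> w \<in> ball u \<delta>1 - K \<Longrightarrow> \<exists>g\<in>carrier \<pi>. \<forall>q.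
      path_in (ball u \<delta>1 - K) q \<and> pathstart q = w \<and> pathfinish q = w \<longrightarrow> cl q \<in> generate \<pi> {conj_m g}"
    using small_loops[of R] by blast
  have "0 < \<delta>1 / 4" using \<delta>1 by simp
  from short_paths[OF this, of R] obtain \<delta>2 where \<delta>2: "\<delta>2 > 0" "\<forall>u\<in>cball 0 R - K. \<forall>v. v \<notin> K \<and> dist u v < \<delta>2 \<longrightarrow>
     (\<exists>\<gamma>. path_in (ball u (\<delta>1 / 4) - K) \<gamma> \<and> pathstart \<gamma> = u \<and> pathfinish \<gamma> = v)"
    by blast
  define \<gamma> where "\<gamma> u v = (SOME \<gamma>. path_in (ball u (\<delta>1 / 4) - K) \<gamma> \<and> pathstart \<gamma> = u \<and> pathfinish \<gamma> = v)" for u v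
  show thesis
  proof (rule that[of "min \<delta>2 (\<delta>1 / 4)" \<delta>1 \<gamma>])
    fix u v assume uv: "u \<in> cball 0 R - K" "v \<notin> K" "dist u v < min \<delta>2 (\<delta>1 / 4)"
    then have "dist u v < \<delta>2" by simp
    then have "\<exists>\<gamma>. path_in (ball u (\<delta>1 / 4) - K) \<gamma> \<and> pathstart \<gamma> = u \<and> pathfinish \<gamma> = v" using \<delta>2(2) uv by blast
    then show "path_in (ball u (\<delta>1 / 4) - K) (\<gamma> u v) \<and> pathstart (\<gamma> u v) = u \<and> pathfinish (\<gamma> u v) = v"
      unfolding \<gamma>_def by (rule someI_ex)
  qed (use \<delta>1 \<delta>2 in auto)
qed

section \<open>Generation by loops inside a large ball\<close>

lemma conj_m_closed: "g \<in> carrier \<pi> \<Longrightarrow> conj_m g \<in> carrier \<pi>"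
  using m by simp

lemma path_in_ball_mono:
  assumes "path_in (ball v r - K) q" "dist u v + r \<le> s"
  shows "path_in (ball u s - K) q"
proof (rule path_in_subset[OF assms(1)])
  have "dist u z < s" if "dist v z < r" for z using dist_triangle[of u z v] that assms(2) by linarith
  then show "ball v r - K \<subseteq> ball u s - K" by auto
qed

lemma path_in_K: "path_in (ball u r - K) q \<Longrightarrow> path_in (- K) q"
  by (erule path_in_subset) blast

text \<open>The net of short paths \<open>\<gamma>\<close> gives finitely many generators: a loop is cut into small pieces whose
  end points are moved to the net; each piece then differs from some \<open>\<gamma> v v'\<close> by a small loop at \<open>v\<close>.\<close>
lemma finitely_generated_loops:
  assumes x: "x \<in> cball 0 R"
  shows "\<exists>E. finite E \<and> E \<subseteq> carrier \<pi> \<and>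
    (\<forall>p. path_in (cball 0 R - K) p \<and> pathstart p = x \<and> pathfinish p = x \<longrightarrow> cl p \<in> generate \<pi> E)"
proof -
  obtain \<delta>1 \<delta> \<gamma> where \<delta>: "0 < \<delta>" "\<delta> \<le> \<delta>1 / 4"
    and loops: "\<And>u w. u \<in> cball 0 R \<Longrightarrow> w \<in> ball u \<delta>1 - K \<Longrightarrow> \<exists>g\<in>carrier \<pi>. \<forall>q.
      path_in (ball u \<delta>1 - K) q \<and> pathstart q = w \<and> pathfinish q = w \<longrightarrow> cl q \<in> generate \<pi> {conj_m g}"
    and \<gamma>: "\<And>u v. u \<in> cball 0 R - K \<Longrightarrow> v \<notin> K \<Longrightarrow> dist u v < \<delta> \<Longrightarrow>
      path_in (ball u (\<delta>1 / 4) - K) (\<gamma> u v) \<and> pathstart (\<gamma> u v) = u \<and> pathfinish (\<gamma> u v) = v"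
    by (rule scales) blast
  have "bounded (cball 0 R - K)" using bounded_subset[OF bounded_cball] by blast
  moreover have "0 < \<delta> / 4" using \<delta> by simp
  ultimately obtain F0 where F0: "F0 \<subseteq> cball 0 R - K" "finite F0" "\<forall>y\<in>cball 0 R - K. \<exists>v\<in>F0. dist y v < \<delta> / 4"
    using finite_net[of "cball 0 R - K" "\<delta> / 4"] by metis
  \<comment> \<open>\<open>x\<close> joins the net so that a loop at \<open>x\<close> starts and
    ends at a net point.\<close>
  define F where "F = insert x F0"
  have F: "F \<subseteq> cball 0 R - K" "finite F" "x \<in> F" using F0 x base by (auto simp: F_def)
  have net: "\<exists>v\<in>F. dist y v < \<delta> / 4" if "y \<in> cball 0 R - K" for y using F0(3) that by (auto simp: F_def)
  have "\<exists>g\<in>carrier \<pi>. \<forall>q. path_in (ball v \<delta>1 - K) q \<and> pathstart q = v \<and> pathfinish q = v \<longrightarrow>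
      cl q \<in> generate \<pi> {conj_m g}" if "v \<in> F" for v
    using that F(1) \<delta> by (intro loops) auto
  then obtain g where g: "\<And>v. v \<in> F \<Longrightarrow> g v \<in> carrier \<pi>"
    "\<And>v q. v \<in> F \<Longrightarrow> path_in (ball v \<delta>1 - K) q \<Longrightarrow> pathstart q = v \<Longrightarrow> pathfinish q = v \<Longrightarrow>
      cl q \<in> generate \<pi> {conj_m (g v)}" by metis
  \<comment> \<open>Transitions between close net points, and for each net point the conjugate of
    \<open>m\<close> that generates the small loops there.\<close>
  define E where "E = (\<lambda>(v, v'). cl (\<gamma> v v')) ` {(v, v') \<in> F \<times> F. dist v v' < \<delta>} \<union> (\<lambda>v. conj_m (g v)) ` F"
  have "{(v, v') \<in> F \<times> F. dist v v' < \<delta>} \<subseteq> F \<times> F" by blast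
  then have "finite {(v, v') \<in> F \<times> F. dist v v' < \<delta>}" using F(2) finite_subset by blast
  then have finE: "finite E" using F(2) by (simp add: E_def)
  have \<gamma>K: "path_in (- K) (\<gamma> u v)" if "u \<in> cball 0 R - K" "v \<notin> K" "dist u v < \<delta>" for u v
    using \<gamma>[OF that] path_in_K by blast
  have EG: "E \<subseteq> carrier \<pi>"
  proof
    fix z assume "z \<in> E"
    then consider v v' where "v \<in> F" "v' \<in> F" "dist v v' < \<delta>" "z = cl (\<gamma> v v')"
      | v where "v \<in> F" "z = conj_m (g v)" by (auto simp: E_def)
    then show "z \<in> carrier \<pi>"
    proof cases
      case 1
      then show ?thesis using \<gamma>K[of v v'] F(1) cl_closed by blast
    qed (use g conj_m_closed in blast)
  qed
  let ?H = "generate \<pi> E"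
  have Hsub: "subgroup ?H \<pi>" using EG by (rule fg.generate_is_subgroup)
  have \<gamma>H: "cl (\<gamma> v v') \<in> ?H" if "v \<in> F" "v' \<in> F" "dist v v' < \<delta>" for v v'
    using that by (intro generate.incl) (auto simp: E_def)
  have gH: "generate \<pi> {conj_m (g v)} \<subseteq> ?H" if "v \<in> F" for v
    using that by (intro fg.mono_generate) (auto simp: E_def)
  \<comment> \<open>Closing \<zeta> up by the chosen path between the same ends gives a small loop
    at \<open>v\<close>, whose class is a power of the conjugate belonging to
    \<open>v\<close>.\<close>
  have short: "cl \<zeta> \<in> ?H" if v: "v \<in> F" "v' \<in> F" "dist v v' < \<delta>"
    and \<zeta>: "path_in (ball v \<delta>1 - K) \<zeta>" "pathstart \<zeta> = v" "pathfinish \<zeta> = v'" for v v' \<zeta>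
  proof -
    have vv: "v \<in> cball 0 R - K" "v' \<notin> K" using v F by auto
    have \<gamma>': "path_in (ball v \<delta>1 - K) (\<gamma> v v')" "pathstart (\<gamma> v v') = v" "pathfinish (\<gamma> v v') = v'"
      using \<gamma>[OF vv v(3)] path_in_ball_mono[of v "\<delta>1 / 4" "\<gamma> v v'" v \<delta>1] \<delta> by auto
    have "path_in (ball v \<delta>1 - K) (\<zeta> +++ reversepath (\<gamma> v v'))"
      using \<zeta> \<gamma>' by (intro path_in_join) simp_all
    then have "cl (\<zeta> +++ reversepath (\<gamma> v v')) \<in> generate \<pi> {conj_m (g v)}"
      by (rule g(2)[OF v(1)]) (use \<zeta> \<gamma>' in simp_all)
    then have "cl (\<zeta> +++ reversepath (\<gamma> v v')) \<in> ?H" using gH[OF v(1)] by blast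
    moreover have "cl (\<zeta> +++ reversepath (\<gamma> v v')) = cl \<zeta> \<otimes>\<^bsub>\<pi>\<^esub> inv\<^bsub>\<pi>\<^esub> cl (\<gamma> v v')"
      using \<zeta> \<gamma>' path_in_K by (subst cl_join) (auto simp: cl_reversepath)
    ultimately have "(cl \<zeta> \<otimes>\<^bsub>\<pi>\<^esub> inv\<^bsub>\<pi>\<^esub> cl (\<gamma> v v')) \<otimes>\<^bsub>\<pi>\<^esub> cl (\<gamma> v v') \<in> ?H"
      using \<gamma>H[OF v] subgroup.m_closed[OF Hsub] by simp
    then show ?thesis using cl_closed[OF path_in_K[OF \<zeta>(1)]] cl_closed[OF path_in_K[OF \<gamma>'(1)]]
      by (simp add: fg.m_assoc)
  qed
  have "cl p \<in> ?H" if p: "path_in (cball 0 R - K) p" "pathstart p = x" "pathfinish p = x" for p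
  proof -
    obtain M :: nat where M: "M > 0" "\<And>k. k < M \<Longrightarrow>
        path_in (ball (p (real k / real M)) (\<delta> / 4) \<inter> (cball 0 R - K)) (subpath (real k / real M) (real (Suc k) / real M) p)"
      using path_subdivision[OF p(1) \<open>0 < \<delta> / 4\<close>] by blast
    define P where "P k = p (real k / real M)" for k
    define c where "c k = subpath (real k / real M) (real (Suc k) / real M) p" for k
    have t01: "real k / real M \<in> {0..1}" if "k \<le> M" for k using that M(1) by auto
    have P: "P k \<in> cball 0 R - K" if "k \<le> M" for k
      using p(1) t01[OF that] unfolding P_def path_in_def path_image_def by blast
    have c: "path_in (ball (P k) (\<delta> / 4) - K) (c k)" "pathstart (c k) = P k" "pathfinish (c k) = P (Suc k)" if "k < M" for k
      using M(2)[OF that] path_in_subset[of _ "c k" "ball (P k) (\<delta> / 4) - K"] by (auto simp: c_def P_def)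
    have dP: "dist (P k) (P (Suc k)) < \<delta> / 4" if "k < M" for k
      using path_in_starts(2)[OF c(1)[OF that]] c(3)[OF that] by simp
    define s where "s k = subpath 0 (real k / real M) p" for k
    have pK: "path_in (- K) p" using p(1) by (rule path_in_subset) blast
    have s: "path_in (- K) (s k)" "pathstart (s k) = x" "pathfinish (s k) = P k" if "k \<le> M" for k
      using path_in_subpath[OF pK _ t01[OF that], of 0] p(2)[unfolded pathstart_def] by (auto simp: s_def P_def)
    have s_Suc: "cl (s (Suc k)) = cl (s k) \<otimes>\<^bsub>\<pi>\<^esub> cl (c k)" if "k < M" for k
    proof -
      have "cl (s k +++ c k) = cl (s (Suc k))"
        unfolding s_def c_def
        by (intro cl_homotopic homotopic_join_subpaths) (use pK that t01[of k] t01[of "Suc k"] in \<open>auto simp: path_in_def\<close>)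
      then show ?thesis using s[of k] c[OF that] that path_in_K by (simp add: cl_join)
    qed
    \<comment> \<open>Induction over the initial segments of \<open>p\<close>, each moved at its end
      to a net point. The claim covers every nearby \<open>v\<close>, so that consecutive steps may
      use different net points.\<close>
    have "cl (s k) \<otimes>\<^bsub>\<pi>\<^esub> cl (\<gamma> (P k) v) \<in> ?H" if "k \<le> M" "v \<in> F" "dist (P k) v < \<delta> / 4" for k v
      using that
    proof (induction k arbitrary: v)
      case 0
      have "P 0 = x" using p(2) by (simp add: P_def pathstart_def)
      moreover have "s 0 = linepath x x"
        using p(2)[unfolded pathstart_def] by (auto simp: s_def subpath_def linepath_refl)
      then have "cl (s 0) = \<one>\<^bsub>\<pi>\<^esub>" using cl_refl[OF base] by simp
      moreover have "cl (\<gamma> x v) \<in> ?H" using 0 F(3) \<delta> \<open>P 0 = x\<close> by (intro \<gamma>H) auto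
      ultimately show ?case using subgroup.mem_carrier[OF Hsub] by simp
    next
      case (Suc k)
      then have k: "k < M" by simp
      obtain u where u: "u \<in> F" "dist (P k) u < \<delta> / 4" using net P[of k] k by auto
      have uK: "u \<notin> K" "v \<notin> K" using u Suc.prems F by auto
      have \<gamma>u: "path_in (ball (P k) (\<delta>1 / 4) - K) (\<gamma> (P k) u)" "pathstart (\<gamma> (P k) u) = P k" "pathfinish (\<gamma> (P k) u) = u"
        using \<gamma>[OF P uK(1), of k] k u \<delta> by auto
      have \<gamma>v: "path_in (ball (P (Suc k)) (\<delta>1 / 4) - K) (\<gamma> (P (Suc k)) v)" "pathstart (\<gamma> (P (Suc k)) v) = P (Suc k)"
          "pathfinish (\<gamma> (P (Suc k)) v) = v"
        using \<gamma>[OF P[OF Suc.prems(1)] uK(2)] Suc.prems \<delta> by auto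
      have d: "dist u (P k) < \<delta> / 4" "dist u (P (Suc k)) < \<delta> / 2" "dist u v < \<delta>"
        using u(2) dP[OF k] Suc.prems(3) dist_triangle[of u "P (Suc k)" "P k"] dist_triangle[of u v "P (Suc k)"] \<delta>
        by (auto simp: dist_commute)
      let ?\<zeta> = "reversepath (\<gamma> (P k) u) +++ (c k +++ \<gamma> (P (Suc k)) v)"
      have "path_in (ball u \<delta>1 - K) (\<gamma> (P k) u)" "path_in (ball u \<delta>1 - K) (c k)" "path_in (ball u \<delta>1 - K) (\<gamma> (P (Suc k)) v)"
        using path_in_ball_mono[OF \<gamma>u(1)] path_in_ball_mono[OF c(1)[OF k]] path_in_ball_mono[OF \<gamma>v(1)] d \<delta> by auto
      then have \<zeta>: "path_in (ball u \<delta>1 - K) ?\<zeta>"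
        using \<gamma>u c[OF k] \<gamma>v by (intro path_in_join) auto
      have "cl ?\<zeta> \<in> ?H"
        using u(1) Suc.prems(2) d(3) \<zeta> by (rule short) (use \<gamma>u \<gamma>v in auto)
      moreover have "cl ?\<zeta> = inv\<^bsub>\<pi>\<^esub> cl (\<gamma> (P k) u) \<otimes>\<^bsub>\<pi>\<^esub> (cl (c k) \<otimes>\<^bsub>\<pi>\<^esub> cl (\<gamma> (P (Suc k)) v))"
        using path_in_K[OF \<gamma>u(1)] path_in_K[OF c(1)[OF k]] path_in_K[OF \<gamma>v(1)] \<gamma>u c[OF k] \<gamma>v
        by (simp add: cl_join path_in_join cl_reversepath)
      moreover have "cl (s k) \<otimes>\<^bsub>\<pi>\<^esub> cl (\<gamma> (P k) u) \<in> ?H" using Suc.IH[of u] u k by simp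
      ultimately have "(cl (s k) \<otimes>\<^bsub>\<pi>\<^esub> cl (\<gamma> (P k) u)) \<otimes>\<^bsub>\<pi>\<^esub>
          (inv\<^bsub>\<pi>\<^esub> cl (\<gamma> (P k) u) \<otimes>\<^bsub>\<pi>\<^esub> (cl (c k) \<otimes>\<^bsub>\<pi>\<^esub> cl (\<gamma> (P (Suc k)) v))) \<in> ?H"
        using subgroup.m_closed[OF Hsub] by simp
      also have "(cl (s k) \<otimes>\<^bsub>\<pi>\<^esub> cl (\<gamma> (P k) u)) \<otimes>\<^bsub>\<pi>\<^esub>
          (inv\<^bsub>\<pi>\<^esub> cl (\<gamma> (P k) u) \<otimes>\<^bsub>\<pi>\<^esub> (cl (c k) \<otimes>\<^bsub>\<pi>\<^esub> cl (\<gamma> (P (Suc k)) v))) =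
          cl (s (Suc k)) \<otimes>\<^bsub>\<pi>\<^esub> cl (\<gamma> (P (Suc k)) v)"
      proof -
        have "cl (s k) \<in> carrier \<pi>" "cl (\<gamma> (P k) u) \<in> carrier \<pi>" "cl (c k) \<in> carrier \<pi>" "cl (\<gamma> (P (Suc k)) v) \<in> carrier \<pi>"
          using s[of k] k path_in_K \<gamma>u c[OF k] \<gamma>v cl_closed by auto
        then show ?thesis unfolding s_Suc[OF k] by (simp add: fg.m_assoc fg.mult_inv_cancel)
      qed
      finally show ?case .
    qed
    moreover have "P M = x" using M(1) p(3) by (simp add: P_def pathfinish_def)
    \<comment> \<open>The end point is \<open>x\<close>, so \<open>v = x\<close> is admissible; the
      surplus class of \<open>\<gamma> x x\<close> is itself a generator and is cancelled.\<close>
    ultimately have "cl (s M) \<otimes>\<^bsub>\<pi>\<^esub> cl (\<gamma> x x) \<in> ?H" using F(3) \<delta> by force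
    moreover have "s M = p" using M(1) by (simp add: s_def)
    moreover have "cl (\<gamma> x x) \<in> ?H" using F(3) \<delta> by (intro \<gamma>H) auto
    ultimately have "cl p \<otimes>\<^bsub>\<pi>\<^esub> cl (\<gamma> x x) \<otimes>\<^bsub>\<pi>\<^esub> inv\<^bsub>\<pi>\<^esub> cl (\<gamma> x x) \<in> ?H"
      using subgroup.m_closed[OF Hsub] subgroup.m_inv_closed[OF Hsub] by simp
    then show ?thesis
      using cl_closed[OF pK] \<open>cl (\<gamma> x x) \<in> ?H\<close> subgroup.mem_carrier[OF Hsub] by (simp add: fg.m_assoc)
  qed
  with finE EG show ?thesis by blast
qed

text \<open>Modulo the normal closure \<open>N\<close> of \<open>m\<close> the class of a short path depends only on its end points,
  also across \<open>K\<close>: \<open>T\<close> is a flat connection on the whole ball. The product \<open>F u\<close> of \<open>T\<close> along the ray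
  from \<open>0\<close> to \<open>u\<close> trivializes it, whence every loop is trivial modulo \<open>N\<close>.\<close>
lemma loop_in_normal_closure:
  assumes K: "K \<subseteq> ball 0 R" and p: "path_in (cball 0 R - K) p" "pathstart p = x" "pathfinish p = x"
  shows "cl p \<in> generate \<pi> (conj_m ` carrier \<pi>)"
proof -
  let ?D = "cball 0 R - K"
  obtain \<delta>1 \<delta> \<gamma> where \<delta>: "0 < \<delta>" "\<delta> \<le> \<delta>1 / 4"
    and loops: "\<And>u w. u \<in> cball 0 R \<Longrightarrow> w \<in> ball u \<delta>1 - K \<Longrightarrow> \<exists>g\<in>carrier \<pi>. \<forall>q.
      path_in (ball u \<delta>1 - K) q \<and> pathstart q = w \<and> pathfinish q = w \<longrightarrow> cl q \<in> generate \<pi> {conj_m g}"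
    and \<gamma>: "\<And>u v. u \<in> ?D \<Longrightarrow> v \<notin> K \<Longrightarrow> dist u v < \<delta> \<Longrightarrow>
      path_in (ball u (\<delta>1 / 4) - K) (\<gamma> u v) \<and> pathstart (\<gamma> u v) = u \<and> pathfinish (\<gamma> u v) = v"
    by (rule scales) blast
  define N where "N = generate \<pi> (conj_m ` carrier \<pi>)"
  have conj: "conj_m ` carrier \<pi> \<subseteq> carrier \<pi>" using conj_m_closed by blast
  have "N \<lhd> \<pi>" unfolding N_def
  proof (rule fg.normal_generateI[OF conj])
    fix h g assume h: "h \<in> conj_m ` carrier \<pi>" and g: "g \<in> carrier \<pi>"
    then obtain r where r: "r \<in> carrier \<pi>" "h = conj_m r" by blast
    then have "g \<otimes>\<^bsub>\<pi>\<^esub> h \<otimes>\<^bsub>\<pi>\<^esub> inv\<^bsub>\<pi>\<^esub> g = conj_m (g \<otimes>\<^bsub>\<pi>\<^esub> r)"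
      using g m by (simp add: fg.m_assoc fg.inv_mult_group)
    then show "g \<otimes>\<^bsub>\<pi>\<^esub> h \<otimes>\<^bsub>\<pi>\<^esub> inv\<^bsub>\<pi>\<^esub> g \<in> conj_m ` carrier \<pi>" using g r by blast
  qed
  then interpret N: normal N \<pi> .
  have Nsub: "subgroup N \<pi>" by (rule N.is_subgroup)
  let ?Q = "\<pi> Mod N"
  interpret Q: group ?Q by (rule N.factorgroup_is_group)
  define \<kappa> where "\<kappa> q = N #>\<^bsub>\<pi>\<^esub> cl q" for q
  have \<kappa>_closed: "\<kappa> q \<in> carrier ?Q" if "path_in (- K) q" for q
    using cl_closed[OF that] N.subset by (simp add: \<kappa>_def FactGroup_def fg.rcosetsI)
  have \<kappa>_join: "\<kappa> (q +++ r) = \<kappa> q \<otimes>\<^bsub>?Q\<^esub> \<kappa> r" if "path_in (- K) q" "path_in (- K) r" "pathfinish q = pathstart r" for q r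
    using that cl_closed by (simp add: \<kappa>_def FactGroup_def N.rcos_sum cl_join)
  \<comment> \<open>\<open>q\<close> followed by the reverse of \<open>r\<close> is a small loop,
    hence a power of a conjugate of \<open>m\<close> and trivial modulo \<open>N\<close>.\<close>
  have \<kappa>_eq: "\<kappa> q = \<kappa> r" if u: "u \<in> cball 0 R" and q: "path_in (ball u \<delta>1 - K) q" and r: "path_in (ball u \<delta>1 - K) r"
    and e: "pathstart q = pathstart r" "pathfinish q = pathfinish r" for u q r
  proof -
    have cq: "cl q \<in> carrier \<pi>" "cl r \<in> carrier \<pi>" using q r path_in_K cl_closed by auto
    have "path_in (ball u \<delta>1 - K) (q +++ reversepath r)" using q r e by (intro path_in_join) simp_all
    moreover obtain g where "g \<in> carrier \<pi>" "\<forall>q'. path_in (ball u \<delta>1 - K) q' \<and> pathstart q' = pathstart q \<and>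
        pathfinish q' = pathstart q \<longrightarrow> cl q' \<in> generate \<pi> {conj_m g}"
      using loops[OF u path_in_starts(1)[OF q]] by (elim bexE)
    ultimately have "cl (q +++ reversepath r) \<in> generate \<pi> {conj_m g}" "g \<in> carrier \<pi>"
      using e by simp_all
    moreover from this have "generate \<pi> {conj_m g} \<subseteq> N"
      unfolding N_def by (intro fg.mono_generate) blast
    moreover have "cl (q +++ reversepath r) = cl q \<otimes>\<^bsub>\<pi>\<^esub> inv\<^bsub>\<pi>\<^esub> cl r"
      using path_in_K[OF q] path_in_K[OF r] e by (simp add: cl_join cl_reversepath)
    ultimately have "cl q \<otimes>\<^bsub>\<pi>\<^esub> inv\<^bsub>\<pi>\<^esub> cl r \<in> N" by auto
    then have "N #>\<^bsub>\<pi>\<^esub> (cl q \<otimes>\<^bsub>\<pi>\<^esub> inv\<^bsub>\<pi>\<^esub> cl r) = N"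
      using cq Nsub by (intro fg.coset_join2) auto
    then show ?thesis using cq N.subset unfolding \<kappa>_def by (intro fg.coset_mult_inv1) auto
  qed
  define T where "T u v = \<kappa> (\<gamma> u v)" for u v
  have T_closed: "T u v \<in> carrier ?Q" if "u \<in> ?D" "v \<in> ?D" "dist u v < \<delta>" for u v
    unfolding T_def using \<gamma>[of u v] that path_in_K by (intro \<kappa>_closed) blast
  have T_flat: "T u v \<otimes>\<^bsub>?Q\<^esub> T v w = T u w"
    if D: "u \<in> ?D" "v \<in> ?D" "w \<in> ?D" and d: "dist u v < \<delta>" "dist v w < \<delta>" "dist u w < \<delta>" for u v w
  proof -
    have \<gamma>uv: "path_in (ball u (\<delta>1 / 4) - K) (\<gamma> u v)" "pathstart (\<gamma> u v) = u" "pathfinish (\<gamma> u v) = v"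
      and \<gamma>vw: "path_in (ball v (\<delta>1 / 4) - K) (\<gamma> v w)" "pathstart (\<gamma> v w) = v" "pathfinish (\<gamma> v w) = w"
      and \<gamma>uw: "path_in (ball u (\<delta>1 / 4) - K) (\<gamma> u w)" "pathstart (\<gamma> u w) = u" "pathfinish (\<gamma> u w) = w"
      using \<gamma>[of u v] \<gamma>[of v w] \<gamma>[of u w] D d by auto
    have in_u: "path_in (ball u \<delta>1 - K) (\<gamma> u v)" "path_in (ball u \<delta>1 - K) (\<gamma> v w)" "path_in (ball u \<delta>1 - K) (\<gamma> u w)"
      using path_in_ball_mono[OF \<gamma>uv(1), of u \<delta>1] path_in_ball_mono[OF \<gamma>vw(1), of u \<delta>1]
        path_in_ball_mono[OF \<gamma>uw(1), of u \<delta>1] d \<delta> by auto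
    have "T u v \<otimes>\<^bsub>?Q\<^esub> T v w = \<kappa> (\<gamma> u v +++ \<gamma> v w)"
      unfolding T_def using path_in_K[OF \<gamma>uv(1)] path_in_K[OF \<gamma>vw(1)] \<gamma>uv \<gamma>vw by (intro \<kappa>_join[symmetric]) auto
    also have "\<dots> = T u w" unfolding T_def
    proof (rule \<kappa>_eq)
      show "path_in (ball u \<delta>1 - K) (\<gamma> u v +++ \<gamma> v w)" using in_u \<gamma>uv \<gamma>vw by (intro path_in_join) auto
    qed (use D in_u \<gamma>uv \<gamma>vw \<gamma>uw in auto)
    finally show ?thesis .
  qed
  have T_refl: "T u u = \<one>\<^bsub>?Q\<^esub>" if "u \<in> ?D" for u
    using T_flat[of u u u] T_closed[of u u] that \<delta> Q.l_cancel_one' by force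
  \<comment> \<open>The push off \<open>K\<close>. The new point stays in the ball because
    \<open>K\<close> lies in the open ball.\<close>
  have "\<exists>z. z \<in> ?D \<and> dist y z < \<delta> / 4 \<and> (y \<notin> K \<longrightarrow> z = y)" if "y \<in> cball 0 R" for y
  proof (cases "y \<in> K")
    case True
    then have "norm y < R" using K by auto
    then obtain z where z: "z \<notin> K" "dist y z < min (\<delta> / 4) (R - norm y)"
      using complement_dense[of "min (\<delta> / 4) (R - norm y)" y] \<delta> by auto
    have "norm z \<le> norm y + dist y z" by (metis dist_commute dist_norm norm_triangle_sub)
    with z True show ?thesis by (intro exI[of _ z]) auto
  qed (use that \<delta> in auto)
  then obtain j where j: "\<And>y. y \<in> cball 0 R \<Longrightarrow> j y \<in> ?D \<and> dist y (j y) < \<delta> / 4 \<and> (y \<notin> K \<longrightarrow> j y = y)"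
    by metis
  \<comment> \<open>Rays in the ball have length at most \<open>R\<close>, so one number of steps
    makes consecutive points on every ray closer than \<delta> / 4.\<close>
  obtain n0 :: nat where n0: "R / (\<delta> / 4) < real n0" using reals_Archimedean2 by blast
  define n where "n = Suc n0"
  have n: "n > 0" "R / real n < \<delta> / 4" using n0 \<delta> by (auto simp: n_def field_simps)
  define P where "P u k = (real k / real n) *\<^sub>R u" for u :: 'a and k
  have P_in: "P u k \<in> cball 0 R" if "u \<in> cball 0 R" "k \<le> n" for u k
  proof -
    have "norm (P u k) \<le> 1 * norm u" unfolding P_def norm_scaleR using that n by (intro mult_right_mono) auto
    then show ?thesis using that by auto
  qed
  have P_dist: "dist (P u k) (P v k) \<le> dist u v" if "k \<le> n" for u v k
  proof -
    have "dist (P u k) (P v k) = (real k / real n) * dist u v"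
      by (simp add: P_def dist_norm flip: scaleR_diff_right)
    also have "\<dots> \<le> 1 * dist u v" using that n by (intro mult_right_mono) auto
    finally show ?thesis by simp
  qed
  have P_step: "dist (P u k) (P u (Suc k)) < \<delta> / 4" if "u \<in> cball 0 R" for u k
  proof -
    have "P u k - P u (Suc k) = (- (1 / real n)) *\<^sub>R u"
      unfolding P_def by (simp add: add_divide_distrib algebra_simps flip: scaleR_diff_left)
    then have "dist (P u k) (P u (Suc k)) = norm u / real n" by (simp add: dist_norm)
    also have "\<dots> \<le> R / real n" using that by (intro divide_right_mono) auto
    also have "\<dots> < \<delta> / 4" by (fact n(2))
    finally show ?thesis .
  qed
  define J where "J u k = j (P u k)" for u k
  have J: "J u k \<in> ?D" "dist (P u k) (J u k) < \<delta> / 4" if "u \<in> cball 0 R" "k \<le> n" for u k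
    using j[OF P_in[OF that]] by (auto simp: J_def)
  have J_dist: "dist (J u k) (J v k') < \<delta> / 2 + dist (P u k) (P v k')"
    if "u \<in> cball 0 R" "k \<le> n" "v \<in> cball 0 R" "k' \<le> n" for u v k k'
    using J(2)[OF that(1,2)] J(2)[OF that(3,4)] dist_triangle3[of "J u k" "J v k'" "P u k"]
      dist_triangle[of "P u k" "J v k'" "P v k'"] by linarith
  define F where "F u k = rec_nat \<one>\<^bsub>?Q\<^esub> (\<lambda>k f. f \<otimes>\<^bsub>?Q\<^esub> T (J u k) (J u (Suc k))) k" for u k
  have F_0: "F u 0 = \<one>\<^bsub>?Q\<^esub>" and F_Suc: "F u (Suc k) = F u k \<otimes>\<^bsub>?Q\<^esub> T (J u k) (J u (Suc k))" for u k
    by (simp_all add: F_def)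
  have T_ray: "T (J u k) (J u (Suc k)) \<in> carrier ?Q" if "u \<in> cball 0 R" "Suc k \<le> n" for u k
    using J[of u] J_dist[of u k u "Suc k"] P_step[of u k] that \<delta> by (intro T_closed) auto
  have F_closed: "F u k \<in> carrier ?Q" if "u \<in> cball 0 R" "k \<le> n" for u k
    using that(2)
  proof (induction k)
    case 0
    show ?case unfolding F_0 by (rule Q.one_closed)
  next
    case (Suc k)
    then show ?case unfolding F_Suc by (intro Q.m_closed T_ray that(1)) auto
  qed
  \<comment> \<open>Neighbouring rays bound a ladder. Each of its squares is split by the diagonal
    from \<open>J u k\<close> to \<open>J v (Suc k)\<close> into two triangles on which
    \<open>T\<close> is flat.\<close>
  have F_gauge: "F u k \<otimes>\<^bsub>?Q\<^esub> T (J u k) (J v k) = F v k"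
    if uv: "u \<in> cball 0 R" "v \<in> cball 0 R" "dist u v < \<delta> / 4" and k: "k \<le> n" for u v k
    using k
  proof (induction k)
    case 0
    \<comment> \<open>All rays start at the origin, so the ladder begins with a degenerate
      rung.\<close>
    have "J v 0 = J u 0" by (simp add: J_def P_def)
    then show ?case using T_refl[OF J(1)[OF uv(1)], of 0] by (simp only: F_0 Q.l_one Q.one_closed)
  next
    case (Suc k)
    then have kn: "k \<le> n" "Suc k \<le> n" by auto
    note Jk = J(1)[OF uv(1) kn(1)] J(1)[OF uv(1) kn(2)] J(1)[OF uv(2) kn(1)] J(1)[OF uv(2) kn(2)]
    \<comment> \<open>The two pushes off \<open>K\<close> cost \<delta> / 4 each, a step along a ray
      and a change of ray less than \<delta> / 4 each, so even the diagonal stays below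
      \<delta>.\<close>
    have d: "dist (J u k) (J u (Suc k)) < \<delta>" "dist (J u (Suc k)) (J v (Suc k)) < \<delta>"
      "dist (J u k) (J v k) < \<delta>" "dist (J v k) (J v (Suc k)) < \<delta>" "dist (J u k) (J v (Suc k)) < \<delta>"
      using J_dist[OF uv(1) kn(1) uv(1) kn(2)] J_dist[OF uv(1) kn(2) uv(2) kn(2)] J_dist[OF uv(1) kn(1) uv(2) kn(1)]
        J_dist[OF uv(2) kn(1) uv(2) kn(2)] J_dist[OF uv(1) kn(1) uv(2) kn(2)]
        P_step[OF uv(1), of k] P_step[OF uv(2), of k] P_dist[OF kn(1), of u v] P_dist[OF kn(2), of u v]
        dist_triangle[of "P u k" "P v (Suc k)" "P v k"] uv(3) \<delta>(1) by linarith+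
    have "F u (Suc k) \<otimes>\<^bsub>?Q\<^esub> T (J u (Suc k)) (J v (Suc k)) =
        F u k \<otimes>\<^bsub>?Q\<^esub> (T (J u k) (J u (Suc k)) \<otimes>\<^bsub>?Q\<^esub> T (J u (Suc k)) (J v (Suc k)))"
      unfolding F_Suc by (intro Q.m_assoc F_closed T_closed uv kn Jk d)
    also have "\<dots> = F u k \<otimes>\<^bsub>?Q\<^esub> (T (J u k) (J v k) \<otimes>\<^bsub>?Q\<^esub> T (J v k) (J v (Suc k)))"
      by (simp only: T_flat Jk d)
    also have "\<dots> = F u k \<otimes>\<^bsub>?Q\<^esub> T (J u k) (J v k) \<otimes>\<^bsub>?Q\<^esub> T (J v k) (J v (Suc k))"
      by (intro Q.m_assoc[symmetric] F_closed T_closed uv kn Jk d)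
    finally show ?case by (simp only: Suc.IH[OF kn(1)] F_Suc)
  qed
  have P_n: "P u n = u" for u using n by (simp add: P_def)
  define \<Phi> where "\<Phi> u = F u n" for u
  have \<Phi>_closed: "\<Phi> u \<in> carrier ?Q" if "u \<in> ?D" for u
    unfolding \<Phi>_def using that by (intro F_closed) auto
  have gauge: "\<Phi> u \<otimes>\<^bsub>?Q\<^esub> T u v = \<Phi> v" if "u \<in> ?D" "v \<in> ?D" "dist u v < \<delta> / 4" for u v
    using F_gauge[of u v n] j[of u] j[of v] that by (auto simp: \<Phi>_def J_def P_n)
  have "0 < \<delta> / 4" using \<delta> by simp
  then obtain M :: nat where M: "M > 0" "\<And>k. k < M \<Longrightarrow>
      path_in (ball (p (real k / real M)) (\<delta> / 4) \<inter> ?D) (subpath (real k / real M) (real (Suc k) / real M) p)"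
    using path_subdivision[OF p(1)] by blast
  define c where "c k = subpath (real k / real M) (real (Suc k) / real M) p" for k
  define s where "s k = subpath 0 (real k / real M) p" for k
  define y where "y k = p (real k / real M)" for k
  have t01: "real k / real M \<in> {0..1}" if "k \<le> M" for k using that M(1) by auto
  have y: "y k \<in> ?D" if "k \<le> M" for k
    using p(1) t01[OF that] unfolding y_def path_in_def path_image_def by blast
  have pK: "path_in (- K) p" using p(1) by (rule path_in_subset) blast
  have p0: "p 0 = x" using p(2) by (simp add: pathstart_def)
  have xD: "x \<in> ?D" using y[of 0] p0 by (simp add: y_def)
  have c: "path_in (ball (y k) (\<delta> / 4) - K) (c k)" "pathstart (c k) = y k" "pathfinish (c k) = y (Suc k)" if "k < M" for k
    using M(2)[OF that] path_in_subset[of _ "c k" "ball (y k) (\<delta> / 4) - K"] by (auto simp: c_def y_def)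
  have s: "path_in (- K) (s k)" "pathfinish (s k) = y k" if "k \<le> M" for k
    using path_in_subpath[OF pK _ t01[OF that], of 0] by (auto simp: s_def y_def)
  \<comment> \<open>\<Phi> is a potential for \<open>T\<close>, so the transitions along
    \<open>p\<close> telescope. As \<open>p\<close> is closed, the final value is \<Phi> x again,
    and it can be cancelled.\<close>
  have "\<Phi> x \<otimes>\<^bsub>?Q\<^esub> \<kappa> (s k) = \<Phi> (y k)" if "k \<le> M" for k
    using that
  proof (induction k)
    case 0
    have "s 0 = linepath x x" using p0 by (auto simp: s_def subpath_def linepath_refl)
    then have "\<kappa> (s 0) = \<one>\<^bsub>?Q\<^esub>"
      using cl_refl[OF base] N.subset by (simp add: \<kappa>_def FactGroup_def)
    moreover have "y 0 = x" using p0 by (simp add: y_def)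
    ultimately show ?case using \<Phi>_closed[OF xD] by (simp only: Q.r_one)
  next
    case (Suc k)
    then have k: "k < M" "k \<le> M" by auto
    have d: "dist (y k) (y (Suc k)) < \<delta> / 4"
      using path_in_starts(2)[OF c(1)[OF k(1)]] c(3)[OF k(1)] by simp
    have \<gamma>': "path_in (ball (y k) (\<delta>1 / 4) - K) (\<gamma> (y k) (y (Suc k)))"
      "pathstart (\<gamma> (y k) (y (Suc k))) = y k" "pathfinish (\<gamma> (y k) (y (Suc k))) = y (Suc k)"
      using \<gamma>[OF y[OF k(2)], of "y (Suc k)"] y[OF Suc.prems] d \<delta> by auto
    have "\<kappa> (c k) = T (y k) (y (Suc k))" unfolding T_def
    proof (rule \<kappa>_eq)
      show "path_in (ball (y k) \<delta>1 - K) (c k)" "path_in (ball (y k) \<delta>1 - K) (\<gamma> (y k) (y (Suc k)))"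
        using path_in_ball_mono[OF c(1)[OF k(1)], of "y k" \<delta>1] path_in_ball_mono[OF \<gamma>'(1), of "y k" \<delta>1] \<delta> by auto
    qed (use y[OF k(2)] c[OF k(1)] \<gamma>' in auto)
    moreover have "\<kappa> (s (Suc k)) = \<kappa> (s k) \<otimes>\<^bsub>?Q\<^esub> \<kappa> (c k)"
    proof -
      have "cl (s k +++ c k) = cl (s (Suc k))"
        unfolding s_def c_def
        by (intro cl_homotopic homotopic_join_subpaths)
          (use pK k t01[of k] t01[of "Suc k"] Suc.prems in \<open>auto simp: path_in_def\<close>)
      then have "\<kappa> (s (Suc k)) = \<kappa> (s k +++ c k)" by (simp add: \<kappa>_def)
      then show ?thesis using s[OF k(2)] c[OF k(1)] path_in_K by (simp add: \<kappa>_join)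
    qed
    ultimately have "\<Phi> x \<otimes>\<^bsub>?Q\<^esub> \<kappa> (s (Suc k)) = (\<Phi> x \<otimes>\<^bsub>?Q\<^esub> \<kappa> (s k)) \<otimes>\<^bsub>?Q\<^esub> T (y k) (y (Suc k))"
      using \<Phi>_closed[OF xD] \<kappa>_closed[OF s(1)[OF k(2)]] T_closed[OF y[OF k(2)] y[OF Suc.prems]] d \<delta>
      by (simp only: Q.m_assoc)
    also have "\<dots> = \<Phi> (y (Suc k))" using Suc.IH k gauge[OF y[OF k(2)] y[OF Suc.prems] d] by simp
    finally show ?case .
  qed
  moreover have "s M = p" "y M = x" using M(1) p(3) by (simp_all add: s_def y_def pathfinish_def)
  ultimately have "\<Phi> x \<otimes>\<^bsub>?Q\<^esub> \<kappa> p = \<Phi> x" using order_refl by metis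
  then have "\<kappa> p = \<one>\<^bsub>?Q\<^esub>"
    using Q.l_cancel_one[OF \<Phi>_closed[OF xD] \<kappa>_closed[OF pK]] by (simp only: simp_thms)
  then have "N #>\<^bsub>\<pi>\<^esub> cl p = N" by (simp add: \<kappa>_def FactGroup_def)
  then have "cl p \<in> N" using cl_closed[OF pK] Nsub by (rule fg.coset_join1)
  then show ?thesis by (simp add: N_def)
qed

section \<open>From the ball to the whole complement\<close>

text \<open>Radial projection onto the ball. A point outside moves along its ray without its norm
  dropping below \<open>R\<close>, so the straight-line homotopy never meets \<open>K\<close>, which
  lies in the open ball.\<close>

lemma loop_into_ball:
  assumes K: "K \<subseteq> ball 0 R" and x: "norm x \<le> R" "0 < R"
    and p: "path_in (- K) p" "pathstart p = x" "pathfinish p = x"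
  shows "\<exists>q. path_in (cball 0 R - K) q \<and> pathstart q = x \<and> pathfinish q = x \<and> cl q = cl p"
proof -
  define \<rho> where "\<rho> y = (R / max R (norm y)) *\<^sub>R y" for y :: 'a
  have \<rho>_id: "\<rho> y = y" if "norm y \<le> R" for y using that x by (simp add: \<rho>_def max_def)
  have \<rho>_norm: "norm (\<rho> y) \<le> R" for y using x by (auto simp: \<rho>_def max_def)
  have seg: "closed_segment y (\<rho> y) \<subseteq> - K" if "y \<notin> K" for y
  proof (cases "norm y \<le> R")
    case True
    then show ?thesis using that \<rho>_id by simp
  next
    case False
    have "R \<le> norm z" if z: "z \<in> closed_segment y (\<rho> y)" for z
    proof -
      obtain s where s: "0 \<le> s" "s \<le> 1" "z = (1 - s) *\<^sub>R y + s *\<^sub>R \<rho> y" using z by (auto simp: in_segment)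
      then have "z = ((1 - s) + s * (R / norm y)) *\<^sub>R y" using False by (simp add: \<rho>_def max_def algebra_simps)
      then have "norm z = \<bar>(1 - s) + s * (R / norm y)\<bar> * norm y" by simp
      also have "\<dots> = ((1 - s) + s * (R / norm y)) * norm y" using s x by simp
      also have "\<dots> = (1 - s) * norm y + s * R" using x False by (cases "y = 0") (simp_all add: field_simps)
      also have "\<dots> \<ge> (1 - s) * R + s * R" using s False by (intro add_mono mult_left_mono) auto
      finally show ?thesis by (simp add: algebra_simps)
    qed
    then show ?thesis using K by fastforce
  qed
  have cont: "continuous_on UNIV \<rho>" unfolding \<rho>_def by (intro continuous_intros) (use x in auto)
  have pq: "path p" "\<And>t. t \<in> {0..1} \<Longrightarrow> p t \<notin> K" using p(1) unfolding path_in_def path_image_def by blast+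
  have "path (\<rho> \<circ> p)" using pq(1) continuous_on_subset[OF cont] by (intro path_continuous_image) auto
  moreover have "(\<rho> \<circ> p) t \<in> cball 0 R - K" if "t \<in> {0..1}" for t
    using \<rho>_norm seg[OF pq(2)[OF that]] by auto
  ultimately have "path_in (cball 0 R - K) (\<rho> \<circ> p)" unfolding path_in_def path_image_def by blast
  moreover have "homotopic_paths (- K) p (\<rho> \<circ> p)"
    using pq(1) \<open>path (\<rho> \<circ> p)\<close> p \<rho>_id[OF x(1)] seg[OF pq(2)]
    by (intro homotopic_paths_linear) (auto simp: pathstart_compose pathfinish_compose)
  ultimately show ?thesis using p \<rho>_id[OF x(1)] cl_homotopic
    by (intro exI[of _ "\<rho> \<circ> p"]) (auto simp: pathstart_compose pathfinish_compose)
qed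

text \<open>Once every loop is moved into one large ball, both generation results for that ball hold
  for the whole group, and \<open>finite_generating_subset\<close> extracts finitely many
  conjugates.\<close>

lemma generated_by_finitely_many_conjugates:
  "\<exists>F. finite F \<and> F \<subseteq> carrier \<pi> \<and> carrier \<pi> = generate \<pi> (conj_m ` F)"
proof -
  have "bounded (insert x K)" using compact_imp_bounded[OF compact_K] by simp
  then obtain R where R: "0 < R" "insert x K \<subseteq> ball 0 R" using bounded_subset_ballD by blast
  then have K: "K \<subseteq> ball 0 R" and x: "norm x \<le> R" "x \<in> cball 0 R" by auto
  have reduce: "z \<in> H" if z: "z \<in> carrier \<pi>"
    and H: "\<And>p. path_in (cball 0 R - K) p \<Longrightarrow> pathstart p = x \<Longrightarrow> pathfinish p = x \<Longrightarrow> cl p \<in> H" for z H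
  proof -
    obtain p where p: "p \<in> loops_at (- K) x" "z = path_class (- K) p"
      using z by (auto simp: fundamental_group_def)
    then have "path_in (- K) p" "pathstart p = x" "pathfinish p = x" by (auto simp: loops_at_def path_in_def)
    then obtain q where "path_in (cball 0 R - K) q" "pathstart q = x" "pathfinish q = x" "cl q = cl p"
      using loop_into_ball[OF K x(1) R(1)] by blast
    with H p cl_loop show ?thesis by metis
  qed
  have conj: "conj_m ` carrier \<pi> \<subseteq> carrier \<pi>" using conj_m_closed by blast
  have "carrier \<pi> \<subseteq> generate \<pi> (conj_m ` carrier \<pi>)"
    using reduce loop_in_normal_closure[OF K] by blast
  then have 1: "carrier \<pi> = generate \<pi> (conj_m ` carrier \<pi>)"
    using fg.generate_incl[OF conj] by blast
  obtain E where E: "finite E" "E \<subseteq> carrier \<pi>" "\<forall>p. path_in (cball 0 R - K) p \<and>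
      pathstart p = x \<and> pathfinish p = x \<longrightarrow> cl p \<in> generate \<pi> E"
    using finitely_generated_loops[OF x(2)] by blast
  have "carrier \<pi> \<subseteq> generate \<pi> E" using reduce E(3) by blast
  then have 2: "carrier \<pi> = generate \<pi> E" using fg.generate_incl[OF E(2)] by blast
  obtain B where B: "B \<subseteq> conj_m ` carrier \<pi>" "finite B" "carrier \<pi> = generate \<pi> B"
    using fg.finite_generating_subset[OF 1 E(1) 2 conj] by blast
  obtain F where "F \<subseteq> carrier \<pi>" "finite F" "B = conj_m ` F"
    using finite_subset_image[OF B(2,1)] by blast
  with B(3) show ?thesis by blast
qed

end

text \<open>The tube supplies the neighbourhoods required by \<open>meridional_complement\<close>:
  in its pieces loops are computed in the universal covering, and in balls off \<open>K\<close> they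
  contract.\<close>

lemma knot_group_generated_by_meridians:
  assumes "x \<in> - K" "meridian_longitude K x m l"
  shows "\<exists>F. finite F \<and> F \<subseteq> carrier (knot_group K x) \<and> carrier (knot_group K x) =
    generate (knot_group K x) ((\<lambda>g. g \<otimes>\<^bsub>knot_group K x\<^esub> m \<otimes>\<^bsub>knot_group K x\<^esub> inv\<^bsub>knot_group K x\<^esub> g) ` F)"
    and "m \<in> carrier (knot_group K x)"
proof -
  let ?G = "knot_group K x"
  obtain \<Phi> g where tub: "tubular_neighbourhood K \<Phi>"
    and g: "path g" "path_image g \<subseteq> - K" "pathstart g = x" "pathfinish g = \<Phi> (1, 1)"
    and m: "m = path_class (- K) (g +++ (\<lambda>t. \<Phi> (1, cis (2 * pi * t))) +++ reversepath g)"
    using assms(2) unfolding meridian_longitude_def by blast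
  have g': "path_in (- K) g" using g by (simp add: path_in_def)
  obtain a where "based_paths (- K) x a"
    using based_paths_exist[OF path_connected_complement[OF tub] assms(1)] by blast
  then interpret based_paths "- K" x a .
  \<comment> \<open>The circle of the meridian lifts to a segment in the boundary Re w = 0 of
    \<open>tube_lift\<close>.\<close>
  have seg: "path_in (tube_lift) (linepath (0, 0) (0, 2 * pi * \<i>))"
    using closed_segment_subset[OF _ _ convex_tube_lift[OF tub], of "(0, 0)" "(0, 2 * pi * \<i>)"]
    by (simp add: path_in_def tube_lift_def[OF tub])
  have "path_in (- K) (tube_exp \<Phi> \<circ> linepath (0, 0) (0, 2 * pi * \<i>))"
    using seg path_continuous_image[of _ "tube_exp \<Phi>"] continuous_on_subset[OF continuous_on_tube_exp[OF tub]]
      tube_exp_in[OF tub] unfolding path_in_def path_image_compose by blast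
  moreover have "tube_exp \<Phi> \<circ> linepath (0, 0) (0, 2 * pi * \<i>) = (\<lambda>t. \<Phi> (1, cis (2 * pi * t)))"
    by (rule ext) (simp add: tube_exp_def[OF tub] linepath_def cis_conv_exp scaleR_conv_of_real mult_ac)
  ultimately have circle: "path_in (- K) (\<lambda>t. \<Phi> (1, cis (2 * pi * t)))" by simp
  have circle_ends: "pathstart (\<lambda>t. \<Phi> (1, cis (2 * pi * t))) = \<Phi> (1, 1)"
    "pathfinish (\<lambda>t. \<Phi> (1, cis (2 * pi * t))) = \<Phi> (1, 1)"
    by (simp_all add: pathstart_def pathfinish_def)
  have "path_in (- K) (g +++ (\<lambda>t. \<Phi> (1, cis (2 * pi * t))) +++ reversepath g)"
    using g g' circle circle_ends by (intro path_in_join) auto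
  then have "g +++ (\<lambda>t. \<Phi> (1, cis (2 * pi * t))) +++ reversepath g \<in> loops_at (- K) x"
    using g by (auto simp: loops_at_def path_in_def)
  then show mG: "m \<in> carrier ?G" unfolding m fundamental_group_def by simp
  have "meridional_complement K x a m"
  proof (unfold_locales)
    show "compact K" by (rule compact_K[OF tub])
    fix e :: real and y assume "0 < e"
    then obtain U where U: "open U" "y \<in> U" "U \<subseteq> ball y e" "path_connected (U - K)" "U - K \<noteq> {}"
      "(\<exists>t0 \<eta>. 0 < \<eta> \<and> \<eta> < 1 \<and> U = tube_piece \<Phi> t0 \<eta>) \<or> convex U \<and> U \<inter> K = {}"
      using complement_piece[OF tub] by metis
    have "\<exists>h\<in>carrier ?G. \<forall>q. path_in (U - K) q \<and> pathstart q = u \<and> pathfinish q = u \<longrightarrow>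
        cl q \<in> generate ?G {h \<otimes>\<^bsub>?G\<^esub> m \<otimes>\<^bsub>?G\<^esub> inv\<^bsub>?G\<^esub> h}" if u: "u \<in> U - K" for u
      using U(6)
    proof
      assume "\<exists>t0 \<eta>. 0 < \<eta> \<and> \<eta> < 1 \<and> U = tube_piece \<Phi> t0 \<eta>"
      then obtain t0 \<eta> where \<eta>: "0 < \<eta>" "\<eta> < 1" "U = tube_piece \<Phi> t0 \<eta>" by blast
      show ?thesis
        using piece_loops[OF tub \<open>based_paths (- K) x a\<close> g' g(3,4) m \<eta>(1,2)] u unfolding \<eta>(3) by blast
    next
      assume U': "convex U \<and> U \<inter> K = {}"
      \<comment> \<open>Contractible loops give the unit, which lies in every subgroup; the unit is
        taken as conjugating element.\<close>
      have "cl q \<in> generate ?G {\<one>\<^bsub>?G\<^esub> \<otimes>\<^bsub>?G\<^esub> m \<otimes>\<^bsub>?G\<^esub> inv\<^bsub>?G\<^esub> \<one>\<^bsub>?G\<^esub>}"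
        if q: "path_in (U - K) q" "pathstart q = u" "pathfinish q = u" for q
      proof -
        have "path_in U q" using q(1) by (rule path_in_subset) blast
        then have "homotopic_paths U q (linepath u u)"
          using U' u q by (intro homotopic_paths_convex) (auto simp: path_in_linepath_refl)
        then have "homotopic_paths (- K) q (linepath u u)"
          by (rule homotopic_paths_subset) (use U' in blast)
        then have "cl q = \<one>\<^bsub>?G\<^esub>" using cl_homotopic cl_refl[of u] u by auto
        then show ?thesis by (simp add: generate.one)
      qed
      then show ?thesis using fg.one_closed by blast
    qed
    then show "\<exists>U. open U \<and> y \<in> U \<and> U \<subseteq> ball y e \<and> path_connected (U - K) \<and> U - K \<noteq> {} \<and>
      (\<forall>u\<in>U - K. \<exists>h\<in>carrier ?G. \<forall>q. path_in (U - K) q \<and> pathstart q = u \<and> pathfinish q = u \<longrightarrow>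
        cl q \<in> generate ?G {h \<otimes>\<^bsub>?G\<^esub> m \<otimes>\<^bsub>?G\<^esub> inv\<^bsub>?G\<^esub> h})"
      by (intro exI[of _ U] conjI ballI U(1-5))
  qed (rule mG)
  then show "\<exists>F. finite F \<and> F \<subseteq> carrier ?G \<and> carrier ?G =
      generate ?G ((\<lambda>g. g \<otimes>\<^bsub>?G\<^esub> m \<otimes>\<^bsub>?G\<^esub> inv\<^bsub>?G\<^esub> g) ` F)"
    by (rule meridional_complement.generated_by_finitely_many_conjugates)
qed

section \<open>Stabilization\<close>

theorem corollary3p8:
  fixes K :: "(real^3) set" and x :: "real^3"
    and m l :: "(real \<Rightarrow> real^3) set"
  assumes "is_knot K"
    and "x \<in> - K"
    and "meridian_longitude K x m l"
  shows "\<exists>N\<ge>1. \<forall>n\<ge>N.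
    (A_polynomial_defined (knot_group K x) m l n \<longleftrightarrow>
       A_polynomial_defined (knot_group K x) m l N) \<and>
    (\<forall>p q. is_A_polynomial (knot_group K x) m l n p \<longrightarrow>
       is_A_polynomial (knot_group K x) m l N q \<longrightarrow> equal_up_to_unit p q)"
proof -
  let ?G = "knot_group K x"
  have G: "group ?G" using assms(2) by (rule group_fundamental_group)
  have m: "m \<in> carrier ?G" using assms(2,3) by (rule knot_group_generated_by_meridians)
  have "derived ?G (carrier ?G) \<subseteq> carrier ?G" using group.derived_in_carrier[OF G] by blast
  then have l: "l \<in> carrier ?G" using assms(3) unfolding meridian_longitude_def by blast
  obtain F where F: "finite F" "F \<subseteq> carrier ?G"
    "carrier ?G = generate ?G ((\<lambda>g. g \<otimes>\<^bsub>?G\<^esub> m \<otimes>\<^bsub>?G\<^esub> inv\<^bsub>?G\<^esub> g) ` F)"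
    using knot_group_generated_by_meridians(1)[OF assms(2,3)] by blast
  obtain N where N: "N \<ge> 1" "\<forall>n\<ge>N. KCH_eigenvalues ?G m l n = KCH_eigenvalues ?G m l N"
    using KCH_eigenvalues_stabilize[OF G m l F] by (elim exE conjE)
  \<comment> \<open>Definedness and the zero locus depend on the degree only through this closure,
    so the equality of eigenvalue sets settles both.\<close>
  have closure: "KCH_closure ?G m l n = KCH_closure ?G m l N" if "n \<ge> N" for n
    unfolding KCH_closure_def N(2)[rule_format, OF that] ..
  show ?thesis
  proof (intro exI[of _ N] conjI allI impI)
    fix n assume n: "n \<ge> N"
    show "A_polynomial_defined ?G m l n \<longleftrightarrow> A_polynomial_defined ?G m l N"
      unfolding A_polynomial_defined_def closure[OF n] ..
    fix p q assume "is_A_polynomial ?G m l n p" "is_A_polynomial ?G m l N q"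
    then show "equal_up_to_unit p q"
      unfolding is_A_polynomial_def closure[OF n] by (intro squarefree_laurent_unique) auto
  qed (rule N(1))
qed

end
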